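(* Let $F$ be a Haar system space for which the Haar system $(h_j)_{j\ge1}$ is an unconditional Schauder basis, and assume that the Rademacher sequence $(r_n)_{n=1}^\infty$, $r_n=\sum_{I\in\mathcal D_n}h_I$, is weakly null in $F$. Let $\delta>0$ and let $T:F\to F$ be a bounded linear operator such that for every $j\in\mathbb N$ $$|\langle Th_j,h_j\rangle|\ \ge\ \delta\,\|h_j\|_F\,\|h_j\|_{F^*}=\delta|I_j| .$$ Then the identity operator $I_F$ on $F$ factors through $T$: there exist bounded linear operators $A,B:F\to F$ such that $I_F=BTA$.
   Context: Scalars are real; $\mathbb N=\{1,2,\dots\}$; functions live on $[0,1)$ (equivalently $[0,1]$) and $|\cdot|$ of a set is Lebesgue measure. Dyadic intervals: $\mathcal D=\{[\frac{i-1}{2^n},\frac{i}{2^n}): n\ge 0,\ 1\le i\le 2^n\}$, $\mathcal D_n=\{J\in\mathcal D:|J|=2^{-n}\}$, $\mathcal D^+=\mathcal D\cup\{\emptyset\}$. Enumerate $\mathcal D^+$ as $(I_j)_{j\ge1}$ by $I_1=\emptyset$ and $I_{2^n+i}=[\frac{i-1}{2^n},\frac{i}{2^n})$. The Haar function of $I\in\mathcal D$ is $h_I=\chi_{I^+}-\chi_{I^-}$, where $I^+$ and $I^-$ are the left and right halves of $I$; $h_\emptyset=\chi_{[0,1)}$; $h_j=h_{I_j}$. In expressions of the form $\delta|I_j|$, for $j=1$ the quantity $|I_1|$ is understood as $1$ (the measure of the support of $h_1$). A Haar system space $F$ is the completion of $Z=\mathrm{span}\{h_L:L\in\mathcal D^+\}=\mathrm{span}\{\chi_I:I\in\mathcal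 D\}$ under a norm $\|\cdot\|_F$ such that (1) if $f,g\in Z$ and $|f|,|g|$ have the same distribution then $\|f\|_F=\|g\|_F$; (2) $\|\chi_{[0,1)}\|_F=1$. Such a space is naturally identified with a space of measurable functions contained in $L_1[0,1]$, and $(h_j)_{j\ge1}$ is a monotone Schauder basis of it. Each $g\in Z$ is viewed as an element of $F^*$ via $\langle f,g\rangle=\int_0^1 f(x)g(x)\,dx$, $f\in F$, and $\|g\|_{F^*}$ is its norm in $F^*$. *)

theory Defs
  imports "HOL-Analysis.Analysis" "HOL-Library.Discrete_Functions"
begin

definition dyadic_interval :: "nat \<Rightarrow> nat \<Rightarrow> real set" where
  "dyadic_interval n i = {(real i - 1) / 2 ^ n ..< real i / 2 ^ n}"

definition dyadic :: "real set set" where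
  "dyadic = {dyadic_interval n i | n i. 1 \<le> i \<and> i \<le> 2 ^ n}"

definition dyadic_level :: "nat \<Rightarrow> real set set" where
  "dyadic_level n = {J \<in> dyadic. measure lebesgue J = 1 / 2 ^ n}"

definition dyadic_plus :: "real set set" where
  "dyadic_plus = insert {} dyadic"

text \<open>The enumeration of \<open>dyadic_plus\<close> starts at index 1; the value at index 0 is irrelevant.
  See \<open>haar_interval_enum\<close> below for its defining property.\<close>

definition haar_interval :: "nat \<Rightarrow> real set" where
  "haar_interval j =
     (if j \<le> 1 then {}
      else dyadic_interval (floor_log (j - 1)) (j - 2 ^ floor_log (j - 1)))"

definition left_half :: "real set \<Rightarrow> real set" where
  "left_half I = {Inf I ..< (Inf I + Sup I) / 2}"

definition right_half :: "real set \<Rightarrow> real set" where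
  "right_half I = {(Inf I + Sup I) / 2 ..< Sup I}"

definition haar :: "real set \<Rightarrow> real \<Rightarrow> real" where
  "haar I = (if I = {} then indicator {0..<1}
             else (\<lambda>t. indicator (left_half I) t - indicator (right_half I) t))"

definition haar_seq :: "nat \<Rightarrow> real \<Rightarrow> real" where
  "haar_seq j = haar (haar_interval j)"

definition rademacher :: "nat \<Rightarrow> real \<Rightarrow> real" where
  "rademacher n = (\<lambda>t. \<Sum>I\<in>dyadic_level n. haar I t)"

text \<open>The span of the Haar functions. Its elements are functions on the whole real line that
  vanish outside \<open>{0..<1}\<close>, so equality of functions on \<open>{0..<1}\<close> is equality in
  \<open>real \<Rightarrow> real\<close>.\<close>

definition haar_span :: "(real \<Rightarrow> real) set" where
  "haar_span = {\<lambda>t. \<Sum>L\<in>S. c L * haar L t | S c. finite S \<and> S \<subseteq> dyadic_plus}"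

definition same_distribution :: "(real \<Rightarrow> real) \<Rightarrow> (real \<Rightarrow> real) \<Rightarrow> bool" where
  "same_distribution f g \<longleftrightarrow>
     distr (lebesgue_on {0..<1}) borel f = distr (lebesgue_on {0..<1}) borel g"

definition norm_on_haar_span :: "((real \<Rightarrow> real) \<Rightarrow> real) \<Rightarrow> bool" where
  "norm_on_haar_span N \<longleftrightarrow>
     (\<forall>f\<in>haar_span. 0 \<le> N f \<and> (N f = 0 \<longleftrightarrow> f = (\<lambda>t. 0))) \<and>
     (\<forall>f\<in>haar_span. \<forall>c. N (\<lambda>t. c * f t) = \<bar>c\<bar> * N f) \<and>
     (\<forall>f\<in>haar_span. \<forall>g\<in>haar_span. N (\<lambda>t. f t + g t) \<le> N f + N g)"

definition haar_system_norm :: "((real \<Rightarrow> real) \<Rightarrow> real) \<Rightarrow> bool" where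
  "haar_system_norm N \<longleftrightarrow>
     norm_on_haar_span N \<and>
     (\<forall>f\<in>haar_span. \<forall>g\<in>haar_span.
        same_distribution (\<lambda>t. \<bar>f t\<bar>) (\<lambda>t. \<bar>g t\<bar>) \<longrightarrow> N f = N g) \<and>
     N (indicator {0..<1}) = 1"

text \<open>The Banach space \<open>'f\<close> is a completion of the normed space \<open>(haar_span, N)\<close>, with \<open>\<iota>\<close> the
  canonical embedding; values of \<open>\<iota>\<close> outside \<open>haar_span\<close> are irrelevant. The type \<open>'f\<close> is thus
  the Haar system space determined by \<open>N\<close>.\<close>

definition haar_system_space ::
    "((real \<Rightarrow> real) \<Rightarrow> real) \<Rightarrow> ((real \<Rightarrow> real) \<Rightarrow> 'f::banach) \<Rightarrow> bool" where
  "haar_system_space N \<iota> \<longleftrightarrow>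
     haar_system_norm N \<and>
     (\<forall>f\<in>haar_span. \<forall>g\<in>haar_span. \<iota> (\<lambda>t. f t + g t) = \<iota> f + \<iota> g) \<and>
     (\<forall>f\<in>haar_span. \<forall>c. \<iota> (\<lambda>t. c * f t) = c *\<^sub>R \<iota> f) \<and>
     (\<forall>f\<in>haar_span. norm (\<iota> f) = N f) \<and>
     closure (\<iota> ` haar_span) = UNIV"

text \<open>The identification of elements of the completion with integrable functions on \<open>{0..<1}\<close>:
  \<open>x\<close> is identified with \<open>u\<close> if some sequence in \<open>haar_span\<close> tends to \<open>x\<close> in the completion and
  to \<open>u\<close> in mean. Since the norm of a Haar system space dominates the \<open>L\<^sub>1\<close> norm on
  \<open>haar_span\<close>, such a \<open>u\<close> exists for every \<open>x\<close> and is unique almost everywhere.\<close>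

definition represents ::
    "((real \<Rightarrow> real) \<Rightarrow> 'f::banach) \<Rightarrow> 'f \<Rightarrow> (real \<Rightarrow> real) \<Rightarrow> bool" where
  "represents \<iota> x u \<longleftrightarrow>
     integrable (lebesgue_on {0..<1}) u \<and>
     (\<exists>z. (\<forall>n::nat. z n \<in> haar_span) \<and>
          (\<lambda>n. \<iota> (z n)) \<longlonglongrightarrow> x \<and>
          (\<lambda>n. \<integral>t. \<bar>z n t - u t\<bar> \<partial>lebesgue_on {0..<1}) \<longlonglongrightarrow> 0)"

definition as_function :: "((real \<Rightarrow> real) \<Rightarrow> 'f::banach) \<Rightarrow> 'f \<Rightarrow> real \<Rightarrow> real" where
  "as_function \<iota> x = (SOME u. represents \<iota> x u)"

definition pairing :: "((real \<Rightarrow> real) \<Rightarrow> 'f::banach) \<Rightarrow> 'f \<Rightarrow> (real \<Rightarrow> real) \<Rightarrow> real" where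
  "pairing \<iota> x g = (\<integral>t. as_function \<iota> x t * g t \<partial>lebesgue_on {0..<1})"

definition dual_norm :: "((real \<Rightarrow> real) \<Rightarrow> 'f::banach) \<Rightarrow> (real \<Rightarrow> real) \<Rightarrow> real" where
  "dual_norm \<iota> g = onorm (\<lambda>x. pairing \<iota> x g)"

definition schauder_basis :: "(nat \<Rightarrow> 'f::banach) \<Rightarrow> bool" where
  "schauder_basis e \<longleftrightarrow> (\<forall>x. \<exists>!a. (\<lambda>j. a j *\<^sub>R e j) sums x)"

definition unconditional_schauder_basis :: "(nat \<Rightarrow> 'f::banach) \<Rightarrow> bool" where
  "unconditional_schauder_basis e \<longleftrightarrow>
     schauder_basis e \<and>
     (\<forall>x a. (\<lambda>j. a j *\<^sub>R e j) sums x \<longrightarrow> ((\<lambda>j. a j *\<^sub>R e j) has_sum x) UNIV)"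

definition weakly_null :: "(nat \<Rightarrow> 'f::real_normed_vector) \<Rightarrow> bool" where
  "weakly_null x \<longleftrightarrow>
     (\<forall>\<phi>::'f \<Rightarrow> real. bounded_linear \<phi> \<longrightarrow> (\<lambda>n. \<phi> (x n)) \<longlonglongrightarrow> 0)"

lemma haar_interval_one: "haar_interval 1 = {}"
  by (simp add: haar_interval_def)

lemma haar_interval_enum:
  assumes "1 \<le> i" "i \<le> 2 ^ n"
  shows "haar_interval (2 ^ n + i) = dyadic_interval n i"
proof -
  have "floor_log (2 ^ n + i - 1) = n"
    by (rule floor_log_eqI) (use assms in auto)
  moreover have "\<not> 2 ^ n + i \<le> 1"
    using assms one_le_power[of "2::nat" n] by linarith
  ultimately show ?thesis
    by (simp add: haar_interval_def)
qed

lemma haar_dyadic_interval: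
  "haar (dyadic_interval n i) =
     (\<lambda>t. indicator (dyadic_interval (Suc n) (2 * i - 1)) t
          - indicator (dyadic_interval (Suc n) (2 * i)) t)" if "1 \<le> i"
proof -
  have lt: "(real i - 1) / 2 ^ n < real i / 2 ^ n"
    by (simp add: divide_strict_right_mono)
  have mid: "((real i - 1) / 2 ^ n + real i / 2 ^ n) / 2 = (2 * real i - 1) / 2 ^ Suc n"
    by (simp add: field_simps)
  have r: "real (2 * i - 1) = 2 * real i - 1"
    using that by simp
  have ends: "(2 * real i - 1 - 1) / 2 ^ Suc n = (real i - 1) / 2 ^ n"
    "real (2 * i) / 2 ^ Suc n = real i / 2 ^ n"
    "real (2 * i) - 1 = 2 * real i - 1"
    by (simp_all add: field_simps)
  show ?thesis
    unfolding haar_def left_half_def right_half_def dyadic_interval_def r ends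
    using lt by (simp only: cInf_atLeastLessThan cSup_atLeastLessThan mid) simp
qed

lemma dyadic_level_eq: "dyadic_level n = dyadic_interval n ` {1..2 ^ n}"
proof -
  have m: "measure lebesgue (dyadic_interval k i) = 1 / 2 ^ k" for k i
  proof -
    have "(real i - 1) / 2 ^ k \<le> real i / 2 ^ k"
      by (simp add: divide_right_mono)
    then show ?thesis
      by (simp add: dyadic_interval_def diff_divide_distrib)
  qed
  show ?thesis
    by (auto simp: dyadic_level_def dyadic_def m) blast
qed

end

theory Submission
  imports Defs
begin

text \<open>The space contains a copy of the Haar system on which \<open>T\<close> is almost diagonal, and there \<open>T\<close> can be
inverted by a Neumann series.

The copy consists of blocks. The Haar functions are numbered from \<open>0\<close> in heap order, so that
number \<open>0\<close> is the constant function and the left and right halves of the support of number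
\<open>k \<ge> 1\<close> carry the numbers \<open>2 k\<close> and \<open>2 k + 1\<close>. The block \<open>F 0\<close> is the constant function
itself; for \<open>k \<ge> 1\<close> the block \<open>F k\<close> is a sum of Haar functions of one high level with signs, taken
over those that live on a set \<open>G k\<close>. Here \<open>G 1\<close> is the whole unit
interval, and \<open>G (2 k)\<close>, \<open>G (2 k + 1)\<close> are the sets where \<open>F k\<close> equals \<open>1\<close> and \<open>- 1\<close>. The blocks thus
have the joint distribution of the Haar functions.

Two facts about the norm follow, both from its invariance under permutations of the dyadic
intervals of a level (\<open>N_equal_fibres\<close>). The linear map \<open>A\<close> that sends the \<open>k\<close>-th Haar function to
\<open>F k\<close> is an isometry (\<open>block_embedding\<close>). The linear map \<open>B\<close> that reads off the coefficients of a
function against the blocks and puts them back on the Haar functions is a contraction, because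
it is in essence a conditional expectation, hence an average of rearrangements
(\<open>block_averaging\<close>). Therefore the matrix of \<open>B \<circ> T \<circ> A\<close> in the Haar basis has the entries
\<open>\<langle>T (F k), F j\<rangle> / |I j|\<close>.

The blocks can be chosen one after another so that this matrix is good (\<open>block_exists\<close>).
\<^item> Entries off the diagonal are as small as desired. If \<open>y\<close> is fixed then \<open>\<langle>y, h\<rangle>\<close> summed in modulus
  over all Haar functions \<open>h\<close> of level \<open>n\<close> tends to \<open>0\<close>, since step functions are orthogonal to high
  levels. If \<open>\<phi>\<close> is a fixed functional then \<open>\<phi> h\<close> summed in modulus over the level tends to \<open>0\<close> as
  well: a multiplier with suitable signs, bounded by unconditionality, turns this sum into the
  value of one bounded functional at the Rademacher function of that level, and the Rademacher
  functions are weakly null.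
\<^item> Diagonal entries stay at least \<open>\<delta>\<close>. After composing \<open>T\<close> with a multiplier of signs the numbers
  \<open>\<langle>T h, h\<rangle>\<close> are positive, and for a suitable choice of signs in the block the mixed terms of
  \<open>\<langle>T (F k), F k\<rangle>\<close> add up to something nonnegative (\<open>good_signs_exist\<close>).

A multiplier then divides by the diagonal, which is bounded below, and the result differs from
the identity by an operator of norm at most \<open>1/2\<close> (\<open>near_identity_if_small_off_diagonal\<close>).\<close>

section \<open>Tools from functional analysis\<close>

text \<open>By Baire's theorem one of the closed sets on which all operators are bounded by \<open>k\<close>
  contains a ball.\<close>

lemma banach_steinhaus:
  fixes F :: "'i \<Rightarrow> 'a::banach \<Rightarrow> 'b::real_normed_vector"
  assumes lin: "\<And>i. bounded_linear (F i)"
    and pw: "\<And>x. \<exists>C. \<forall>i. norm (F i x) \<le> C"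
  obtains C where "\<And>i x. norm (F i x) \<le> C * norm x"
proof -
  define U where "U k = {x. \<forall>i. norm (F i x) \<le> real k}" for k :: nat
  have clo: "closed (U k)" for k
  proof -
    have "U k = (\<Inter>i. {x. norm (F i x) \<le> real k})"
      by (auto simp: U_def)
    moreover have "closed {x. norm (F i x) \<le> real k}" for i
      by (intro closed_Collect_le continuous_on_norm continuous_on_const
          linear_continuous_on lin)
    ultimately show ?thesis by auto
  qed
  have "\<Union> (range U) = UNIV"
  proof -
    have "\<exists>k. x \<in> U k" for x
    proof -
      obtain C where "\<forall>i. norm (F i x) \<le> C" using pw by blast
      moreover obtain k :: nat where "C \<le> real k" using real_arch_simple by blast
      ultimately show ?thesis unfolding U_def by (blast intro: order_trans)
    qed
    then show ?thesis by auto
  qed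
  have "\<exists>k. interior (U k) \<noteq> {}"
  proof (rule ccontr)
    assume "\<not> ?thesis"
    then have "Met_TC.mtopology interior_of \<Union> (range U) = {}"
      by (intro Met_TC.metric_Baire_category_alt) (auto simp: clo complete_UNIV interior_of_def interior_def)
    with \<open>\<Union> (range U) = UNIV\<close> show False
      by simp
  qed
  then obtain k x0 e where e: "e > 0" "cball x0 e \<subseteq> U k"
    by (meson all_not_in_conv mem_interior_cball)
  have "norm (F i x) \<le> (2 * real k / e) * norm x" for i x
  proof (cases "x = 0")
    case True
    then show ?thesis using bounded_linear.linear[OF lin[of i]] linear_0 by fastforce
  next
    case False
    interpret F: bounded_linear "F i" by (rule lin)
    define y where "y = (e / norm x) *\<^sub>R x"
    have "norm y = e" using False e by (simp add: y_def)
    then have "x0 + y \<in> U k" "x0 \<in> U k"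
      using e by (auto intro!: subsetD[OF e(2)] simp: dist_norm)
    then have "norm (F i (x0 + y)) \<le> k" "norm (F i x0) \<le> k"
      by (auto simp: U_def)
    moreover have "F i y = F i (x0 + y) - F i x0" by (simp add: F.add)
    ultimately have "norm (F i y) \<le> 2 * k"
      using norm_triangle_ineq4[of "F i (x0 + y)" "F i x0"] by simp
    moreover have "norm (F i y) = (e / norm x) * norm (F i x)"
      using e(1) by (simp add: y_def F.scaleR)
    ultimately show ?thesis
      using e(1) False by (simp add: field_simps)
  qed
  then show thesis by (rule that)
qed

text \<open>As a function of each single coefficient the norm is convex, so it is largest when every
  coefficient is \<open>0\<close> or \<open>1\<close>. The vector \<open>w\<close> collects the terms already
  treated in the induction.\<close>

lemma norm_sum_subunit_coeffs_le:
  fixes v :: "'i \<Rightarrow> 'a::real_normed_vector"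
  assumes "finite A"
    and "\<And>j. j \<in> A \<Longrightarrow> 0 \<le> m j \<and> m j \<le> 1"
    and "\<And>B. B \<subseteq> A \<Longrightarrow> norm (w + (\<Sum>j\<in>B. v j)) \<le> R"
  shows "norm (w + (\<Sum>j\<in>A. m j *\<^sub>R v j)) \<le> R"
  using assms
proof (induction A arbitrary: w rule: finite_induct)
  case empty
  then show ?case by auto
next
  case (insert a A)
  have 1: "norm ((w + v a) + (\<Sum>j\<in>A. m j *\<^sub>R v j)) \<le> R"
  proof (rule insert.IH)
    fix B assume B: "B \<subseteq> A"
    with insert.hyps have "finite B" "a \<notin> B" by (auto intro: finite_subset)
    then show "norm (w + v a + sum v B) \<le> R"
      using insert.prems(2)[of "insert a B"] B by (auto simp: add.assoc)
  qed (use insert.prems in auto)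
  have 2: "norm (w + (\<Sum>j\<in>A. m j *\<^sub>R v j)) \<le> R"
    using insert.prems by (intro insert.IH) auto
  let ?s = "\<Sum>j\<in>A. m j *\<^sub>R v j"
  have m: "0 \<le> m a" "m a \<le> 1" using insert.prems by auto
  have "w + (\<Sum>j\<in>insert a A. m j *\<^sub>R v j) = m a *\<^sub>R ((w + v a) + ?s) + (1 - m a) *\<^sub>R (w + ?s)"
    using insert.hyps by (simp add: algebra_simps)
  also have "norm \<dots> \<le> m a * R + (1 - m a) * R"
    using 1 2 m by (intro norm_triangle_le add_mono) (auto intro: mult_left_mono)
  finally show ?case by (simp add: algebra_simps)
qed

lemma bounded_linear_dense_extension:
  fixes \<phi> :: "'a::real_normed_vector \<Rightarrow> 'b::banach"
  assumes X: "subspace X" "closure X = UNIV"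
    and add: "\<And>x y. x \<in> X \<Longrightarrow> y \<in> X \<Longrightarrow> \<phi> (x + y) = \<phi> x + \<phi> y"
    and scale: "\<And>c x. x \<in> X \<Longrightarrow> \<phi> (c *\<^sub>R x) = c *\<^sub>R \<phi> x"
    and bd: "\<And>x. x \<in> X \<Longrightarrow> norm (\<phi> x) \<le> K * norm x"
  obtains G where "bounded_linear G" "\<And>x. x \<in> X \<Longrightarrow> G x = \<phi> x" "\<And>x. norm (G x) \<le> K * norm x"
proof -
  have diff: "\<phi> (x - y) = \<phi> x - \<phi> y" if "x \<in> X" "y \<in> X" for x y
    using add[of x "(- 1) *\<^sub>R y"] scale[of y "- 1"] that X(1)
    by (simp add: subspace_neg)
  have "\<bar>K\<bar>-lipschitz_on X \<phi>"
  proof (rule lipschitz_onI)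
    fix x y assume "x \<in> X" "y \<in> X"
    then show "dist (\<phi> x) (\<phi> y) \<le> \<bar>K\<bar> * dist x y"
      using bd[of "x - y"] X(1) mult_right_mono[OF abs_ge_self[of K] norm_ge_zero[of "x - y"]]
      by (simp add: dist_norm diff[symmetric] subspace_diff)
  qed simp
  then have "uniformly_continuous_on X \<phi>"
    by (rule lipschitz_on_uniformly_continuous)
  then obtain G where G: "uniformly_continuous_on (closure X) G" "\<And>x. x \<in> X \<Longrightarrow> \<phi> x = G x"
    by (rule uniformly_continuous_on_extension_on_closure) blast
  have cont: "continuous_on UNIV G"
    using G(1) X(2) uniformly_continuous_imp_continuous by auto
  have lim: "\<exists>s. (\<forall>n::nat. s n \<in> X) \<and> s \<longlonglongrightarrow> x \<and> (\<lambda>n. \<phi> (s n)) \<longlonglongrightarrow> G x" for x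
  proof -
    obtain s where s: "\<forall>n. s n \<in> X" "s \<longlonglongrightarrow> x"
      using X(2) closure_sequential[of x X] by auto
    then have "(\<lambda>n. G (s n)) \<longlonglongrightarrow> G x"
      using cont by (intro continuous_on_tendsto_compose[OF cont]) auto
    with s G(2) show ?thesis by auto
  qed
  have Glin: "G (x + y) = G x + G y" for x y
  proof -
    obtain s t where s: "\<forall>n. s n \<in> X" "s \<longlonglongrightarrow> x" "(\<lambda>n. \<phi> (s n)) \<longlonglongrightarrow> G x"
      and t: "\<forall>n. t n \<in> X" "t \<longlonglongrightarrow> y" "(\<lambda>n. \<phi> (t n)) \<longlonglongrightarrow> G y"
      using lim by meson
    have "(\<lambda>n. G (s n + t n)) \<longlonglongrightarrow> G (x + y)"
      using cont s t by (intro continuous_on_tendsto_compose[OF cont] tendsto_add) auto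
    moreover have "G (s n + t n) = \<phi> (s n) + \<phi> (t n)" for n
      using s(1) t(1) X(1) add G(2)[symmetric] by (simp add: subspace_add)
    ultimately have "(\<lambda>n. \<phi> (s n) + \<phi> (t n)) \<longlonglongrightarrow> G (x + y)"
      by simp
    then show ?thesis
      using LIMSEQ_unique[OF _ tendsto_add[OF s(3) t(3)]] by simp
  qed
  have Gsc: "G (c *\<^sub>R x) = c *\<^sub>R G x" for c x
  proof -
    obtain s where s: "\<forall>n. s n \<in> X" "s \<longlonglongrightarrow> x" "(\<lambda>n. \<phi> (s n)) \<longlonglongrightarrow> G x"
      using lim by meson
    have "(\<lambda>n. G (c *\<^sub>R s n)) \<longlonglongrightarrow> G (c *\<^sub>R x)"
      using cont s by (intro continuous_on_tendsto_compose[OF cont] tendsto_intros) auto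
    moreover have "G (c *\<^sub>R s n) = c *\<^sub>R \<phi> (s n)" for n
      using s(1) X(1) scale G(2)[symmetric] by (simp add: subspace_scale)
    ultimately have "(\<lambda>n. c *\<^sub>R \<phi> (s n)) \<longlonglongrightarrow> G (c *\<^sub>R x)"
      by simp
    then show ?thesis
      using LIMSEQ_unique[OF _ tendsto_scaleR[OF tendsto_const s(3)]] by simp
  qed
  have Gbd: "norm (G x) \<le> K * norm x" for x
  proof -
    obtain s where s: "\<forall>n. s n \<in> X" "s \<longlonglongrightarrow> x" "(\<lambda>n. \<phi> (s n)) \<longlonglongrightarrow> G x"
      using lim by meson
    show ?thesis
      by (rule LIMSEQ_le[OF tendsto_norm[OF s(3)] tendsto_mult[OF tendsto_const tendsto_norm[OF s(2)]]])
         (use s bd in auto)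
  qed
  have "bounded_linear G"
    by (rule bounded_linear_intro[where K=K]) (auto simp: Glin Gsc Gbd mult.commute)
  with G(2) Gbd show thesis by (intro that) auto
qed

text \<open>The inverse is the Neumann series in \<open>id - V\<close>, an operator of norm at most
  \<open>1/2\<close>.\<close>

lemma neumann_left_inverse:
  fixes V :: "'a::banach \<Rightarrow> 'a"
  assumes V: "bounded_linear V" and close: "\<And>x. norm (V x - x) \<le> norm x / 2"
  obtains W where "bounded_linear W" "\<And>x. W (V x) = x"
proof -
  define R where "R x = x - V x" for x
  have R: "bounded_linear R"
    unfolding R_def by (intro bounded_linear_sub bounded_linear_ident V)
  have Rp: "bounded_linear (R ^^ n)" for n
  proof (induction n)
    case (Suc n)
    then show ?case using bounded_linear_compose[OF R] by (simp add: o_def)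
  qed (simp add: id_def bounded_linear_ident)
  have Rn: "norm ((R ^^ n) x) \<le> norm x * (1/2) ^ n" for n x
  proof (induction n)
    case (Suc n)
    have "norm (R ((R ^^ n) x)) \<le> norm ((R ^^ n) x) / 2"
      using close by (simp add: R_def norm_minus_commute)
    with Suc show ?case by simp
  qed simp
  have summ: "summable (\<lambda>n. (R ^^ n) x)" for x
    by (rule summable_comparison_test'[where g="\<lambda>n. norm x * (1/2) ^ n" and N=0])
       (use Rn in \<open>auto intro!: summable_mult\<close>)
  define W where "W x = (\<Sum>n. (R ^^ n) x)" for x
  have "bounded_linear W"
  proof (rule bounded_linear_intro[where K=2])
    show "W (x + y) = W x + W y" for x y
      unfolding W_def using bounded_linear.linear[OF Rp]
      by (simp add: linear_add suminf_add summ)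
    show "W (c *\<^sub>R x) = c *\<^sub>R W x" for c x
      unfolding W_def using bounded_linear.linear[OF Rp]
      by (simp add: linear_scale bounded_linear.suminf[OF bounded_linear_scaleR_right] summ)
    show "norm (W x) \<le> norm x * 2" for x
    proof -
      have s: "summable (\<lambda>n. norm x * (1/2) ^ n)" by (intro summable_mult) auto
      have sn: "summable (\<lambda>n. norm ((R ^^ n) x))"
        by (rule summable_comparison_test'[OF s, where N=0]) (use Rn in auto)
      have "norm (W x) \<le> (\<Sum>n. norm ((R ^^ n) x))"
        unfolding W_def by (rule summable_norm[OF sn])
      also have "\<dots> \<le> (\<Sum>n. norm x * (1/2) ^ n)"
        by (intro suminf_le Rn sn s)
      also have "\<dots> = norm x * 2"
        by (subst suminf_mult) (auto simp: suminf_geometric)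
      finally show ?thesis .
    qed
  qed
  moreover have "W (V x) = x" for x
  proof -
    have "(\<lambda>n. (R ^^ n) x - (R ^^ Suc n) x) sums ((R ^^ 0) x - 0)"
      by (rule telescope_sums'[OF summable_LIMSEQ_zero[OF summ]])
    moreover have "(R ^^ n) x - (R ^^ Suc n) x = (R ^^ n) (V x)" for n
    proof -
      have "(R ^^ Suc n) x = (R ^^ n) (R x)" by (simp only: funpow_Suc_right o_def)
      then show ?thesis using linear_diff[OF bounded_linear.linear[OF Rp[of n]], of x "R x"]
        by (simp add: R_def)
    qed
    ultimately show ?thesis unfolding W_def by (simp add: sums_iff)
  qed
  ultimately show thesis by (rule that)
qed

text \<open>Completeness of \<open>L\<^sub>1\<close>: the telescoping series of the differences converges
  absolutely in mean, hence almost everywhere, and its sum is the limit.\<close>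

lemma integrable_limit_of_fast_L1_Cauchy:
  fixes z :: "nat \<Rightarrow> 'x \<Rightarrow> real"
  assumes int: "\<And>n. integrable M (z n)"
    and fast: "\<And>n. (\<integral>t. \<bar>z (Suc n) t - z n t\<bar> \<partial>M) \<le> (1/2) ^ n"
  obtains u where "integrable M u" "(\<lambda>n. \<integral>t. \<bar>z n t - u t\<bar> \<partial>M) \<longlonglongrightarrow> 0"
proof -
  define d where "d n t = z (Suc n) t - z n t" for n t
  have di: "integrable M (d n)" for n
    unfolding d_def using int by auto
  have sd: "summable (\<lambda>n. \<integral>t. norm (d n t) \<partial>M)"
    by (rule summable_comparison_test'[where g="\<lambda>n. (1/2)^n" and N=0])
       (use fast in \<open>auto simp: d_def\<close>)
  have AE: "AE t in M. summable (\<lambda>n. norm (d n t))"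
  proof -
    have [measurable]: "d n \<in> borel_measurable M" for n using di by auto
    have "(\<integral>\<^sup>+t. (\<Sum>n. ennreal (norm (d n t))) \<partial>M) = (\<Sum>n. \<integral>\<^sup>+t. ennreal (norm (d n t)) \<partial>M)"
      by (rule nn_integral_suminf) auto
    also have "\<dots> = (\<Sum>n. ennreal (\<integral>t. norm (d n t) \<partial>M))"
      by (intro suminf_cong nn_integral_eq_integral) (use di in auto)
    also have "\<dots> \<noteq> \<infinity>"
      unfolding infinity_ennreal_def by (rule ennreal_suminf_neq_top[OF sd]) simp
    finally have "AE t in M. (\<Sum>n. ennreal (norm (d n t))) \<noteq> \<infinity>"
      by (intro nn_integral_PInf_AE) auto
    then show ?thesis
      by eventually_elim (auto intro: summable_suminf_not_top)
  qed
  define u where "u t = z 0 t + (\<Sum>n. d n t)" for t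
  have u: "integrable M u"
    unfolding u_def by (intro Bochner_Integration.integrable_add integrable_suminf int di AE sd)
  define r where "r n = (\<Sum>k. \<integral>t. norm (d (k + n) t) \<partial>M)" for n
  have r0: "r \<longlonglongrightarrow> 0"
    unfolding r_def by (rule suminf_exist_split2[OF sd])
  have bd: "(\<integral>t. \<bar>z n t - u t\<bar> \<partial>M) \<le> r n" for n
  proof -
    have AE': "AE t in M. summable (\<lambda>k. norm (d (k + n) t))"
      using AE by eventually_elim (rule summable_ignore_initial_segment)
    have sd': "summable (\<lambda>k. \<integral>t. norm (d (k + n) t) \<partial>M)"
      using sd by (rule summable_ignore_initial_segment)
    have i: "integrable M (\<lambda>t. \<Sum>k. norm (d (k + n) t))"

      by (intro integrable_suminf integrable_norm di) (use AE' sd' in simp_all)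
    have "(\<integral>t. \<bar>z n t - u t\<bar> \<partial>M) \<le> (\<integral>t. (\<Sum>k. norm (d (k + n) t)) \<partial>M)"
    proof (rule integral_mono_AE)
      show "AE t in M. \<bar>z n t - u t\<bar> \<le> (\<Sum>k. norm (d (k + n) t))"
        using AE AE'
      proof eventually_elim
        case (elim t)
        have "summable (\<lambda>k. d k t)" using elim(1) by (rule summable_norm_cancel)
        then have "(\<Sum>k. d k t) = (\<Sum>k. d (k + n) t) + (\<Sum>k<n. d k t)"
          by (rule suminf_split_initial_segment)
        also have "(\<Sum>k<n. d k t) = z n t - z 0 t"
          unfolding d_def by (rule sum_lessThan_telescope)
        finally have "z n t - u t = - (\<Sum>k. d (k + n) t)" by (simp add: u_def)
        then show ?case using summable_norm[OF elim(2)] by (simp only: real_norm_def abs_minus_cancel)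
      qed
    qed (intro i Bochner_Integration.integrable_diff integrable_abs u int)+
    also have "\<dots> = r n"
      unfolding r_def

      by (intro integral_suminf integrable_norm di) (use AE' sd' in simp_all)
    finally show ?thesis .
  qed
  have "(\<lambda>n. \<integral>t. \<bar>z n t - u t\<bar> \<partial>M) \<longlonglongrightarrow> 0"
    by (rule tendsto_sandwich[OF _ _ tendsto_const r0]) (use bd in \<open>auto\<close>)
  with u show thesis by (rule that)
qed

section \<open>Dyadic functions constant on intervals of one level\<close>

definition cell :: "nat \<Rightarrow> real \<Rightarrow> nat" where
  "cell n t = nat \<lfloor>2 ^ n * t\<rfloor>"

text \<open>The values on the \<open>2 ^ n\<close> dyadic intervals of level \<open>n\<close> are listed from
  left to right. The function vanishes off the unit interval, as the members of \<open>haar_span\<close>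
  do.\<close>

definition step_fun :: "nat \<Rightarrow> (nat \<Rightarrow> real) \<Rightarrow> real \<Rightarrow> real" where
  "step_fun n v = (\<lambda>t. if 0 \<le> t \<and> t < 1 then v (cell n t) else 0)"

lemma cell_less: "0 \<le> t \<Longrightarrow> t < 1 \<Longrightarrow> cell n t < 2 ^ n"
  by (simp add: cell_def nat_less_iff floor_less_iff)

lemma cell_left_endpoint: "cell n (real i / 2 ^ n) = i"
  by (simp add: cell_def)

lemma cell_coarsen:
  assumes "0 \<le> t" shows "cell (n + k) t div 2 ^ k = cell n t"
proof -
  have "\<lfloor>2 ^ n * t\<rfloor> = \<lfloor>2 ^ (n + k) * t / real_of_int (2 ^ k)\<rfloor>"
    by (simp add: power_add)
  also have "\<dots> = \<lfloor>2 ^ (n + k) * t\<rfloor> div 2 ^ k"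
    by (subst floor_divide_real_eq_div) auto
  finally show ?thesis using assms
    by (simp add: cell_def nat_div_distrib nat_power_eq)
qed

lemma step_eqI: "(\<And>i. i < 2 ^ n \<Longrightarrow> v i = w i) \<Longrightarrow> step_fun n v = step_fun n w"
  by (auto simp: step_fun_def cell_less)

lemma step_eqD:
  assumes "step_fun n v = step_fun n w" "i < 2 ^ n" shows "v i = w i"
proof -
  have "step_fun n v (real i / 2 ^ n) = step_fun n w (real i / 2 ^ n)" using assms by simp
  moreover have "real i < 2 ^ n" using assms by (metis of_nat_less_numeral_power_cancel_iff)
  ultimately show ?thesis by (simp add: step_fun_def cell_left_endpoint)
qed

lemma step_refine: "step_fun n v = step_fun (n + k) (\<lambda>i. v (i div 2 ^ k))"
  by (auto simp: step_fun_def cell_coarsen)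

lemma step_linear:
  "(\<lambda>t. step_fun n v t + step_fun n w t) = step_fun n (\<lambda>i. v i + w i)"
  "(\<lambda>t. step_fun n v t - step_fun n w t) = step_fun n (\<lambda>i. v i - w i)"
  "(\<lambda>t. c * step_fun n v t) = step_fun n (\<lambda>i. c * v i)"
  "(\<lambda>t. step_fun n v t * step_fun n w t) = step_fun n (\<lambda>i. v i * w i)"
  "(\<lambda>t. \<bar>step_fun n v t\<bar>) = step_fun n (\<lambda>i. \<bar>v i\<bar>)"
  "(\<lambda>t. \<Sum>j\<in>A. step_fun n (u j) t) = step_fun n (\<lambda>i. \<Sum>j\<in>A. u j i)"
  by (auto simp: step_fun_def fun_eq_iff)

definition step_funs :: "nat \<Rightarrow> (real \<Rightarrow> real) set" where
  "step_funs n = range (step_fun n)"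

lemma steps_mono: "m \<le> n \<Longrightarrow> step_funs m \<subseteq> step_funs n"
  unfolding step_funs_def using step_refine[of m _ "n - m"] by auto

lemma step_in_steps [simp]: "step_fun n v \<in> step_funs n"
  by (simp add: step_funs_def)

lemma steps_closed:
  "f \<in> step_funs n \<Longrightarrow> g \<in> step_funs n \<Longrightarrow> (\<lambda>t. f t + g t) \<in> step_funs n"
  "f \<in> step_funs n \<Longrightarrow> g \<in> step_funs n \<Longrightarrow> (\<lambda>t. f t - g t) \<in> step_funs n"
  "f \<in> step_funs n \<Longrightarrow> g \<in> step_funs n \<Longrightarrow> (\<lambda>t. f t * g t) \<in> step_funs n"
  "f \<in> step_funs n \<Longrightarrow> (\<lambda>t. c * f t) \<in> step_funs n"
  "f \<in> step_funs n \<Longrightarrow> (\<lambda>t. \<bar>f t\<bar>) \<in> step_funs n"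
  unfolding step_funs_def by (auto simp: step_linear)

lemma zero_in_steps [simp]: "(\<lambda>t. 0) \<in> step_funs n"
  unfolding step_funs_def by (rule range_eqI[where x="\<lambda>_. 0"]) (auto simp: step_fun_def)

lemma steps_sum: "(\<And>j. j \<in> A \<Longrightarrow> f j \<in> step_funs n) \<Longrightarrow> (\<lambda>t. \<Sum>j\<in>A. f j t) \<in> step_funs n"
  by (induction A rule: infinite_finite_induct) (auto intro: steps_closed)

section \<open>The Haar system in heap order\<close>

text \<open>Counting from \<open>0\<close> turns the given enumeration into the numbering of a binary heap:
  the number \<open>0\<close> is the constant function, the interval numbered \<open>2 ^ n + i\<close> is the
  one at place \<open>i\<close> of level \<open>n\<close>, and its halves carry the numbers \<open>2 k\<close>
  and \<open>2 k + 1\<close> for \<open>k = 2 ^ n + i\<close>.\<close>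

definition haar_fn :: "nat \<Rightarrow> real \<Rightarrow> real" where
  "haar_fn k = haar_seq (Suc k)"

text \<open>For \<open>k \<ge> 1\<close> this is the indicator of the support of \<open>haar_fn
  k\<close>.\<close>

definition chi :: "nat \<Rightarrow> real \<Rightarrow> real" where
  "chi k = step_fun (floor_log k) (\<lambda>j. of_bool (2 ^ floor_log k + j = k))"

text \<open>The measure of the support of \<open>haar_fn k\<close>. The convention \<open>floor_log 0 =
  0\<close> gives the right value \<open>1\<close> for \<open>k = 0\<close>.\<close>

definition mu :: "nat \<Rightarrow> real" where
  "mu k = 1 / 2 ^ floor_log k"

lemma floor_log_node: "i < 2 ^ n \<Longrightarrow> floor_log (2 ^ n + i) = n"
  by (rule floor_log_eqI) auto

lemma heap_index_cases:
  assumes "k \<ge> 1"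
  obtains n i where "k = 2 ^ n + i" "i < 2 ^ n" "floor_log k = n"
proof -
  have "2 ^ floor_log k \<le> k" "k < 2 * 2 ^ floor_log k"
    using assms floor_log_exp2_le floor_log_exp2_gt by auto
  then show thesis
    by (intro that[of "floor_log k" "k - 2 ^ floor_log k"]) auto
qed

lemma chi_node: "i < 2 ^ n \<Longrightarrow> chi (2 ^ n + i) = step_fun n (\<lambda>j. of_bool (j = i))"
  by (simp add: chi_def floor_log_node)

lemma chi_children_node:
  assumes "i < 2 ^ n"
  shows "chi (2 * (2 ^ n + i)) = step_fun (Suc n) (\<lambda>j. of_bool (j = 2 * i))"
    and "chi (2 * (2 ^ n + i) + 1) = step_fun (Suc n) (\<lambda>j. of_bool (j = 2 * i + 1))"
  using chi_node[of "2 * i" "Suc n"] chi_node[of "2 * i + 1" "Suc n"] assms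
  by (simp_all add: algebra_simps)

lemma indicator_dyadic_interval:
  assumes "i < 2 ^ n"
  shows "indicator (dyadic_interval n (Suc i)) = step_fun n (\<lambda>j. of_bool (j = i))"
proof
  fix t :: real
  have "t \<in> dyadic_interval n (Suc i) \<longleftrightarrow> \<lfloor>2 ^ n * t\<rfloor> = int i"
    by (auto simp: dyadic_interval_def floor_eq_iff field_simps)
  also have "\<dots> \<longleftrightarrow> 0 \<le> t \<and> t < 1 \<and> cell n t = i"
  proof
    assume *: "\<lfloor>2 ^ n * t\<rfloor> = int i"
    then have "0 \<le> 2 ^ n * t" by (metis of_nat_0_le_iff zero_le_floor)
    then have "0 \<le> t" by (rule contrapos_pp) (simp add: mult_pos_neg not_le)
    moreover have "2 ^ n * t < real i + 1" using * by linarith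
    moreover have "real i + 1 \<le> 2 ^ n" using assms by (metis Suc_leI of_nat_Suc of_nat_le_numeral_power_cancel_iff add.commute)
    ultimately show "0 \<le> t \<and> t < 1 \<and> cell n t = i" using *
      by (auto simp: cell_def) (metis mult.right_neutral mult_less_cancel_left_pos order_less_le_trans zero_less_numeral zero_less_power)
  qed (auto simp: cell_def)
  finally show "indicator (dyadic_interval n (Suc i)) t = step_fun n (\<lambda>j. of_bool (j = i)) t"
    by (auto simp: step_fun_def indicator_def)
qed

lemma haar_fn_0: "haar_fn 0 = step_fun 0 (\<lambda>_. 1)"
proof -
  have "haar_interval (Suc 0) = {}" using haar_interval_one by simp
  then have "haar_fn 0 = indicator {0..<1}"
    by (simp add: haar_fn_def haar_seq_def haar_def)
  then show ?thesis by (auto simp: step_fun_def indicator_def fun_eq_iff)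
qed

lemma chi_1: "chi (Suc 0) = step_fun 0 (\<lambda>_. 1)"
  unfolding chi_def floor_log_Suc_zero by (rule step_eqI) simp

lemma haar_interval_heap:
  "i < 2 ^ n \<Longrightarrow> haar_interval (Suc (2 ^ n + i)) = dyadic_interval n (Suc i)"
  using haar_interval_enum[of "Suc i" n] by simp

lemma haar_fn_eq_chi_diff:
  assumes "k \<ge> 1"
  shows "haar_fn k = (\<lambda>t. chi (2 * k) t - chi (2 * k + 1) t)"
proof -
  obtain n i where k: "k = 2 ^ n + i" "i < 2 ^ n" using heap_index_cases[OF assms] by metis
  have "haar_fn k = (\<lambda>t. indicator (dyadic_interval (Suc n) (Suc (2 * i))) t
          - indicator (dyadic_interval (Suc n) (Suc (2 * i + 1))) t)"
    using haar_dyadic_interval[of "Suc i" n] k by (simp add: haar_fn_def haar_seq_def haar_interval_heap)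
  also have "\<dots> = (\<lambda>t. chi (2 * k) t - chi (2 * k + 1) t)"
    unfolding k(1) chi_children_node[OF k(2)] using k(2) by (simp add: indicator_dyadic_interval)
  finally show ?thesis .
qed

lemma chi_split:
  assumes "k \<ge> 1"
  shows "chi k = (\<lambda>t. chi (2 * k) t + chi (2 * k + 1) t)"
proof -
  obtain n i where k: "k = 2 ^ n + i" "i < 2 ^ n" using heap_index_cases[OF assms] by metis
  have "chi k = step_fun (Suc n) (\<lambda>j. of_bool (j div 2 = i))"
    using k step_refine[of n "\<lambda>j. of_bool (j = i)" 1] by (simp add: chi_node)
  also have "\<dots> = (\<lambda>t. chi (2 * k) t + chi (2 * k + 1) t)"
    unfolding k(1) chi_children_node[OF k(2)] step_linear by (rule step_eqI) (auto; presburger)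
  finally show ?thesis .
qed

text \<open>These two recursions generate all indicators of dyadic intervals from the Haar functions. The
  blocks constructed below obey the same recursions.\<close>

lemma chi_children:
  assumes "k \<ge> 1"
  shows "chi (2 * k) = (\<lambda>t. (1/2) * (chi k t + haar_fn k t))"
    and "chi (2 * k + 1) = (\<lambda>t. (1/2) * (chi k t - haar_fn k t))"
  by (auto simp: chi_split[OF assms] haar_fn_eq_chi_diff[OF assms] fun_eq_iff)

lemma chi_in_steps: "k < 2 ^ Suc n \<Longrightarrow> chi k \<in> step_funs n"
proof -
  assume k: "k < 2 ^ Suc n"
  have "floor_log k \<le> n"
  proof (cases "k = 0")
    case False
    then have "2 ^ floor_log k \<le> k" using floor_log_exp2_le by simp
    then have "(2::nat) ^ floor_log k < 2 ^ Suc n" using k by simp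
    then have "floor_log k < Suc n" by (rule power_less_imp_less_exp[rotated]) simp
    then show ?thesis by simp
  qed simp
  then show ?thesis unfolding chi_def using steps_mono by fastforce
qed

lemma haar_fn_in_steps: "k < 2 ^ n \<Longrightarrow> haar_fn k \<in> step_funs n"
proof (cases "k = 0")
  case True
  then show ?thesis using steps_mono[of 0 n] by (auto simp: haar_fn_0)
next
  case False
  assume "k < 2 ^ n"
  then show ?thesis using False by (auto simp: haar_fn_eq_chi_diff intro!: steps_closed chi_in_steps)
qed

lemma haar_spanI:
  "finite S \<Longrightarrow> S \<subseteq> dyadic_plus \<Longrightarrow> (\<lambda>t. \<Sum>L\<in>S. c L * haar L t) \<in> haar_span"
  unfolding haar_span_def by (intro CollectI exI[of _ S] exI[of _ c] conjI refl)

lemma haar_span_add: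
  assumes "f \<in> haar_span" "g \<in> haar_span"
  shows "(\<lambda>t. f t + g t) \<in> haar_span"
proof -
  obtain S c where f: "f = (\<lambda>t. \<Sum>L\<in>S. c L * haar L t)" "finite S" "S \<subseteq> dyadic_plus"
    using assms(1) by (auto simp: haar_span_def)
  obtain S' c' where g: "g = (\<lambda>t. \<Sum>L\<in>S'. c' L * haar L t)" "finite S'" "S' \<subseteq> dyadic_plus"
    using assms(2) by (auto simp: haar_span_def)
  let ?c = "\<lambda>L. (if L \<in> S then c L else 0) + (if L \<in> S' then c' L else 0)"
  have "(\<Sum>L\<in>S \<union> S'. ?c L * haar L t) = f t + g t" for t
  proof -
    have "(\<Sum>L\<in>S \<union> S'. ?c L * haar L t) = (\<Sum>L\<in>S \<union> S'. (if L \<in> S then c L * haar L t else 0))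
        + (\<Sum>L\<in>S \<union> S'. (if L \<in> S' then c' L * haar L t else 0))"
      unfolding sum.distrib[symmetric] by (intro sum.cong) (auto simp: algebra_simps)
    also have "\<dots> = f t + g t"
      unfolding f(1) g(1) using f(2) g(2)
      by (intro arg_cong2[where f="(+)"] sum.mono_neutral_cong_right) auto
    finally show ?thesis .
  qed
  then have "(\<lambda>t. f t + g t) = (\<lambda>t. \<Sum>L\<in>S \<union> S'. ?c L * haar L t)" by auto
  then show ?thesis using haar_spanI[of "S \<union> S'" ?c] f(2,3) g(2,3) by simp
qed

lemma haar_span_scale:
  assumes "f \<in> haar_span"
  shows "(\<lambda>t. a * f t) \<in> haar_span"
proof -
  obtain S c where f: "f = (\<lambda>t. \<Sum>L\<in>S. c L * haar L t)" "finite S" "S \<subseteq> dyadic_plus"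
    using assms(1) by (auto simp: haar_span_def)
  have "(\<lambda>t. a * f t) = (\<lambda>t. \<Sum>L\<in>S. (a * c L) * haar L t)"
    unfolding f by (simp add: sum_distrib_left mult.assoc)
  then show ?thesis using haar_spanI[OF f(2,3)] by simp
qed

lemma haar_span_sum:
  "(\<And>j. j \<in> A \<Longrightarrow> f j \<in> haar_span) \<Longrightarrow> (\<lambda>t. \<Sum>j\<in>A. f j t) \<in> haar_span"
proof (induction A rule: infinite_finite_induct)
  case (insert a A)
  then show ?case using haar_span_add by simp
qed (auto simp: haar_span_def intro!: exI[of _ "{}"])

lemma haar_eq_haar_fn:
  assumes "L \<in> dyadic_plus" obtains k where "haar L = haar_fn k"
proof (cases "L = {}")
  case True
  then show thesis
    using haar_interval_one by (intro that[of 0]) (simp add: haar_fn_def haar_seq_def)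
next
  case False
  then obtain n i where "L = dyadic_interval n i" "1 \<le> i" "i \<le> 2 ^ n"
    using assms by (auto simp: dyadic_plus_def dyadic_def)
  then show thesis
    using haar_interval_enum[of i n] by (intro that[of "2 ^ n + i - 1"]) (simp add: haar_fn_def haar_seq_def)
qed

lemma haar_fn_in_haar_span: "haar_fn k \<in> haar_span"
proof -
  have "haar_interval (Suc k) \<in> dyadic_plus"
  proof (cases "k = 0")
    case True
    then show ?thesis using haar_interval_one by (simp add: dyadic_plus_def)
  next
    case False
    then obtain n i where k: "k = 2 ^ n + i" "i < 2 ^ n" using heap_index_cases by (metis less_one not_le)
    then have "haar_interval (Suc k) = dyadic_interval n (Suc i)" by (simp add: haar_interval_heap)
    moreover have "1 \<le> Suc i \<and> Suc i \<le> 2 ^ n" using k by auto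
    ultimately show ?thesis unfolding dyadic_plus_def dyadic_def by blast
  qed
  then show ?thesis
    unfolding haar_span_def haar_fn_def haar_seq_def
    by (auto intro!: exI[of _ "{haar_interval (Suc k)}"] exI[of _ "\<lambda>_. 1"])
qed

lemma chi_in_haar_span: "k \<ge> 1 \<Longrightarrow> chi k \<in> haar_span"
proof (induction k rule: less_induct)
  case (less k)
  show ?case
  proof (cases "k = 1")
    case True
    then show ?thesis using haar_fn_in_haar_span[of 0] by (simp add: chi_1 haar_fn_0)
  next
    case False
    then have k2: "k div 2 \<ge> 1" "k div 2 < k" using less.prems by auto
    then have ch: "chi (k div 2) \<in> haar_span" using less.IH by simp
    have "(\<lambda>t. (1/2) * (chi (k div 2) t + haar_fn (k div 2) t)) \<in> haar_span"
      by (intro haar_span_scale haar_span_add ch haar_fn_in_haar_span)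
    moreover have "(\<lambda>t. (1/2) * (chi (k div 2) t + (-1) * haar_fn (k div 2) t)) \<in> haar_span"
      by (intro haar_span_scale haar_span_add ch haar_fn_in_haar_span)
    moreover have "k = 2 * (k div 2) \<or> k = 2 * (k div 2) + 1" by presburger
    ultimately show ?thesis using chi_children[OF k2(1)] by auto
  qed
qed

lemma step_eq_sum_chi: "step_fun n v = (\<lambda>t. \<Sum>i<2 ^ n. v i * chi (2 ^ n + i) t)"
proof -
  have "(\<lambda>t. \<Sum>i<2 ^ n. v i * chi (2 ^ n + i) t) = (\<lambda>t. \<Sum>i<2 ^ n. step_fun n (\<lambda>j. v i * of_bool (j = i)) t)"
  proof (rule ext, rule sum.cong[OF refl])
    fix t i assume "i \<in> {..<(2::nat) ^ n}"
    then have "chi (2 ^ n + i) = step_fun n (\<lambda>j. of_bool (j = i))" by (intro chi_node) simp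
    then show "v i * chi (2 ^ n + i) t = step_fun n (\<lambda>j. v i * of_bool (j = i)) t"
      by (simp only: step_fun_def) simp
  qed
  also have "\<dots> = step_fun n v"
    unfolding step_linear
  proof (rule step_eqI)
    fix j :: nat assume "j < 2 ^ n"
    have "(\<Sum>i<2 ^ n. v i * of_bool (j = i)) = (\<Sum>i<2 ^ n. if j = i then v i else 0)"
      by (rule sum.cong) auto
    then show "(\<Sum>i<2 ^ n. v i * of_bool (j = i)) = v j"
      using \<open>j < 2 ^ n\<close> by simp
  qed
  finally show ?thesis ..
qed

lemma haar_span_eq_steps: "haar_span = (\<Union>n. step_funs n)"
proof (intro equalityI subsetI)
  fix f assume "f \<in> (\<Union>n. step_funs n)"
  then obtain n v where "f = step_fun n v" by (auto simp: step_funs_def)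
  then show "f \<in> haar_span"
    unfolding step_eq_sum_chi[of n v]
    by (simp only:) (intro haar_span_sum haar_span_scale chi_in_haar_span; simp)
next
  fix f assume "f \<in> haar_span"
  then obtain S c where f: "f = (\<lambda>t. \<Sum>L\<in>S. c L * haar L t)" "finite S" "S \<subseteq> dyadic_plus"
    by (auto simp: haar_span_def)
  have "\<exists>n. haar L \<in> step_funs n" if "L \<in> S" for L
    using that f(3) haar_eq_haar_fn[of L] haar_fn_in_steps[OF less_exp] by (metis subsetD)
  then obtain l where l: "\<And>L. L \<in> S \<Longrightarrow> haar L \<in> step_funs (l L)" by metis
  have "l L \<le> Max (l ` S)" if "L \<in> S" for L using that f(2) by simp
  then have "haar L \<in> step_funs (Max (l ` S))" if "L \<in> S" for L
    using l that steps_mono by blast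
  then have "f \<in> step_funs (Max (l ` S))"
    unfolding f(1) by (intro steps_sum steps_closed(4))
  then show "f \<in> (\<Union>n. step_funs n)" by blast
qed

lemma steps_subset_haar_span: "f \<in> step_funs n \<Longrightarrow> f \<in> haar_span"
  by (auto simp: haar_span_eq_steps)

section \<open>Integrals and distributions of step functions\<close>

lemma step_bounded:
  obtains C where "\<And>t. \<bar>step_fun n v t\<bar> \<le> C"
proof
  fix t show "\<bar>step_fun n v t\<bar> \<le> (\<Sum>i<2^n. \<bar>v i\<bar>)"
    by (auto simp: step_fun_def cell_less sum_nonneg intro!: member_le_sum)
qed

abbreviation "M01 \<equiv> lebesgue_on {0..<1::real}"

lemma finite_measure_M01: "finite_measure M01"
  by (intro finite_measure_lebesgue_on bounded_set_imp_lmeasurable) auto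

lemma step_integral:
  "integrable M01 (step_fun n v)" "integral\<^sup>L M01 (step_fun n v) = (\<Sum>i<2 ^ n. v i) / 2 ^ n"
proof -
  have eq: "step_fun n v t = (\<Sum>i<2 ^ n. v i * indicator (dyadic_interval n (Suc i)) t)" for t
    by (subst step_eq_sum_chi) (simp add: indicator_dyadic_interval chi_node)
  have sub: "dyadic_interval n (Suc i) \<subseteq> {0..<1}" if "i < 2 ^ n" for i
  proof -
    have "real i + 1 \<le> 2 ^ n" using that by (metis Suc_leI of_nat_Suc of_nat_le_numeral_power_cancel_iff add.commute)
    then have "(1 + real i) / 2 ^ n \<le> 1" by simp
    then show ?thesis
      unfolding dyadic_interval_def by (auto simp del: divide_le_eq_1_pos)
  qed
  have sets: "dyadic_interval n i \<in> sets lebesgue" for i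
    by (simp add: dyadic_interval_def)
  have int: "integrable M01 (indicator (dyadic_interval n (Suc i)) :: real \<Rightarrow> real)" if "i < 2 ^ n" for i
    using sub[OF that] sets finite_measure.emeasure_finite[OF finite_measure_M01]
    by (intro integrable_real_indicator) (auto simp: sets_restrict_space_iff less_top)
  have val: "integral\<^sup>L M01 (indicator (dyadic_interval n (Suc i)) :: real \<Rightarrow> real) = 1 / 2 ^ n" if "i < 2 ^ n" for i
  proof -
    have "integral\<^sup>L M01 (indicator (dyadic_interval n (Suc i)) :: real \<Rightarrow> real) = measure M01 (dyadic_interval n (Suc i))"
      using sub[OF that] by (simp add: Int_absorb2)
    also have "\<dots> = measure lebesgue (dyadic_interval n (Suc i))"
      by (rule measure_restrict_space) (use sub[OF that] in auto)
    also have "\<dots> = 1 / 2 ^ n"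
      by (simp add: dyadic_interval_def diff_divide_distrib[symmetric] divide_right_mono)
    finally show ?thesis .
  qed
  show "integrable M01 (step_fun n v)"
    unfolding eq[abs_def] by (intro Bochner_Integration.integrable_sum integrable_mult_right int) auto
  have "integral\<^sup>L M01 (step_fun n v) = (\<Sum>i<2 ^ n. integral\<^sup>L M01 (\<lambda>t. v i * indicator (dyadic_interval n (Suc i)) t))"
    unfolding eq[abs_def] by (intro Bochner_Integration.integral_sum integrable_mult_right int) auto
  also have "\<dots> = (\<Sum>i<2 ^ n. v i / 2 ^ n)"
    using val int by (intro sum.cong) auto
  finally show "integral\<^sup>L M01 (step_fun n v) = (\<Sum>i<2 ^ n. v i) / 2 ^ n"
    by (simp add: sum_divide_distrib)
qed

text \<open>The law of a step function gives a Borel set the proportion of the values that lie in it, and this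
  count does not see their order.\<close>

lemma step_same_distribution:
  assumes \<pi>: "bij_betw \<pi> {..<2 ^ n} {..<2 ^ n}"
  shows "same_distribution (step_fun n (\<lambda>i. v (\<pi> i))) (step_fun n v)"
proof -
  interpret finite_measure M01 by (rule finite_measure_M01)
  have meas: "step_fun n w \<in> borel_measurable M01" for w
    using step_integral(1) by (rule borel_measurable_integrable)
  have law: "emeasure (distr M01 borel (step_fun n w)) A = ennreal ((\<Sum>i<2 ^ n. indicator A (w i)) / 2 ^ n)"
    if A: "A \<in> sets borel" for w A
  proof -
    have "emeasure (distr M01 borel (step_fun n w)) A = emeasure M01 (step_fun n w -` A \<inter> space M01)"
      using meas A by (rule emeasure_distr)
    also have "\<dots> = ennreal (measure M01 (step_fun n w -` A \<inter> space M01))"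
      by (rule emeasure_eq_measure)
    also have "measure M01 (step_fun n w -` A \<inter> space M01) = integral\<^sup>L M01 (indicator (step_fun n w -` A))"
      by simp
    also have "\<dots> = integral\<^sup>L M01 (step_fun n (\<lambda>i. indicator A (w i)))"
      by (rule Bochner_Integration.integral_cong) (auto simp: step_fun_def indicator_def)
    finally show ?thesis by (simp add: step_integral)
  qed
  show ?thesis
    unfolding same_distribution_def
  proof (rule measure_eqI)
    fix A assume "A \<in> sets (distr M01 borel (step_fun n (\<lambda>i. v (\<pi> i))))"
    then have A: "A \<in> sets borel" by simp
    have "(\<Sum>i<2 ^ n. indicator A (v (\<pi> i)) :: real) = (\<Sum>i<2 ^ n. indicator A (v i))"
      by (rule sum.reindex_bij_betw[OF \<pi>])
    then show "emeasure (distr M01 borel (step_fun n (\<lambda>i. v (\<pi> i)))) A = emeasure (distr M01 borel (step_fun n v)) A"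
      using A by (simp add: law)
  qed simp
qed

section \<open>The pairing of step functions\<close>

definition ip :: "(real \<Rightarrow> real) \<Rightarrow> (real \<Rightarrow> real) \<Rightarrow> real" where
  "ip f g = integral\<^sup>L M01 (\<lambda>t. f t * g t)"

lemma ip_step: "ip (step_fun n v) (step_fun n w) = (\<Sum>i<2 ^ n. v i * w i) / 2 ^ n"
  unfolding ip_def step_linear(4) step_integral ..

lemma haar_span_common_level:
  assumes "f \<in> haar_span" "g \<in> haar_span"
  obtains n where "f \<in> step_funs n" "g \<in> step_funs n"
proof -
  obtain a b where "f \<in> step_funs a" "g \<in> step_funs b" using assms by (auto simp: haar_span_eq_steps)
  then have "f \<in> step_funs (max a b)" "g \<in> step_funs (max a b)"
    using steps_mono[of a "max a b"] steps_mono[of b "max a b"] by auto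
  then show thesis by (rule that)
qed

lemma haar_span_mult: "f \<in> haar_span \<Longrightarrow> g \<in> haar_span \<Longrightarrow> (\<lambda>t. f t * g t) \<in> haar_span"
  by (metis haar_span_common_level steps_closed(3) steps_subset_haar_span)

lemma haar_span_abs: "f \<in> haar_span \<Longrightarrow> (\<lambda>t. \<bar>f t\<bar>) \<in> haar_span"
  by (metis haar_span_common_level steps_closed(5) steps_subset_haar_span)

lemma haar_span_diff: "f \<in> haar_span \<Longrightarrow> g \<in> haar_span \<Longrightarrow> (\<lambda>t. f t - g t) \<in> haar_span"
  by (metis haar_span_common_level steps_closed(2) steps_subset_haar_span)

lemma haar_span_integrable: "f \<in> haar_span \<Longrightarrow> integrable M01 f"
  using step_integral(1) by (auto simp: haar_span_eq_steps step_funs_def)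

lemma haar_span_bounded:
  assumes "f \<in> haar_span" obtains C where "\<And>t. \<bar>f t\<bar> \<le> C"
  using assms step_bounded by (auto simp: haar_span_eq_steps step_funs_def)

lemma ip_commute: "ip f g = ip g f"
  by (simp add: ip_def mult.commute)

lemma ip_integrable: "f \<in> haar_span \<Longrightarrow> g \<in> haar_span \<Longrightarrow> integrable M01 (\<lambda>t. f t * g t)"
  by (intro haar_span_integrable haar_span_mult)

lemma ip_add:
  assumes "f \<in> haar_span" "g \<in> haar_span" "h \<in> haar_span"
  shows "ip (\<lambda>t. f t + g t) h = ip f h + ip g h" "ip h (\<lambda>t. f t + g t) = ip h f + ip h g"
  using ip_integrable[of f h] ip_integrable[of g h] ip_integrable[of h f] ip_integrable[of h g] assms
  by (simp_all add: ip_def algebra_simps)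

lemma ip_diff:
  assumes "f \<in> haar_span" "g \<in> haar_span" "h \<in> haar_span"
  shows "ip (\<lambda>t. f t - g t) h = ip f h - ip g h" "ip h (\<lambda>t. f t - g t) = ip h f - ip h g"
  using ip_integrable[of f h] ip_integrable[of g h] ip_integrable[of h f] ip_integrable[of h g] assms
  by (simp_all add: ip_def algebra_simps)

lemma ip_scale:
  shows "ip (\<lambda>t. c * f t) h = c * ip f h" "ip h (\<lambda>t. c * f t) = c * ip h f"
  by (simp_all add: ip_def mult.assoc mult.left_commute)

lemma ip_sum:
  assumes "\<And>j. j \<in> A \<Longrightarrow> f j \<in> haar_span" "h \<in> haar_span"
  shows "ip (\<lambda>t. \<Sum>j\<in>A. f j t) h = (\<Sum>j\<in>A. ip (f j) h)"
    and "ip h (\<lambda>t. \<Sum>j\<in>A. f j t) = (\<Sum>j\<in>A. ip h (f j))"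
proof -
  show "ip (\<lambda>t. \<Sum>j\<in>A. f j t) h = (\<Sum>j\<in>A. ip (f j) h)"
    unfolding ip_def sum_distrib_right
    by (rule Bochner_Integration.integral_sum) (intro ip_integrable assms)
  show "ip h (\<lambda>t. \<Sum>j\<in>A. f j t) = (\<Sum>j\<in>A. ip h (f j))"
    unfolding ip_def sum_distrib_left
    by (rule Bochner_Integration.integral_sum) (intro ip_integrable assms)
qed

lemma abs_ip_le:
  assumes "f \<in> haar_span" "g \<in> haar_span" "\<And>t. \<bar>g t\<bar> \<le> C"
  shows "\<bar>ip f g\<bar> \<le> C * integral\<^sup>L M01 (\<lambda>t. \<bar>f t\<bar>)"
proof -
  have "\<bar>ip f g\<bar> \<le> integral\<^sup>L M01 (\<lambda>t. \<bar>f t * g t\<bar>)"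
    unfolding ip_def by (rule integral_abs_bound)
  also have "\<dots> \<le> integral\<^sup>L M01 (\<lambda>t. C * \<bar>f t\<bar>)"
    using assms by (intro integral_mono integrable_mult_right haar_span_integrable haar_span_abs haar_span_mult)
      (auto simp: abs_mult mult.commute[of C] mult_left_mono)
  finally show ?thesis by simp
qed

section \<open>Orthogonality of the Haar system\<close>

lemma ip_chi:
  assumes "f \<in> step_funs n" "i < 2 ^ n"
  shows "ip f (chi (2 ^ n + i)) = f (real i / 2 ^ n) / 2 ^ n"
proof -
  obtain v where v: "f = step_fun n v" using assms by (auto simp: step_funs_def)
  have "real i < 2 ^ n" using assms by (metis of_nat_less_numeral_power_cancel_iff)
  then have "f (real i / 2 ^ n) = v i" by (simp add: v step_fun_def cell_left_endpoint)
  moreover have "(\<Sum>j<2 ^ n. v j * of_bool (j = i)) = (\<Sum>j<2 ^ n. if j = i then v j else 0)"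
    by (rule sum.cong) auto
  ultimately show ?thesis using assms(2) by (simp add: v chi_node ip_step)
qed

text \<open>A step function of level \<open>n\<close> is constant on the support of every Haar function of level \<open>n\<close> or
  higher, and that Haar function has mean zero.\<close>

lemma ip_step_haar_fn_eq_0:
  assumes "f \<in> step_funs n" "2 ^ n \<le> k"
  shows "ip f (haar_fn k) = 0"
proof -
  have "k \<ge> 1" using assms(2) one_le_power[of "2::nat" n] by linarith
  then obtain m i where k: "k = 2 ^ m + i" "i < 2 ^ m" using heap_index_cases by metis
  then have "(2::nat) ^ n < 2 ^ Suc m" using assms(2) by simp
  then have "n \<le> m" by (metis less_Suc_eq_le power_less_imp_less_exp one_less_numeral_iff semiring_norm(76))
  then have "f \<in> step_funs m" using assms(1) steps_mono by blast
  then obtain v where "f = step_fun m v" by (auto simp: step_funs_def)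
  then have f: "f = step_fun (Suc m) (\<lambda>j. v (j div 2))" using step_refine[of m v 1] by simp
  have S: "f \<in> step_funs (Suc m)" unfolding f by simp
  have "ip f (haar_fn k) = ip f (chi (2 * k)) - ip f (chi (2 * k + 1))"
    unfolding haar_fn_eq_chi_diff[OF \<open>k \<ge> 1\<close>]
    using S \<open>k \<ge> 1\<close> by (intro ip_diff chi_in_haar_span steps_subset_haar_span[OF S]) auto
  also have "ip f (chi (2 * k)) = v i / 2 ^ Suc m"
    unfolding k(1) chi_children_node(1)[OF k(2)] f ip_step using k(2)
    by (subst sum.remove[of _ "2 * i"]) auto
  also have "ip f (chi (2 * k + 1)) = v i / 2 ^ Suc m"
    unfolding k(1) chi_children_node(2)[OF k(2)] f ip_step using k(2)
    by (subst sum.remove[of _ "2 * i + 1"]) auto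
  finally show ?thesis by simp
qed

lemma haar_fn_abs:
  assumes "k \<ge> 1" shows "\<bar>haar_fn k t\<bar> = chi k t" "haar_fn k t * haar_fn k t = chi k t"
proof -
  obtain m i where k: "k = 2 ^ m + i" "i < 2 ^ m" using heap_index_cases assms by metis
  have "chi (2 * k) = step_fun (Suc m) (\<lambda>j. of_bool (j = 2 * i))"
    "chi (2 * k + 1) = step_fun (Suc m) (\<lambda>j. of_bool (j = 2 * i + 1))"
    unfolding k(1) by (rule chi_children_node[OF k(2)])+
  then show "\<bar>haar_fn k t\<bar> = chi k t" "haar_fn k t * haar_fn k t = chi k t"
    unfolding haar_fn_eq_chi_diff[OF assms] chi_split[OF assms] by (auto simp: step_fun_def)
qed

lemma mu_pos: "mu k > 0" and mu_inverse_le: "1 / mu k \<le> real (Suc k)"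
proof -
  have "2 ^ floor_log k \<le> Suc k"
    using floor_log_exp2_le[of k] by (cases "k = 0") auto
  then have "real (2 ^ floor_log k) \<le> real (Suc k)" by (rule of_nat_mono)
  then show "mu k > 0" "1 / mu k \<le> real (Suc k)" by (auto simp: mu_def)
qed

lemma integral_chi: "k \<ge> 1 \<Longrightarrow> integral\<^sup>L M01 (chi k) = mu k"
proof -
  assume "k \<ge> 1"
  then obtain m i where k: "k = 2 ^ m + i" "i < 2 ^ m" "floor_log k = m" using heap_index_cases by metis
  then show ?thesis unfolding mu_def
    by (simp add: chi_node step_integral sum.remove[of "{..<2 ^ m}" i])
qed

lemma ip_haar_fn_self: "ip (haar_fn k) (haar_fn k) = mu k"
proof (cases "k = 0")
  case True
  then show ?thesis by (simp add: haar_fn_0 ip_step mu_def)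
next
  case False
  then show ?thesis by (simp add: ip_def haar_fn_abs integral_chi)
qed

lemma ip_haar_fn_orthogonal: "j \<noteq> k \<Longrightarrow> ip (haar_fn j) (haar_fn k) = 0"
proof (induction j k rule: linorder_wlog)
  case (le j k)
  then have "1 \<le> k" "j < k" by auto
  obtain m i where k: "k = 2 ^ m + i" "i < 2 ^ m" using heap_index_cases \<open>1 \<le> k\<close> by metis
  show ?case
  proof (cases "j < 2 ^ m")
    case True
    then show ?thesis using k haar_fn_in_steps by (intro ip_step_haar_fn_eq_0[of _ m]) auto
  next
    case False
    then obtain i' where j: "j = 2 ^ m + i'" by (metis le_iff_add not_le)
    then have i': "i' < 2 ^ m" "i' \<noteq> i" "j \<ge> 1" using k \<open>j < k\<close> by auto
    have zero: "haar_fn j t * haar_fn k t = 0" for t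
    proof -
      have "\<bar>haar_fn j t * haar_fn k t\<bar> = chi j t * chi k t"
        using i' \<open>1 \<le> k\<close> by (simp add: abs_mult haar_fn_abs)
      also have "\<dots> = 0" using i'(1,2) k by (auto simp: j chi_node step_fun_def)
      finally show ?thesis by simp
    qed
    show ?thesis unfolding ip_def by (simp only: zero Bochner_Integration.integral_zero)
  qed
qed (simp add: ip_commute)

lemma haar_fn_bounded: "\<bar>haar_fn k t\<bar> \<le> 1"
  by (cases "k = 0") (auto simp: haar_fn_0 haar_fn_abs chi_def step_fun_def)

lemma rademacher_eq_sum_haar_fn: "rademacher n = (\<lambda>t. \<Sum>k\<in>{2 ^ n..<2 ^ Suc n}. haar_fn k t)"
proof
  fix t
  have inj: "inj_on (dyadic_interval n) {1..2 ^ n}"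
  proof (rule inj_onI)
    fix i j assume *: "i \<in> {1..2 ^ n}" "j \<in> {1..2 ^ n}" "dyadic_interval n i = dyadic_interval n j"
    have **: "(real i - 1) / 2 ^ n < real i / 2 ^ n" "(real j - 1) / 2 ^ n < real j / 2 ^ n"
      by (simp_all add: divide_strict_right_mono)
    have "Sup (dyadic_interval n i) = real i / 2 ^ n" "Sup (dyadic_interval n j) = real j / 2 ^ n"
      unfolding dyadic_interval_def by (rule cSup_atLeastLessThan[OF **(1)] cSup_atLeastLessThan[OF **(2)])+
    then have "real i / 2 ^ n = real j / 2 ^ n" by (simp only: *(3))
    then show "i = j" by simp
  qed
  have "rademacher n t = (\<Sum>i\<in>{1..2 ^ n}. haar (dyadic_interval n i) t)"
    unfolding rademacher_def dyadic_level_eq sum.reindex[OF inj] o_def ..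
  also have "\<dots> = (\<Sum>i\<in>{1..2 ^ n}. haar_fn (2 ^ n + i - 1) t)"
  proof (rule sum.cong[OF refl])
    fix i assume i: "i \<in> {1..(2::nat) ^ n}"
    then have "Suc (2 ^ n + i - 1) = 2 ^ n + i" by simp
    then have "haar_fn (2 ^ n + i - 1) = haar (haar_interval (2 ^ n + i))"
      by (simp only: haar_fn_def haar_seq_def)
    then show "haar (dyadic_interval n i) t = haar_fn (2 ^ n + i - 1) t"
      using i by (simp add: haar_interval_enum)
  qed
  also have "\<dots> = (\<Sum>k\<in>{2 ^ n..<2 ^ Suc n}. haar_fn k t)"
    by (rule sum.reindex_bij_witness[of _ "\<lambda>k. Suc k - 2 ^ n" "\<lambda>i. 2 ^ n + i - 1"]) auto
  finally show "rademacher n t = (\<Sum>k\<in>{2 ^ n..<2 ^ Suc n}. haar_fn k t)" .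
qed

section \<open>Permutations with prescribed fibres\<close>

text \<open>The permutation lists the fibres of \<open>p\<close> one after another as blocks of length
  \<open>L\<close>.\<close>

lemma equal_fibres_permutation:
  fixes p :: "nat \<Rightarrow> nat"
  assumes p: "\<And>i. i < M * L \<Longrightarrow> p i < M"
    and fib: "\<And>q. q < M \<Longrightarrow> card {i. i < M * L \<and> p i = q} = L"
  obtains \<sigma> where "bij_betw \<sigma> {..<M * L} {..<M * L}" "\<And>j. j < M * L \<Longrightarrow> p (\<sigma> j) = j div L"
proof -
  have "\<exists>b. bij_betw b {0..<L} {i. i < M * L \<and> p i = q}" if "q < M" for q
    using ex_bij_betw_nat_finite[of "{i. i < M * L \<and> p i = q}"] fib[OF that] by simp
  then obtain b where b: "\<And>q. q < M \<Longrightarrow> bij_betw (b q) {0..<L} {i. i < M * L \<and> p i = q}" by metis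
  define \<sigma> where "\<sigma> j = b (j div L) (j mod L)" for j
  have in_range: "\<sigma> j < M * L \<and> p (\<sigma> j) = j div L" if "j < M * L" for j
  proof -
    have "j div L < M" using that by (simp add: less_mult_imp_div_less)
    moreover have "j mod L \<in> {0..<L}" using that by (cases "L = 0") auto
    ultimately have "\<sigma> j \<in> {i. i < M * L \<and> p i = j div L}"
      unfolding \<sigma>_def using b bij_betwE by blast
    then show ?thesis by simp
  qed
  have "inj_on \<sigma> {..<M * L}"
  proof (rule inj_onI)
    fix i j assume *: "i \<in> {..<M * L}" "j \<in> {..<M * L}" "\<sigma> i = \<sigma> j"
    then have d: "i div L = j div L" using in_range[of i] in_range[of j] by simp
    have "i div L < M" using * by (simp add: less_mult_imp_div_less)
    then have "inj_on (b (i div L)) {0..<L}" using b bij_betw_imp_inj_on by blast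
    moreover have "b (i div L) (i mod L) = b (i div L) (j mod L)" using *(3) d by (simp add: \<sigma>_def)
    moreover have "i mod L \<in> {0..<L}" "j mod L \<in> {0..<L}" using *(1,2) by (cases "L = 0"; auto)+
    ultimately have "i mod L = j mod L" by (meson inj_onD)
    with d show "i = j" by (metis div_mult_mod_eq)
  qed
  moreover have "\<sigma> ` {..<M * L} \<subseteq> {..<M * L}" using in_range by auto
  ultimately have "bij_betw \<sigma> {..<M * L} {..<M * L}"
    by (simp add: bij_betw_def endo_inj_surj)
  with in_range show thesis by (intro that) auto
qed

lemma mod_add_right_cancel_nat:
  fixes a b s L :: nat
  assumes "(a + s) mod L = (b + s) mod L" shows "a mod L = b mod L"
  using assms
proof (induction a b rule: linorder_wlog)
  case (le a b)
  then have "(b + s) mod L = (a + s) mod L" by simp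
  then show ?case
    using le(1) mod_eq_dvd_iff_nat[of "a + s" "b + s" L] mod_eq_dvd_iff_nat[of a b L] by simp
qed simp

text \<open>The map rotates every block of length \<open>L\<close> cyclically by \<open>s\<close>
  places.\<close>

lemma block_shift_bij:
  fixes L M s :: nat
  assumes "L > 0"
  defines "\<tau> \<equiv> \<lambda>j. (j div L) * L + (j + s) mod L"
  shows "bij_betw \<tau> {..<M * L} {..<M * L}" "\<tau> j div L = j div L"
proof -
  have d: "\<tau> j div L = j div L" for j using assms(1) by (simp add: \<tau>_def)
  have m: "\<tau> j mod L = (j + s) mod L" for j using assms(1) by (simp add: \<tau>_def)
  show "\<tau> j div L = j div L" by (rule d)
  have "inj_on \<tau> {..<M * L}"
  proof (rule inj_onI)
    fix i j assume "\<tau> i = \<tau> j"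
    then have 1: "i div L = j div L" and 2: "(i + s) mod L = (j + s) mod L" by (metis d, metis m)
    from 2 have "i mod L = j mod L" by (rule mod_add_right_cancel_nat)
    with 1 show "i = j" by (metis div_mult_mod_eq)
  qed
  moreover have "\<tau> ` {..<M * L} \<subseteq> {..<M * L}"
  proof
    fix y assume "y \<in> \<tau> ` {..<M * L}"
    then obtain j where "j < M * L" "y = \<tau> j" by auto
    then have "y div L < M" using d[of j] by (simp add: less_mult_imp_div_less)
    then show "y \<in> {..<M * L}" using assms(1) by (simp add: div_less_iff_less_mult)
  qed
  ultimately show "bij_betw \<tau> {..<M * L} {..<M * L}"
    by (simp add: bij_betw_def endo_inj_surj)
qed

lemma sum_block_shift:
  fixes u :: "nat \<Rightarrow> real"
  assumes "L > 0"
  shows "(\<Sum>s<L. u ((j div L) * L + (j + s) mod L)) = (\<Sum>i<L. u ((j div L) * L + i))"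
proof -
  have "inj_on (\<lambda>s. (j + s) mod L) {..<L}"
  proof (rule inj_onI)
    fix s s' assume "s \<in> {..<L}" "s' \<in> {..<L}" "(j + s) mod L = (j + s') mod L"
    then have "s mod L = s' mod L"
      using mod_add_right_cancel_nat[of s j L s'] by (simp add: add.commute)
    then show "s = s'" using \<open>s \<in> {..<L}\<close> \<open>s' \<in> {..<L}\<close> by simp
  qed
  moreover have "(\<lambda>s. (j + s) mod L) ` {..<L} \<subseteq> {..<L}" using assms by auto
  ultimately have "bij_betw (\<lambda>s. (j + s) mod L) {..<L} {..<L}"
    by (simp add: bij_betw_def endo_inj_surj)
  then show ?thesis by (rule sum.reindex_bij_betw)
qed

section \<open>Rearrangement invariance of the norm\<close>

locale haar_space =
  fixes N :: "(real \<Rightarrow> real) \<Rightarrow> real" and \<iota> :: "(real \<Rightarrow> real) \<Rightarrow> 'f::banach"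
  assumes haar_system_space: "haar_system_space N \<iota>"
begin

lemma N_zero_iff: "f \<in> haar_span \<Longrightarrow> N f = 0 \<longleftrightarrow> f = (\<lambda>t. 0)"
  and N_scale: "f \<in> haar_span \<Longrightarrow> N (\<lambda>t. c * f t) = \<bar>c\<bar> * N f"
  and N_triangle: "f \<in> haar_span \<Longrightarrow> g \<in> haar_span \<Longrightarrow> N (\<lambda>t. f t + g t) \<le> N f + N g"
  and N_distribution: "f \<in> haar_span \<Longrightarrow> g \<in> haar_span \<Longrightarrow>
        same_distribution (\<lambda>t. \<bar>f t\<bar>) (\<lambda>t. \<bar>g t\<bar>) \<Longrightarrow> N f = N g"
  and N_indicator: "N (indicator {0..<1}) = 1"
  and \<iota>_add: "f \<in> haar_span \<Longrightarrow> g \<in> haar_span \<Longrightarrow> \<iota> (\<lambda>t. f t + g t) = \<iota> f + \<iota> g"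
  and \<iota>_scale: "f \<in> haar_span \<Longrightarrow> \<iota> (\<lambda>t. c * f t) = c *\<^sub>R \<iota> f"
  and norm_\<iota>: "f \<in> haar_span \<Longrightarrow> norm (\<iota> f) = N f"
  and \<iota>_dense: "closure (\<iota> ` haar_span) = UNIV"
  using haar_system_space
  unfolding haar_system_space_def haar_system_norm_def norm_on_haar_span_def by blast+

lemma step_in_haar_span: "step_fun n v \<in> haar_span"
  by (rule steps_subset_haar_span[OF step_in_steps])

lemma zero_in_haar_span: "(\<lambda>t. 0) \<in> haar_span"
  by (rule steps_subset_haar_span[of _ 0]) simp

lemma \<iota>_zero: "\<iota> (\<lambda>t. 0) = 0"
  using \<iota>_scale[OF zero_in_haar_span, of 0] by simp

lemma \<iota>_diff: "f \<in> haar_span \<Longrightarrow> g \<in> haar_span \<Longrightarrow> \<iota> (\<lambda>t. f t - g t) = \<iota> f - \<iota> g"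
  using \<iota>_add[of f "\<lambda>t. (-1) * g t"] \<iota>_scale[of g "-1"] haar_span_scale[of g "-1"] by simp

lemma \<iota>_sum: "(\<And>j. j \<in> A \<Longrightarrow> f j \<in> haar_span) \<Longrightarrow> \<iota> (\<lambda>t. \<Sum>j\<in>A. f j t) = (\<Sum>j\<in>A. \<iota> (f j))"
  by (induction A rule: infinite_finite_induct) (auto simp: \<iota>_zero \<iota>_add haar_span_sum)

lemma N_sum: "(\<And>j. j \<in> A \<Longrightarrow> f j \<in> haar_span) \<Longrightarrow> N (\<lambda>t. \<Sum>j\<in>A. f j t) \<le> (\<Sum>j\<in>A. N (f j))"
proof (induction A rule: infinite_finite_induct)
  case (insert a A)
  then show ?case
    using N_triangle[of "f a" "\<lambda>t. \<Sum>j\<in>A. f j t"] by (simp add: haar_span_sum)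
qed (use N_zero_iff[OF zero_in_haar_span] in auto)

lemma N_abs_cong:
  assumes "f \<in> haar_span" "g \<in> haar_span" "\<And>t. \<bar>f t\<bar> = \<bar>g t\<bar>"
  shows "N f = N g"
  using assms by (intro N_distribution) (auto simp: same_distribution_def)

lemma N_one: "N (step_fun 0 (\<lambda>_. 1)) = 1"
proof -
  have "step_fun 0 (\<lambda>_. 1) = indicator {0..<1}" by (auto simp: step_fun_def indicator_def fun_eq_iff)
  then show ?thesis using N_indicator by simp
qed

lemma N_permute:
  assumes "bij_betw \<pi> {..<2 ^ n} {..<2 ^ n}"
  shows "N (step_fun n (\<lambda>i. v (\<pi> i))) = N (step_fun n v)"
proof (rule N_distribution)
  show "same_distribution (\<lambda>t. \<bar>step_fun n (\<lambda>i. v (\<pi> i)) t\<bar>) (\<lambda>t. \<bar>step_fun n v t\<bar>)"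
    unfolding step_linear(5) using step_same_distribution[OF assms, of "\<lambda>i. \<bar>v i\<bar>"] .
qed (rule step_in_haar_span)+

text \<open>A permutation of the intervals of level \<open>n\<close> makes the fibres of \<open>p\<close>
  consecutive. Then \<open>w \<circ> p\<close> is the step function \<open>w\<close> of level \<open>m\<close>
  written at level \<open>n\<close>, which gives the first part. For the second part, replacing a function by
  its mean over every fibre amounts to averaging its \<open>2 ^ (n - m)\<close> simultaneous cyclic rotations
  within the fibres, and each rotation preserves \<open>N\<close>.\<close>

lemma N_equal_fibres:
  assumes "m \<le> n"
    and p: "\<And>i. i < 2 ^ n \<Longrightarrow> p i < 2 ^ m"
    and fib: "\<And>q. q < 2 ^ m \<Longrightarrow> card {i. i < 2 ^ n \<and> p i = q} = 2 ^ (n - m)"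
  shows "N (step_fun n (\<lambda>i. w (p i))) = N (step_fun m w)" (is ?iso)
    and "N (step_fun m (\<lambda>q. \<Sum>i | i < 2 ^ n \<and> p i = q. v i)) \<le> 2 ^ (n - m) * N (step_fun n v)" (is ?avg)
proof -
  define L where "L = (2::nat) ^ (n - m)"
  define M where "M = (2::nat) ^ m"
  have size_eq: "M * L = 2 ^ n" and L: "L > 0" using assms(1) by (auto simp: L_def M_def power_add[symmetric])
  obtain \<sigma> where \<sigma>: "bij_betw \<sigma> {..<2 ^ n} {..<2 ^ n}" "\<And>j. j < 2 ^ n \<Longrightarrow> p (\<sigma> j) = j div L"
  proof (rule equal_fibres_permutation[of M L p, unfolded size_eq])
    show "p i < M" if "i < 2 ^ n" for i using p that by (simp add: M_def)
    show "card {i. i < 2 ^ n \<and> p i = q} = L" if "q < M" for q using fib that by (simp add: M_def L_def)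
  qed (rule that)
  have coarse: "step_fun n (\<lambda>j. w (j div L)) = step_fun m w" for w
    using step_refine[of m w "n - m"] assms(1) by (simp add: L_def)
  have "N (step_fun n (\<lambda>i. w (p i))) = N (step_fun n (\<lambda>j. w (p (\<sigma> j))))"
    by (rule N_permute[OF \<sigma>(1), symmetric])
  also have "step_fun n (\<lambda>j. w (p (\<sigma> j))) = step_fun n (\<lambda>j. w (j div L))"
    by (rule step_eqI) (simp add: \<sigma>)
  finally show ?iso by (simp add: coarse)
  define u where "u j = v (\<sigma> j)" for j
  define \<tau> where "\<tau> s j = (j div L) * L + (j + s) mod L" for s j
  define W where "W q = (\<Sum>i | i < 2 ^ n \<and> p i = q. v i)" for q
  have \<tau>: "bij_betw (\<tau> s) {..<2 ^ n} {..<2 ^ n}" for s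
    using block_shift_bij(1)[OF L, of s M] unfolding size_eq \<tau>_def .
  have Nu: "N (step_fun n (\<lambda>j. u (\<tau> s j))) = N (step_fun n v)" for s
    using N_permute[OF \<tau>, of u s] N_permute[OF \<sigma>(1), of v] unfolding u_def by simp
  have "step_fun n (\<lambda>j. \<Sum>s<L. u (\<tau> s j)) = step_fun n (\<lambda>j. W (j div L))"
  proof (rule step_eqI)
    fix j :: nat assume j: "j < 2 ^ n"
    have jM: "j div L < M" using j size_eq by (simp add: less_mult_imp_div_less)
    have "(\<Sum>s<L. u (\<tau> s j)) = (\<Sum>i<L. u ((j div L) * L + i))"
      unfolding \<tau>_def by (rule sum_block_shift[OF L])
    also have "\<dots> = W (j div L)"
      unfolding W_def u_def
    proof (rule sum.reindex_bij_betw)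
      have b2: "bij_betw \<sigma> {(j div L) * L..<(j div L) * L + L} {i. i < 2 ^ n \<and> p i = j div L}"
        unfolding bij_betw_def
      proof
        have sub: "{(j div L) * L..<(j div L) * L + L} \<subseteq> {..<2 ^ n}"
        proof -
          have "(j div L) * L + L \<le> M * L" using jM by (metis Suc_leI mult_Suc mult_le_mono1 add.commute)
          then show ?thesis using size_eq by auto
        qed
        then show "inj_on \<sigma> {(j div L) * L..<(j div L) * L + L}"
          using \<sigma>(1) bij_betw_imp_inj_on inj_on_subset by blast
        show "\<sigma> ` {(j div L) * L..<(j div L) * L + L} = {i. i < 2 ^ n \<and> p i = j div L}"
        proof (intro equalityI subsetI)
          fix i assume "i \<in> \<sigma> ` {(j div L) * L..<(j div L) * L + L}"
          then obtain l where l: "i = \<sigma> l" "l \<in> {(j div L) * L..<(j div L) * L + L}" by auto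
          then have "l < 2 ^ n" using sub by auto
          moreover have "l div L = j div L"
            using l(2) by (intro div_nat_eqI) (auto simp: algebra_simps)
          ultimately show "i \<in> {i. i < 2 ^ n \<and> p i = j div L}"
            using \<sigma> l(1) bij_betwE by fastforce
        next
          fix i assume i: "i \<in> {i. i < 2 ^ n \<and> p i = j div L}"
          then obtain l where l: "l < 2 ^ n" "i = \<sigma> l"
            using \<sigma>(1) unfolding bij_betw_def by (metis (no_types, lifting) image_iff lessThan_iff mem_Collect_eq)
          then have "l div L = j div L" using i \<sigma>(2) by auto
          then have "l \<in> {(j div L) * L..<(j div L) * L + L}"
            using L by (metis atLeastLessThan_iff div_mult_mod_eq le_add1 mod_less_divisor nat_add_left_cancel_less)
          with l show "i \<in> \<sigma> ` {(j div L) * L..<(j div L) * L + L}" by blast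
        qed
      qed
      have b1: "bij_betw (\<lambda>i. (j div L) * L + i) {..<L} {(j div L) * L..<(j div L) * L + L}"
        by (rule bij_betwI[where g="\<lambda>x. x - (j div L) * L"]) auto
      show "bij_betw (\<lambda>i. \<sigma> ((j div L) * L + i)) {..<L} {i. i < 2 ^ n \<and> p i = j div L}"
        using bij_betw_trans[OF b1 b2] by (simp only: o_def)
    qed
    finally show "(\<Sum>s<L. u (\<tau> s j)) = W (j div L)" .
  qed
  then have "N (step_fun m W) = N (\<lambda>t. \<Sum>s<L. step_fun n (\<lambda>j. u (\<tau> s j)) t)"
    by (simp add: coarse step_linear)
  also have "\<dots> \<le> (\<Sum>s<L. N (step_fun n (\<lambda>j. u (\<tau> s j))))"
    by (rule N_sum) (rule step_in_haar_span)
  also have "\<dots> = 2 ^ (n - m) * N (step_fun n v)" by (simp add: Nu) (simp add: L_def)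
  finally show ?avg unfolding W_def .
qed

text \<open>The mean value of \<open>\<bar>f\<bar>\<close> is the average over a single fibre.\<close>

lemma L1_le_N:
  assumes "f \<in> haar_span"
  shows "integral\<^sup>L M01 (\<lambda>t. \<bar>f t\<bar>) \<le> N f"
proof -
  obtain n v where f: "f = step_fun n v" using assms by (auto simp: haar_span_eq_steps step_funs_def)
  have "N (step_fun 0 (\<lambda>q. \<Sum>i | i < 2 ^ n \<and> 0 = q. \<bar>v i\<bar>)) \<le> 2 ^ (n - 0) * N (step_fun n (\<lambda>i. \<bar>v i\<bar>))"
    by (rule N_equal_fibres(2)) auto
  also have "N (step_fun n (\<lambda>i. \<bar>v i\<bar>)) = N f"
    unfolding f by (rule N_abs_cong[OF step_in_haar_span step_in_haar_span]) (simp add: step_fun_def)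
  also have "step_fun 0 (\<lambda>q. \<Sum>i | i < 2 ^ n \<and> 0 = q. \<bar>v i\<bar>) = (\<lambda>t. (\<Sum>i<2 ^ n. \<bar>v i\<bar>) * step_fun 0 (\<lambda>_. 1) t)"
    unfolding step_linear by (rule step_eqI) (simp add: lessThan_def)
  also have "N \<dots> = (\<Sum>i<2 ^ n. \<bar>v i\<bar>)"
    by (subst N_scale) (auto simp: N_one sum_nonneg step_in_haar_span)
  finally show ?thesis unfolding f step_linear(5) step_integral by (simp add: field_simps)
qed

text \<open>With \<open>g\<close> the indicator of the zero set of \<open>f\<close>, the function
  \<open>f\<close> is the midpoint of \<open>f + g\<close> and \<open>f - g\<close>, both of modulus
  one.\<close>

lemma N_le_1:
  assumes "f \<in> haar_span" "\<And>t. \<bar>f t\<bar> = 0 \<or> \<bar>f t\<bar> = 1"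
  shows "N f \<le> 1"
proof -
  define g where "g t = step_fun 0 (\<lambda>_. 1) t - \<bar>f t\<bar>" for t
  have one: "step_fun 0 (\<lambda>_. 1) \<in> haar_span" by (rule steps_subset_haar_span[of _ 0]) simp
  have g: "g \<in> haar_span" unfolding g_def by (intro haar_span_diff one haar_span_abs assms)
  have supp: "f t = 0" if "\<not> (0 \<le> t \<and> t < 1)" for t
    using assms(1) that by (auto simp: haar_span_eq_steps step_funs_def step_fun_def)
  have N1: "N (\<lambda>t. f t + g t) = 1" "N (\<lambda>t. f t - g t) = 1"
  proof -
    have "\<bar>f t + g t\<bar> = \<bar>step_fun 0 (\<lambda>_. 1) t\<bar>" "\<bar>f t - g t\<bar> = \<bar>step_fun 0 (\<lambda>_. 1) t\<bar>" for t
      using assms(2)[of t] supp[of t] by (auto simp: g_def step_fun_def split: if_splits)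
    then have "N (\<lambda>t. f t + g t) = N (step_fun 0 (\<lambda>_. 1))" "N (\<lambda>t. f t - g t) = N (step_fun 0 (\<lambda>_. 1))"
      using assms(1) g one by (intro N_abs_cong haar_span_add haar_span_diff; simp)+
    then show "N (\<lambda>t. f t + g t) = 1" "N (\<lambda>t. f t - g t) = 1" by (simp_all add: N_one)
  qed
  have "N (\<lambda>t. 2 * f t) = N (\<lambda>t. (f t + g t) + (f t - g t))"
    by (rule arg_cong[where f=N]) auto
  also have "\<dots> \<le> 1 + 1"
    using N_triangle[of "\<lambda>t. f t + g t" "\<lambda>t. f t - g t"] N1 assms(1) g
    by (simp add: haar_span_add haar_span_diff)
  finally show ?thesis using N_scale[OF assms(1), of 2] by simp
qed

lemma N_haar_fn_le_1: "N (haar_fn k) \<le> 1"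
proof (rule N_le_1[OF haar_fn_in_haar_span])
  show "\<bar>haar_fn k t\<bar> = 0 \<or> \<bar>haar_fn k t\<bar> = 1" for t
    by (cases "k = 0") (auto simp: haar_fn_0 haar_fn_abs chi_def step_fun_def)
qed

section \<open>Extension from step functions to the completion\<close>

lemma subspace_range: "subspace (\<iota> ` haar_span)"
proof (rule subspaceI)
  show "0 \<in> \<iota> ` haar_span" using \<iota>_zero zero_in_haar_span by (metis imageI)
  show "x + y \<in> \<iota> ` haar_span" if xy: "x \<in> \<iota> ` haar_span" "y \<in> \<iota> ` haar_span" for x y
  proof -
    obtain f g where "f \<in> haar_span" "g \<in> haar_span" "x = \<iota> f" "y = \<iota> g" using xy by auto
    then show ?thesis by (intro image_eqI[OF _ haar_span_add[of f g]]) (simp_all add: \<iota>_add)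
  qed
  show "c *\<^sub>R x \<in> \<iota> ` haar_span" if x: "x \<in> \<iota> ` haar_span" for c x
  proof -
    obtain f where "f \<in> haar_span" "x = \<iota> f" using x by auto
    then show ?thesis by (intro image_eqI[OF _ haar_span_scale[of f c]]) (simp_all add: \<iota>_scale)
  qed
qed

lemma \<iota>_inj:
  assumes "f \<in> haar_span" "g \<in> haar_span" "\<iota> f = \<iota> g" shows "f = g"
proof -
  have "N (\<lambda>t. f t - g t) = norm (\<iota> f - \<iota> g)"
    using assms by (simp add: norm_\<iota>[symmetric] \<iota>_diff haar_span_diff)
  then have "(\<lambda>t. f t - g t) = (\<lambda>t. 0)" using assms N_zero_iff haar_span_diff by simp
  then show ?thesis by (auto simp: fun_eq_iff)
qed

lemma extend_from_haar_span:
  fixes \<phi> :: "(real \<Rightarrow> real) \<Rightarrow> 'b::banach"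
  assumes add: "\<And>f g. f \<in> haar_span \<Longrightarrow> g \<in> haar_span \<Longrightarrow> \<phi> (\<lambda>t. f t + g t) = \<phi> f + \<phi> g"
    and scale: "\<And>c f. f \<in> haar_span \<Longrightarrow> \<phi> (\<lambda>t. c * f t) = c *\<^sub>R \<phi> f"
    and bd: "\<And>f. f \<in> haar_span \<Longrightarrow> norm (\<phi> f) \<le> K * N f"
  obtains G where "bounded_linear G" "\<And>f. f \<in> haar_span \<Longrightarrow> G (\<iota> f) = \<phi> f"
    "\<And>x. norm (G x) \<le> K * norm x"
proof -
  define \<psi> where "\<psi> x = \<phi> (inv_into haar_span \<iota> x)" for x
  have inj: "inj_on \<iota> haar_span" using \<iota>_inj by (rule inj_onI)
  have \<psi>: "\<psi> (\<iota> f) = \<phi> f" if "f \<in> haar_span" for f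
    using that by (simp add: \<psi>_def inv_into_f_f[OF inj])
  obtain G where G: "bounded_linear G" "\<And>x. x \<in> \<iota> ` haar_span \<Longrightarrow> G x = \<psi> x" "\<And>x. norm (G x) \<le> K * norm x"
  proof (rule bounded_linear_dense_extension[OF subspace_range \<iota>_dense])
    show "\<psi> (x + y) = \<psi> x + \<psi> y" if xy: "x \<in> \<iota> ` haar_span" "y \<in> \<iota> ` haar_span" for x y
    proof -
      obtain f g where "f \<in> haar_span" "g \<in> haar_span" "x = \<iota> f" "y = \<iota> g" using xy by auto
      then show ?thesis using \<psi>[OF haar_span_add] by (simp add: \<psi> add \<iota>_add)
    qed
    show "\<psi> (c *\<^sub>R x) = c *\<^sub>R \<psi> x" if x: "x \<in> \<iota> ` haar_span" for c x
    proof -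
      obtain f where "f \<in> haar_span" "x = \<iota> f" using x by auto
      then show ?thesis using \<psi>[OF haar_span_scale[of f c]] by (simp add: \<psi> scale \<iota>_scale)
    qed
    show "norm (\<psi> x) \<le> K * norm x" if "x \<in> \<iota> ` haar_span" for x
      using that bd by (auto simp: \<psi> norm_\<iota>)
  qed (rule that)
  then show thesis using that \<psi> by auto
qed

lemma eq_from_haar_span:
  assumes "bounded_linear F" "bounded_linear G" "\<And>f. f \<in> haar_span \<Longrightarrow> F (\<iota> f) = G (\<iota> f)"
  shows "F x = G x"
proof -
  have "closed {x. F x = G x}"
    using assms by (intro closed_Collect_eq linear_continuous_on)
  moreover have "\<iota> ` haar_span \<subseteq> {x. F x = G x}" using assms(3) by auto
  ultimately have "closure (\<iota> ` haar_span) \<subseteq> {x. F x = G x}" by (rule closure_minimal[rotated])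
  then show ?thesis using \<iota>_dense by auto
qed

lemma approx_from_haar_span:
  assumes "e > 0" obtains f where "f \<in> haar_span" "norm (x - \<iota> f) < e"
proof -
  have "x \<in> closure (\<iota> ` haar_span)" using \<iota>_dense by simp
  then show thesis using assms that by (auto simp: closure_approachable dist_norm norm_minus_commute)
qed

section \<open>The pairing on the completion\<close>

text \<open>A sequence of step functions that converges fast in the completion converges fast in mean, because
  \<open>N\<close> dominates the mean of the modulus.\<close>

lemma ex_represents: "\<exists>u. represents \<iota> x u"
proof -
  have "\<exists>f. f \<in> haar_span \<and> norm (x - \<iota> f) < (1/2) ^ n / 2" for n :: nat
  proof -
    have "(1/2) ^ n / 2 > (0::real)" by simp
    then show ?thesis by (metis approx_from_haar_span)
  qed
  then obtain z where z: "\<And>n::nat. z n \<in> haar_span" "\<And>n. norm (x - \<iota> (z n)) < (1/2) ^ n / 2" by metis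
  have fast: "(\<integral>t. \<bar>z (Suc n) t - z n t\<bar> \<partial>M01) \<le> (1/2) ^ n" for n
  proof -
    have "(\<integral>t. \<bar>z (Suc n) t - z n t\<bar> \<partial>M01) \<le> N (\<lambda>t. z (Suc n) t - z n t)"
      by (intro L1_le_N haar_span_diff z)
    also have "\<dots> = norm (\<iota> (z (Suc n)) - \<iota> (z n))"
      by (simp add: norm_\<iota>[symmetric] \<iota>_diff haar_span_diff z)
    also have "\<dots> \<le> norm (x - \<iota> (z n)) + norm (x - \<iota> (z (Suc n)))"
      using norm_triangle_ineq4[of "x - \<iota> (z n)" "x - \<iota> (z (Suc n))"] by simp
    also have "\<dots> \<le> (1/2) ^ n / 2 + (1/2) ^ Suc n / 2"
      using z(2)[of n] z(2)[of "Suc n"] by linarith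
    also have "\<dots> \<le> (1/2) ^ n" by simp
    finally show ?thesis .
  qed
  obtain u where u: "integrable M01 u" "(\<lambda>n. \<integral>t. \<bar>z n t - u t\<bar> \<partial>M01) \<longlonglongrightarrow> 0"
    by (rule integrable_limit_of_fast_L1_Cauchy[OF haar_span_integrable[OF z(1)] fast])
  have lim: "(\<lambda>n. \<iota> (z n)) \<longlonglongrightarrow> x"
  proof (rule metric_tendsto_imp_tendsto)
    show "(\<lambda>n. (1/2::real) ^ n / 2) \<longlonglongrightarrow> 0"
      by (intro tendsto_divide_zero LIMSEQ_realpow_zero) auto
    show "\<forall>\<^sub>F n in sequentially. dist (\<iota> (z n)) x \<le> dist ((1/2::real) ^ n / 2) 0"
      using z(2) by (intro always_eventually allI) (simp add: dist_norm norm_minus_commute less_imp_le)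
  qed
  show ?thesis
    unfolding represents_def by (intro exI[of _ u] conjI exI[of _ z] allI u z(1) lim)
qed

text \<open>On step functions the pairing is bounded by the mean of the modulus, hence by \<open>N\<close>,
  and so extends to a bounded functional \<open>G\<close> on the completion. Any function that represents
  \<open>x\<close> is a limit in mean of step functions that tend to \<open>x\<close> in the completion;
  passing to the limit, its integral against \<open>g\<close> is \<open>G x\<close>, whichever representative
  was selected.\<close>

lemma pairing_facts:
  assumes g: "g \<in> haar_span"
  shows pairing_bounded_linear: "bounded_linear (\<lambda>x. pairing \<iota> x g)"
    and pairing_\<iota>: "\<And>f. f \<in> haar_span \<Longrightarrow> pairing \<iota> (\<iota> f) g = ip f g"
    and abs_pairing_le: "\<And>C x. (\<And>t. \<bar>g t\<bar> \<le> C) \<Longrightarrow> \<bar>pairing \<iota> x g\<bar> \<le> C * norm x"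
proof -
  have ext: "\<exists>G. bounded_linear G \<and> (\<forall>f\<in>haar_span. G (\<iota> f) = ip f g) \<and> (\<forall>x. norm (G x) \<le> C * norm x)"
    if C: "\<And>t. \<bar>g t\<bar> \<le> C" for C
  proof -
    have C0: "0 \<le> C" using C[of 0] by linarith
    show ?thesis
    proof (rule extend_from_haar_span[of "\<lambda>f. ip f g" C])
      show "norm (ip f g) \<le> C * N f" if "f \<in> haar_span" for f
        using abs_ip_le[OF that g C] mult_left_mono[OF L1_le_N[OF that] C0] by simp
      fix G assume "bounded_linear G" "\<And>f. f \<in> haar_span \<Longrightarrow> G (\<iota> f) = ip f g"
        "\<And>x. norm (G x) \<le> C * norm x"
      then show ?thesis by (intro exI[of _ G]) simp
    qed (use g in \<open>simp_all add: ip_add ip_scale\<close>)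
  qed
  obtain C where C: "\<And>t. \<bar>g t\<bar> \<le> C" using haar_span_bounded[OF g] by metis
  from ext[OF C] obtain G where
    "bounded_linear G \<and> (\<forall>f\<in>haar_span. G (\<iota> f) = ip f g) \<and> (\<forall>x. norm (G x) \<le> C * norm x)"
    by (rule exE)
  then have G: "bounded_linear G" "\<And>f. f \<in> haar_span \<Longrightarrow> G (\<iota> f) = ip f g" by auto
  have pG: "pairing \<iota> x g = G x" for x
  proof -
    define u where "u = as_function \<iota> x"
    have "represents \<iota> x u" unfolding u_def as_function_def by (rule someI_ex[OF ex_represents])
    then obtain z where u: "integrable M01 u" and z: "\<And>n. z n \<in> haar_span" "(\<lambda>n. \<iota> (z n)) \<longlonglongrightarrow> x"
      "(\<lambda>n. \<integral>t. \<bar>z n t - u t\<bar> \<partial>M01) \<longlonglongrightarrow> 0"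
      unfolding represents_def by blast
    have gm: "g \<in> borel_measurable M01" using haar_span_integrable[OF g] by simp
    have ug: "integrable M01 (\<lambda>t. u t * g t)"
    proof (rule Bochner_Integration.integrable_bound)
      show "integrable M01 (\<lambda>t. C * u t)" using u by simp
      show "(\<lambda>t. u t * g t) \<in> borel_measurable M01" using u gm by simp
      show "AE t in M01. norm (u t * g t) \<le> norm (C * u t)"
      proof (rule AE_I2)
        fix t show "norm (u t * g t) \<le> norm (C * u t)"
          using C[of t] by (simp add: abs_mult mult.commute[of "\<bar>u t\<bar>"] mult_right_mono)
      qed
    qed
    have "(\<lambda>n. ip (z n) g) \<longlonglongrightarrow> (\<integral>t. u t * g t \<partial>M01)"
    proof (rule metric_tendsto_imp_tendsto)
      show "(\<lambda>n. C * (\<integral>t. \<bar>z n t - u t\<bar> \<partial>M01)) \<longlonglongrightarrow> 0"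
        using tendsto_mult_right_zero[OF z(3)] .
      show "\<forall>\<^sub>F n in sequentially. dist (ip (z n) g) (\<integral>t. u t * g t \<partial>M01) \<le> dist (C * (\<integral>t. \<bar>z n t - u t\<bar> \<partial>M01)) 0"
      proof (intro always_eventually allI)
        fix n
        have zu: "integrable M01 (\<lambda>t. \<bar>z n t - u t\<bar>)" using u haar_span_integrable[OF z(1)] by auto
        have "dist (ip (z n) g) (\<integral>t. u t * g t \<partial>M01) = \<bar>\<integral>t. z n t * g t - u t * g t \<partial>M01\<bar>"
          unfolding ip_def dist_real_def
          by (subst Bochner_Integration.integral_diff) (auto intro: ug ip_integrable[OF z(1) g])
        also have "\<dots> \<le> (\<integral>t. \<bar>z n t * g t - u t * g t\<bar> \<partial>M01)" by (rule integral_abs_bound)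
        also have "\<dots> \<le> (\<integral>t. C * \<bar>z n t - u t\<bar> \<partial>M01)"
        proof (rule integral_mono)
          show "integrable M01 (\<lambda>t. \<bar>z n t * g t - u t * g t\<bar>)"
            by (intro integrable_abs Bochner_Integration.integrable_diff ug ip_integrable[OF z(1) g])
          show "\<bar>z n t * g t - u t * g t\<bar> \<le> C * \<bar>z n t - u t\<bar>" for t
            using mult_right_mono[OF C[of t], of "\<bar>z n t - u t\<bar>"]
            by (simp add: abs_mult[symmetric] algebra_simps)
        qed (use zu in simp)
        also have "\<dots> \<le> dist (C * (\<integral>t. \<bar>z n t - u t\<bar> \<partial>M01)) 0" by simp
        finally show "dist (ip (z n) g) (\<integral>t. u t * g t \<partial>M01) \<le> dist (C * (\<integral>t. \<bar>z n t - u t\<bar> \<partial>M01)) 0" .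
      qed
    qed
    moreover have "(\<lambda>n. ip (z n) g) \<longlonglongrightarrow> G x"
      using bounded_linear.tendsto[OF G(1) z(2)] by (simp add: G(2) z(1))
    ultimately have "(\<integral>t. u t * g t \<partial>M01) = G x" by (rule LIMSEQ_unique)
    then show ?thesis by (simp add: pairing_def u_def)
  qed
  show "bounded_linear (\<lambda>x. pairing \<iota> x g)" using G(1) by (simp add: pG[abs_def] bounded_linear.bounded_linear)
  show "pairing \<iota> (\<iota> f) g = ip f g" if "f \<in> haar_span" for f using that by (simp add: pG G)
  show "\<bar>pairing \<iota> x g\<bar> \<le> C' * norm x" if C': "\<And>t. \<bar>g t\<bar> \<le> C'" for C' x
  proof -
    from ext[OF C'] obtain G' where
      "bounded_linear G' \<and> (\<forall>f\<in>haar_span. G' (\<iota> f) = ip f g) \<and> (\<forall>x. norm (G' x) \<le> C' * norm x)"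
      by (rule exE)
    then have G': "bounded_linear G'" "\<And>f. f \<in> haar_span \<Longrightarrow> G' (\<iota> f) = ip f g"
      "\<And>x. norm (G' x) \<le> C' * norm x" by auto
    have "G x = G' x" by (rule eq_from_haar_span[OF G(1) G'(1)]) (simp add: G G')
    then show ?thesis using G'(3)[of x] by (simp add: pG)
  qed
qed

lemma pairing_sum_right:
  assumes "\<And>j. j \<in> A \<Longrightarrow> g j \<in> haar_span"
  shows "pairing \<iota> x (\<lambda>t. \<Sum>j\<in>A. c j * g j t) = (\<Sum>j\<in>A. c j * pairing \<iota> x (g j))"
proof (rule eq_from_haar_span[where F="\<lambda>x. pairing \<iota> x (\<lambda>t. \<Sum>j\<in>A. c j * g j t)"])
  show "bounded_linear (\<lambda>x. pairing \<iota> x (\<lambda>t. \<Sum>j\<in>A. c j * g j t))"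
    by (intro pairing_bounded_linear haar_span_sum haar_span_scale assms)
  show "bounded_linear (\<lambda>x. \<Sum>j\<in>A. c j * pairing \<iota> x (g j))"
    by (intro bounded_linear_sum bounded_linear_const_mult pairing_bounded_linear assms)
  fix f assume f: "f \<in> haar_span"
  then show "pairing \<iota> (\<iota> f) (\<lambda>t. \<Sum>j\<in>A. c j * g j t) = (\<Sum>j\<in>A. c j * pairing \<iota> (\<iota> f) (g j))"
    using assms by (simp add: pairing_\<iota> haar_span_sum haar_span_scale ip_sum ip_scale)
qed

end

section \<open>Expansions in the Haar system\<close>

text \<open>The recursion determines \<open>H\<close> from \<open>G\<close>, and it is the one by which
  indicators of dyadic intervals arise from Haar functions. Hence \<open>H k\<close> has the same coefficients
  in \<open>G\<close> as \<open>chi k\<close> has in the Haar system. The lemma is applied to the Haar system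
  itself and to the system of blocks.\<close>

lemma haar_tree_expansion:
  fixes G H :: "nat \<Rightarrow> real \<Rightarrow> real"
  assumes root: "\<And>t. H 1 t = G 0 t"
    and left: "\<And>k t. 1 \<le> k \<Longrightarrow> H (2 * k) t = (1/2) * (H k t + G k t)"
    and right: "\<And>k t. 1 \<le> k \<Longrightarrow> H (2 * k + 1) t = (1/2) * (H k t - G k t)"
    and k: "1 \<le> k" "k < 2 ^ Suc n"
  shows "H k t = (\<Sum>j<2 ^ n. (ip (chi k) (haar_fn j) / mu j) * G j t)"
  using k
proof (induction k rule: less_induct)
  case (less k)
  have single: "(\<Sum>j<2 ^ n. (ip (haar_fn p) (haar_fn j) / mu j) * G j t) = G p t" if "p < 2 ^ n" for p
  proof -
    have "(\<Sum>j<2 ^ n. (ip (haar_fn p) (haar_fn j) / mu j) * G j t) = (\<Sum>j<2 ^ n. if j = p then G j t else 0)"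
      using mu_pos[of p] by (intro sum.cong) (auto simp: ip_haar_fn_self ip_haar_fn_orthogonal)
    then show ?thesis using that by simp
  qed
  show ?case
  proof (cases "k = 1")
    case True
    then show ?thesis using single[of 0] by (simp add: root[unfolded One_nat_def] chi_1 haar_fn_0)
  next
    case False
    define p where "p = k div 2"
    have p: "1 \<le> p" "p < k" "p < 2 ^ n" using False less.prems by (auto simp: p_def)
    have IH: "H p t = (\<Sum>j<2 ^ n. (ip (chi p) (haar_fn j) / mu j) * G j t)"
      using less.IH[OF p(2,1)] p(3) by simp
    note Z = chi_in_haar_span[OF p(1)] haar_fn_in_haar_span
    have "k = 2 * p \<or> k = 2 * p + 1" unfolding p_def by presburger
    then show ?thesis
    proof
      assume k: "k = 2 * p"
      have "ip (chi k) (haar_fn j) / mu j * G j t = (1/2) * (ip (chi p) (haar_fn j) / mu j * G j t)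
          + (1/2) * (ip (haar_fn p) (haar_fn j) / mu j * G j t)" for j
        unfolding k chi_children[OF p(1)] ip_scale ip_add(1)[OF Z Z(2)]
        by (simp add: add_divide_distrib distrib_right)
      then show ?thesis
        unfolding k left[OF p(1)] IH
        by (simp only: sum.distrib sum_distrib_left[symmetric] single[OF p(3)] k distrib_left)
    next
      assume k: "k = 2 * p + 1"
      have "ip (chi k) (haar_fn j) / mu j * G j t = (1/2) * (ip (chi p) (haar_fn j) / mu j * G j t)
          - (1/2) * (ip (haar_fn p) (haar_fn j) / mu j * G j t)" for j
        unfolding k chi_children[OF p(1)] ip_scale ip_diff(1)[OF Z Z(2)]
        by (simp add: diff_divide_distrib left_diff_distrib)
      then show ?thesis
        unfolding k right[OF p(1)] IH
        by (simp only: sum_subtractf sum_distrib_left[symmetric] single[OF p(3)] k right_diff_distrib)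
    qed
  qed
qed

lemma haar_expansion:
  assumes "f \<in> step_funs n"
  shows "f = (\<lambda>t. \<Sum>j<2 ^ n. (ip f (haar_fn j) / mu j) * haar_fn j t)"
proof
  fix t
  obtain v where v: "f = step_fun n v" using assms by (auto simp: step_funs_def)
  have Z: "chi (2 ^ n + i) \<in> haar_span" for i
    using one_le_power[of "2::nat" n] by (intro chi_in_haar_span) linarith
  have ipf: "ip f (haar_fn j) = (\<Sum>i<2 ^ n. v i * ip (chi (2 ^ n + i)) (haar_fn j))" for j
    unfolding v step_eq_sum_chi by (subst ip_sum) (auto intro: haar_span_scale Z haar_fn_in_haar_span simp: ip_scale)
  have chi: "chi (2 ^ n + i) t = (\<Sum>j<2 ^ n. (ip (chi (2 ^ n + i)) (haar_fn j) / mu j) * haar_fn j t)"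
    if "i < 2 ^ n" for i
  proof (rule haar_tree_expansion)
    show "chi 1 t = haar_fn 0 t" for t by (simp add: chi_1 haar_fn_0)
    show "chi (2 * k) t = (1/2) * (chi k t + haar_fn k t)" if "1 \<le> k" for k t
      by (simp only: chi_children(1)[OF that])
    show "chi (2 * k + 1) t = (1/2) * (chi k t - haar_fn k t)" if "1 \<le> k" for k t
      by (simp only: chi_children(2)[OF that])
    show "1 \<le> 2 ^ n + i" "2 ^ n + i < 2 ^ Suc n"
      using that one_le_power[of "2::nat" n] by simp_all
  qed
  have "f t = (\<Sum>i<2 ^ n. v i * (\<Sum>j<2 ^ n. (ip (chi (2 ^ n + i)) (haar_fn j) / mu j) * haar_fn j t))"
    unfolding v step_eq_sum_chi by (rule sum.cong) (simp_all only: lessThan_iff chi[symmetric])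
  also have "\<dots> = (\<Sum>j<2 ^ n. \<Sum>i<2 ^ n. v i * ((ip (chi (2 ^ n + i)) (haar_fn j) / mu j) * haar_fn j t))"
    unfolding sum_distrib_left by (rule sum.swap)
  also have "\<dots> = (\<Sum>j<2 ^ n. (ip f (haar_fn j) / mu j) * haar_fn j t)"
    unfolding ipf by (simp add: sum_distrib_right sum_divide_distrib mult.assoc)
  finally show "f t = (\<Sum>j<2 ^ n. (ip f (haar_fn j) / mu j) * haar_fn j t)" .
qed

text \<open>The Haar functions of one level have disjoint supports.\<close>

lemma level_sum:
  assumes "0 \<le> t" "t < 1"
  shows "(\<Sum>k\<in>{2 ^ n..<2 ^ Suc n}. c k * haar_fn k t) = c (2 ^ n + cell n t) * haar_fn (2 ^ n + cell n t) t"
proof -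
  let ?k = "2 ^ n + cell n t"
  have "?k \<in> {2 ^ n..<2 ^ Suc n}" using cell_less[OF assms, of n] by simp
  moreover have "haar_fn k t = 0" if "k \<in> {2 ^ n..<2 ^ Suc n}" "k \<noteq> ?k" for k
  proof -
    define i where "i = k - 2 ^ n"
    have i: "k = 2 ^ n + i" "i < 2 ^ n" using that(1) by (auto simp: i_def)
    have "\<bar>haar_fn k t\<bar> = chi k t" using i one_le_power[of "2::nat" n] by (intro haar_fn_abs) linarith
    also have "\<dots> = 0" using that(2) i by (auto simp: i(1) chi_node step_fun_def)
    finally show ?thesis by simp
  qed
  ultimately show ?thesis
    by (subst sum.remove[of _ ?k]) (auto intro!: sum.neutral)
qed

lemma haar_fn_at_node:
  assumes "0 \<le> t" "t < 1"
  shows "haar_fn (2 ^ n + cell n t) t * haar_fn (2 ^ n + cell n t) t = 1" "\<bar>haar_fn (2 ^ n + cell n t) t\<bar> = 1"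
proof -
  have "1 \<le> 2 ^ n + cell n t" using one_le_power[of "2::nat" n] by linarith
  moreover have "chi (2 ^ n + cell n t) t = 1"
    using assms by (subst chi_node) (auto simp: cell_less step_fun_def)
  ultimately show "haar_fn (2 ^ n + cell n t) t * haar_fn (2 ^ n + cell n t) t = 1" "\<bar>haar_fn (2 ^ n + cell n t) t\<bar> = 1"
    by (simp_all add: haar_fn_abs)
qed

lemma haar_fn_outside: "\<not> (0 \<le> t \<and> t < 1) \<Longrightarrow> haar_fn k t = 0"
  using haar_fn_in_haar_span[of k] by (auto simp: haar_span_eq_steps step_funs_def step_fun_def)

text \<open>The mean of the right-hand side over all choices of signs is the left-hand side. A good choice is
  found greedily: the sign of each new index makes its cross term with the earlier ones nonnegative.\<close>

lemma good_signs_exist: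
  fixes a :: "nat \<Rightarrow> nat \<Rightarrow> real"
  assumes "finite Q"
  shows "\<exists>\<epsilon>. (\<forall>k. \<bar>\<epsilon> k\<bar> = 1) \<and> (\<Sum>k\<in>Q. a k k) \<le> (\<Sum>k\<in>Q. \<Sum>l\<in>Q. \<epsilon> k * \<epsilon> l * a k l)"
  using assms
proof (induction Q rule: finite_induct)
  case empty
  show ?case by (intro exI[of _ "\<lambda>_. 1"]) simp
next
  case (insert q Q)
  then obtain \<epsilon> :: "nat \<Rightarrow> real" where e: "\<And>k. \<bar>\<epsilon> k\<bar> = 1"
    "(\<Sum>k\<in>Q. a k k) \<le> (\<Sum>k\<in>Q. \<Sum>l\<in>Q. \<epsilon> k * \<epsilon> l * a k l)" by blast
  \<comment> \<open>With sign \<open>s\<close> at \<open>q\<close> the cross terms between \<open>q\<close> and \<open>Q\<close> add up to \<open>s * c\<close>.\<close>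
  define c where "c = (\<Sum>k\<in>Q. \<epsilon> k * a k q) + (\<Sum>l\<in>Q. \<epsilon> l * a q l)"
  define s :: real where "s = (if c \<ge> 0 then 1 else - 1)"
  define \<epsilon>' where "\<epsilon>' = \<epsilon>(q := s)"
  have s: "s * s = 1" "\<bar>s\<bar> = 1" "s * c \<ge> 0" by (auto simp: s_def)
  have e': "\<epsilon>' k = \<epsilon> k" if "k \<in> Q" for k using that insert.hyps by (auto simp: \<epsilon>'_def)
  have q: "\<epsilon>' q = s" by (simp add: \<epsilon>'_def)
  have "(\<Sum>k\<in>insert q Q. \<Sum>l\<in>insert q Q. \<epsilon>' k * \<epsilon>' l * a k l)
      = s * s * a q q + (\<Sum>l\<in>Q. s * \<epsilon>' l * a q l) + ((\<Sum>k\<in>Q. \<epsilon>' k * s * a k q) + (\<Sum>k\<in>Q. \<Sum>l\<in>Q. \<epsilon>' k * \<epsilon>' l * a k l))"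
    using insert.hyps by (simp add: q sum.distrib)
  also have "(\<Sum>l\<in>Q. s * \<epsilon>' l * a q l) = s * (\<Sum>l\<in>Q. \<epsilon> l * a q l)"
    by (simp add: sum_distrib_left e' mult.assoc)
  also have "(\<Sum>k\<in>Q. \<epsilon>' k * s * a k q) = s * (\<Sum>k\<in>Q. \<epsilon> k * a k q)"
    unfolding sum_distrib_left by (rule sum.cong) (simp_all add: e')
  also have "(\<Sum>k\<in>Q. \<Sum>l\<in>Q. \<epsilon>' k * \<epsilon>' l * a k l) = (\<Sum>k\<in>Q. \<Sum>l\<in>Q. \<epsilon> k * \<epsilon> l * a k l)"
    by (simp add: e')
  finally have "(\<Sum>k\<in>insert q Q. \<Sum>l\<in>insert q Q. \<epsilon>' k * \<epsilon>' l * a k l)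
      = a q q + s * c + (\<Sum>k\<in>Q. \<Sum>l\<in>Q. \<epsilon> k * \<epsilon> l * a k l)"
    using s by (simp add: c_def algebra_simps)
  then have "(\<Sum>k\<in>insert q Q. a k k) \<le> (\<Sum>k\<in>insert q Q. \<Sum>l\<in>insert q Q. \<epsilon>' k * \<epsilon>' l * a k l)"
    using e(2) s(3) insert.hyps by simp
  moreover have "\<forall>k. \<bar>\<epsilon>' k\<bar> = 1" using e(1) s by (simp add: \<epsilon>'_def)
  ultimately show ?case by blast
qed

context haar_space
begin

abbreviation e :: "nat \<Rightarrow> 'f" where "e k \<equiv> \<iota> (haar_fn k)"

definition coef :: "nat \<Rightarrow> 'f \<Rightarrow> real" where
  "coef k x = pairing \<iota> x (haar_fn k) / mu k"

lemma coef_bounded_linear: "bounded_linear (coef k)"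
  unfolding coef_def[abs_def] using bounded_linear_compose[OF bounded_linear_divide pairing_bounded_linear[OF haar_fn_in_haar_span]] .

lemma coef_e: "coef j (e k) = of_bool (j = k)"
  using mu_pos[of j] by (auto simp: coef_def pairing_\<iota> haar_fn_in_haar_span ip_haar_fn_self ip_haar_fn_orthogonal)

lemma abs_coef_le: "\<bar>coef k x\<bar> \<le> norm x / mu k"
  using abs_pairing_le[OF haar_fn_in_haar_span, of k 1 x] mu_pos[of k] haar_fn_bounded[of k]
  by (simp add: coef_def divide_right_mono)

lemma norm_e_le_1: "norm (e k) \<le> 1"
  by (simp add: norm_\<iota> haar_fn_in_haar_span N_haar_fn_le_1)

text \<open>The functional given by \<open>haar_fn k\<close> is tested at \<open>haar_fn k\<close>.\<close>

lemma mu_le_norm_times_dual_norm: "mu k \<le> norm (e k) * dual_norm \<iota> (haar_fn k)"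
proof -
  have "norm (pairing \<iota> (e k) (haar_fn k)) \<le> onorm (\<lambda>x. pairing \<iota> x (haar_fn k)) * norm (e k)"
    by (rule onorm) (rule pairing_bounded_linear[OF haar_fn_in_haar_span])
  then show ?thesis
    using mu_pos[of k] by (simp add: pairing_\<iota> haar_fn_in_haar_span ip_haar_fn_self dual_norm_def mult.commute)
qed

text \<open>On a step function of level \<open>n\<close> the map is given by the first \<open>2 ^ n\<close>
  coefficients. Summing over the finite set of nonzero coefficients makes its definition independent of
  \<open>n\<close>.\<close>

lemma extend_from_haar_basis:
  fixes G :: "nat \<Rightarrow> 'b::banach"
  assumes bd: "\<And>n a. norm (\<Sum>j<2 ^ n. a j *\<^sub>R G j) \<le> K * N (\<lambda>t. \<Sum>j<2 ^ n. a j * haar_fn j t)"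
  obtains L where "bounded_linear L" "\<And>k. L (e k) = G k"
proof -
  define \<phi> where "\<phi> f = (\<Sum>j | ip f (haar_fn j) \<noteq> 0. (ip f (haar_fn j) / mu j) *\<^sub>R G j)" for f
  have \<phi>: "\<phi> f = (\<Sum>j<2 ^ n. (ip f (haar_fn j) / mu j) *\<^sub>R G j)" if f: "f \<in> step_funs n" for f n
    unfolding \<phi>_def
  proof (rule sum.mono_neutral_left)
    show "{j. ip f (haar_fn j) \<noteq> 0} \<subseteq> {..<2 ^ n}"
    proof (rule subsetI, rule ccontr)
      fix j assume "j \<in> {j. ip f (haar_fn j) \<noteq> 0}" "j \<notin> {..<2 ^ n}"
      then show False using ip_step_haar_fn_eq_0[OF f, of j] by simp
    qed
  qed auto
  obtain L where L: "bounded_linear L" "\<And>f. f \<in> haar_span \<Longrightarrow> L (\<iota> f) = \<phi> f" "\<And>x. norm (L x) \<le> K * norm x"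
  proof (rule extend_from_haar_span[of \<phi> K])
    fix f g :: "real \<Rightarrow> real" assume fg: "f \<in> haar_span" "g \<in> haar_span"
    then obtain n where n: "f \<in> step_funs n" "g \<in> step_funs n" by (rule haar_span_common_level)
    show "\<phi> (\<lambda>t. f t + g t) = \<phi> f + \<phi> g"
      unfolding \<phi>[OF n(1)] \<phi>[OF n(2)] \<phi>[OF steps_closed(1)[OF n]] using fg
      by (simp add: ip_add haar_fn_in_haar_span sum.distrib[symmetric] add_divide_distrib scaleR_add_left)
  next
    fix f :: "real \<Rightarrow> real" and c assume f: "f \<in> haar_span"
    then obtain n where n: "f \<in> step_funs n" by (auto simp: haar_span_eq_steps)
    show "\<phi> (\<lambda>t. c * f t) = c *\<^sub>R \<phi> f"
      unfolding \<phi>[OF n(1)] \<phi>[OF steps_closed(4)[OF n]]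
      by (simp add: ip_scale scaleR_sum_right)
    show "norm (\<phi> f) \<le> K * N f"
      unfolding \<phi>[OF n] using bd[where a="\<lambda>j. ip f (haar_fn j) / mu j" and n=n] haar_expansion[OF n] by simp
  qed (rule that)
  have "L (e k) = G k" for k
  proof -
    have k: "haar_fn k \<in> step_funs k" by (rule haar_fn_in_steps) (rule less_exp)
    have "L (e k) = (\<Sum>j<2 ^ k. (ip (haar_fn k) (haar_fn j) / mu j) *\<^sub>R G j)"
      using L(2)[OF haar_fn_in_haar_span] \<phi>[OF k] by simp
    also have "\<dots> = (\<Sum>j<2 ^ k. if j = k then G k else 0)"
      using mu_pos[of k] by (intro sum.cong) (auto simp: ip_haar_fn_self ip_haar_fn_orthogonal)
    also have "\<dots> = G k" using less_exp[of k] by simp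
    finally show ?thesis .
  qed
  with L(1) show thesis by (rule that)
qed

end

section \<open>Multipliers and decay along the levels\<close>

locale unconditional_haar_space = haar_space N \<iota> for N and \<iota> :: "(real \<Rightarrow> real) \<Rightarrow> 'f::banach" +
  assumes unconditional: "unconditional_schauder_basis e"
begin

text \<open>The functionals \<open>coef k\<close> are continuous and biorthogonal to the basis, so they are
  its coefficient functionals.\<close>

lemma coef_expansion: "(\<lambda>j. coef j x *\<^sub>R e j) sums x" "((\<lambda>j. coef j x *\<^sub>R e j) has_sum x) UNIV"
proof -
  obtain a where a: "(\<lambda>j. a j *\<^sub>R e j) sums x"
    using unconditional unfolding unconditional_schauder_basis_def schauder_basis_def by blast
  have "coef k x = a k" for k
  proof -
    interpret c: bounded_linear "coef k" by (rule coef_bounded_linear)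
    have "(\<lambda>j. coef k (a j *\<^sub>R e j)) sums coef k x" by (rule c.sums[OF a])
    moreover have "coef k (a j *\<^sub>R e j) = (if j = k then a j else 0)" for j
      by (simp add: c.scaleR coef_e)
    ultimately have "(\<lambda>j. if j = k then a j else 0) sums coef k x" by simp
    then show ?thesis using sums_single[of k a] sums_unique2 by blast
  qed
  then have 1: "(\<lambda>j. coef j x *\<^sub>R e j) sums x" using a by simp
  then show "(\<lambda>j. coef j x *\<^sub>R e j) sums x" .
  show "((\<lambda>j. coef j x *\<^sub>R e j) has_sum x) UNIV"
    using 1 unconditional[unfolded unconditional_schauder_basis_def, THEN conjunct2, rule_format, of "\<lambda>j. coef j x" x]
    by simp
qed

lemma eq_from_haar_basis:
  assumes "bounded_linear F" "bounded_linear G" "\<And>k. F (e k) = G (e k)"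
  shows "F x = G x"
proof -
  interpret F: bounded_linear F by fact
  interpret G: bounded_linear G by fact
  have "F (coef j x *\<^sub>R e j) = G (coef j x *\<^sub>R e j)" for j
    by (simp add: F.scaleR G.scaleR assms(3))
  then have "(\<lambda>j. G (coef j x *\<^sub>R e j)) sums F x"
    using F.sums[OF coef_expansion(1)[of x]] by simp
  then show ?thesis
    using G.sums[OF coef_expansion(1)[of x]] by (rule sums_unique2)
qed

text \<open>Unconditional convergence bounds, for each \<open>x\<close>, all the finite subsums of its
  expansion. (For infinite \<open>A\<close> the sum is zero by convention.) The bound is uniform by the
  theorem of Banach and Steinhaus.\<close>

lemma subset_projections_uniformly_bounded:
  obtains C where "C \<ge> 0" "\<And>A x. norm (\<Sum>j\<in>A. coef j x *\<^sub>R e j) \<le> C * norm x"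
proof -
  have lin: "bounded_linear (\<lambda>x. \<Sum>j\<in>A. coef j x *\<^sub>R e j)" for A
    by (intro bounded_linear_sum bounded_linear_scaleR_left[THEN bounded_linear_compose] coef_bounded_linear)
  have pw: "\<exists>C. \<forall>A. norm (\<Sum>j\<in>A. coef j x *\<^sub>R e j) \<le> C" for x
  proof -
    let ?f = "\<lambda>j. coef j x *\<^sub>R e j"
    have "\<forall>\<^sub>F A in finite_subsets_at_top UNIV. dist (sum ?f A) x < 1"
      using coef_expansion(2)[of x] unfolding has_sum_def by (rule tendstoD) simp
    then obtain F where F: "finite F" "\<And>A. finite A \<Longrightarrow> F \<subseteq> A \<Longrightarrow> dist (sum ?f A) x < 1"
      unfolding eventually_finite_subsets_at_top by auto
    have "norm (sum ?f A) \<le> norm x + 1 + (\<Sum>j\<in>F. norm (?f j))" for A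
    proof (cases "finite A")
      case True
      have "sum ?f A = sum ?f (A \<union> F) - sum ?f (F - A)"
        using True F(1) sum.union_disjoint[of A "F - A" ?f] by (simp add: Un_Diff_cancel Int_Diff)
      then have "norm (sum ?f A) \<le> norm (sum ?f (A \<union> F)) + norm (sum ?f (F - A))"
        using norm_triangle_ineq4[of "sum ?f (A \<union> F)" "sum ?f (F - A)"] by (simp only:)
      moreover have "norm (sum ?f (A \<union> F)) \<le> norm x + 1"
        using F(2)[of "A \<union> F"] True F(1) norm_triangle_ineq2[of "sum ?f (A \<union> F)" x] by (simp add: dist_norm)
      moreover have "norm (sum ?f (F - A)) \<le> (\<Sum>j\<in>F. norm (?f j))"
        by (rule order_trans[OF norm_sum sum_mono2]) (use F(1) in auto)
      ultimately show ?thesis by linarith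
    qed (auto intro!: add_nonneg_nonneg sum_nonneg)
    then show ?thesis by blast
  qed
  obtain C where C: "\<And>A x. norm (\<Sum>j\<in>A. coef j x *\<^sub>R e j) \<le> C * norm x"
    by (rule banach_steinhaus[of "\<lambda>A x. \<Sum>j\<in>A. coef j x *\<^sub>R e j", OF lin pw]) (rule that)
  have "norm (\<Sum>j\<in>A. coef j x *\<^sub>R e j) \<le> \<bar>C\<bar> * norm x" for A x
    by (rule order_trans[OF C]) (simp add: mult_right_mono)
  then show thesis by (intro that[of "\<bar>C\<bar>"]) auto
qed

text \<open>The positive and negative parts of \<open>m\<close> take values between \<open>0\<close> and
  \<open>1\<close>, so the corresponding weighted sums are controlled by the subset projections.\<close>

lemma multiplier_exists:
  assumes m: "\<And>j. \<bar>m j\<bar> \<le> 1"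
  obtains M where "bounded_linear M" "\<And>k. M (e k) = m k *\<^sub>R e k"
proof -
  obtain C where C: "C \<ge> 0" "\<And>A x. norm (\<Sum>j\<in>A. coef j x *\<^sub>R e j) \<le> C * norm x"
    by (rule subset_projections_uniformly_bounded) (rule that)
  show thesis
  proof (rule extend_from_haar_basis[of "\<lambda>j. m j *\<^sub>R e j" "2 * C"])
    fix n and a :: "nat \<Rightarrow> real"
    define x where "x = \<iota> (\<lambda>t. \<Sum>j<2 ^ n. a j * haar_fn j t)"
    have inZ: "(\<lambda>t. \<Sum>j<2 ^ n. a j * haar_fn j t) \<in> haar_span"
      by (intro haar_span_sum haar_span_scale haar_fn_in_haar_span)
    have x: "x = (\<Sum>j<2 ^ n. a j *\<^sub>R e j)"
      unfolding x_def by (subst \<iota>_sum) (auto intro: haar_span_scale haar_fn_in_haar_span simp: \<iota>_scale haar_fn_in_haar_span)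
    have cx: "coef k x = a k" if "k < 2 ^ n" for k
    proof -
      interpret c: bounded_linear "coef k" by (rule coef_bounded_linear)
      have "coef k x = (\<Sum>j<2 ^ n. if j = k then a j else 0)"
        unfolding x c.sum c.scaleR by (rule sum.cong) (auto simp: coef_e)
      then show ?thesis using that by simp
    qed
    have part: "norm (\<Sum>j<2 ^ n. p j *\<^sub>R (a j *\<^sub>R e j)) \<le> C * norm x" if p: "\<And>j. 0 \<le> p j \<and> p j \<le> 1" for p
    proof -
      have "norm (0 + (\<Sum>j<2 ^ n. p j *\<^sub>R (a j *\<^sub>R e j))) \<le> C * norm x"
      proof (rule norm_sum_subunit_coeffs_le)
        fix B :: "nat set" assume B: "B \<subseteq> {..<2 ^ n}"
        have "(\<Sum>j\<in>B. a j *\<^sub>R e j) = (\<Sum>j\<in>B. coef j x *\<^sub>R e j)"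
          using B cx by (intro sum.cong) auto
        then show "norm (0 + (\<Sum>j\<in>B. a j *\<^sub>R e j)) \<le> C * norm x" using C(2)[of x B] by simp
      qed (use p in auto)
      then show ?thesis by simp
    qed
    have "(\<Sum>j<2 ^ n. a j *\<^sub>R (m j *\<^sub>R e j)) =
        (\<Sum>j<2 ^ n. max 0 (m j) *\<^sub>R (a j *\<^sub>R e j)) - (\<Sum>j<2 ^ n. max 0 (- m j) *\<^sub>R (a j *\<^sub>R e j))"
      unfolding sum_subtractf[symmetric] scaleR_diff_left[symmetric]
    proof (rule sum.cong[OF refl])
      fix j
      have "max 0 (m j) - max 0 (- m j) = m j" by simp
      then show "a j *\<^sub>R (m j *\<^sub>R e j) = (max 0 (m j) - max 0 (- m j)) *\<^sub>R (a j *\<^sub>R e j)"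
        by (simp only: scaleR_scaleR mult.commute)
    qed
    also have "norm \<dots> \<le> C * norm x + C * norm x"
      using m by (intro order_trans[OF norm_triangle_ineq4] add_mono part) (auto simp: abs_le_iff)
    finally show "norm (\<Sum>j<2 ^ n. a j *\<^sub>R (m j *\<^sub>R e j)) \<le> 2 * C * N (\<lambda>t. \<Sum>j<2 ^ n. a j * haar_fn j t)"
      using norm_\<iota>[OF inZ] by (simp add: x_def)
  qed (rule that)
qed

text \<open>A single multiplier \<open>M\<close> with the signs of all the numbers \<open>\<phi> (e k)\<close>
  turns the sum of moduli over level \<open>n\<close> into the value of the one functional \<open>\<phi>
  \<circ> M\<close> at the Rademacher function of that level, whatever \<open>n\<close> is.\<close>

lemma functional_level_sums_tendsto_0:
  assumes wn: "weakly_null (\<lambda>n. \<iota> (rademacher (Suc n)))" and \<phi>: "bounded_linear (\<phi> :: 'f \<Rightarrow> real)"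
  shows "(\<lambda>n. \<Sum>k\<in>{2 ^ n..<2 ^ Suc n}. \<bar>\<phi> (e k)\<bar>) \<longlonglongrightarrow> 0"
proof -
  obtain M where M: "bounded_linear M" "\<And>k. M (e k) = sgn (\<phi> (e k)) *\<^sub>R e k"
    by (rule multiplier_exists[of "\<lambda>k. sgn (\<phi> (e k))"]) (simp add: abs_sgn_eq, rule that)
  interpret \<phi>M: bounded_linear "\<lambda>x. \<phi> (M x)" using bounded_linear_compose[OF \<phi> M(1)] .
  interpret \<phi>: bounded_linear \<phi> by (rule \<phi>)
  have "(\<lambda>n. \<phi> (M (\<iota> (rademacher (Suc n))))) \<longlonglongrightarrow> 0"
    using wn \<phi>M.bounded_linear_axioms unfolding weakly_null_def by blast
  moreover have "\<phi> (M (\<iota> (rademacher n))) = (\<Sum>k\<in>{2 ^ n..<2 ^ Suc n}. \<bar>\<phi> (e k)\<bar>)" for n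
  proof -
    have "\<iota> (rademacher n) = (\<Sum>k\<in>{2 ^ n..<2 ^ Suc n}. e k)"
      unfolding rademacher_eq_sum_haar_fn by (rule \<iota>_sum) (rule haar_fn_in_haar_span)
    then have "\<phi> (M (\<iota> (rademacher n))) = (\<Sum>k\<in>{2 ^ n..<2 ^ Suc n}. \<phi> (M (e k)))"
      by (simp only: \<phi>M.sum)
    moreover have "\<phi> (M (e k)) = \<bar>\<phi> (e k)\<bar>" for k
      by (simp add: M(2) \<phi>.scaleR abs_sgn mult.commute)
    ultimately show ?thesis by (simp only:)
  qed
  ultimately have "(\<lambda>n. \<Sum>k\<in>{2 ^ Suc n..<2 ^ Suc (Suc n)}. \<bar>\<phi> (e k)\<bar>) \<longlonglongrightarrow> 0" by simp
  then show ?thesis by (rule LIMSEQ_imp_Suc)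
qed

end

context haar_space begin

text \<open>Up to a small error \<open>y\<close> is a step function, which is orthogonal to all high levels.
  The error is paired with a signed sum of disjointly supported Haar functions, whose modulus is at most
  one.\<close>

lemma pairing_level_sums_tendsto_0:
  "(\<lambda>n. \<Sum>k\<in>{2 ^ n..<2 ^ Suc n}. \<bar>pairing \<iota> y (haar_fn k)\<bar>) \<longlonglongrightarrow> 0"
proof (rule LIMSEQ_I)
  fix r :: real assume "r > 0"
  then obtain z where z: "z \<in> haar_span" "norm (y - \<iota> z) < r" by (rule approx_from_haar_span)
  obtain n0 where n0: "z \<in> step_funs n0" using z by (auto simp: haar_span_eq_steps)
  have "norm ((\<Sum>k\<in>{2 ^ n..<2 ^ Suc n}. \<bar>pairing \<iota> y (haar_fn k)\<bar>) - 0) < r" if "n \<ge> n0" for n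
  proof -
    define s where "s k = sgn (pairing \<iota> (y - \<iota> z) (haar_fn k))" for k
    have eq: "pairing \<iota> y (haar_fn k) = pairing \<iota> (y - \<iota> z) (haar_fn k)" if k: "k \<in> {2 ^ n..<2 ^ Suc n}" for k
    proof -
      have "z \<in> step_funs n" using n0 steps_mono[OF \<open>n \<ge> n0\<close>] by blast
      then have "pairing \<iota> (\<iota> z) (haar_fn k) = 0"
        using k z by (simp add: pairing_\<iota> haar_fn_in_haar_span ip_step_haar_fn_eq_0)
      then show ?thesis
        using linear_diff[OF bounded_linear.linear[OF pairing_bounded_linear[OF haar_fn_in_haar_span[of k]]], of y "\<iota> z"] by simp
    qed
    have "(\<Sum>k\<in>{2 ^ n..<2 ^ Suc n}. \<bar>pairing \<iota> y (haar_fn k)\<bar>) = (\<Sum>k\<in>{2 ^ n..<2 ^ Suc n}. s k * pairing \<iota> (y - \<iota> z) (haar_fn k))"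
      by (rule sum.cong) (simp_all add: eq s_def abs_sgn mult.commute)
    also have "\<dots> = pairing \<iota> (y - \<iota> z) (\<lambda>t. \<Sum>k\<in>{2 ^ n..<2 ^ Suc n}. s k * haar_fn k t)"
      by (rule pairing_sum_right[symmetric]) (rule haar_fn_in_haar_span)
    finally have sum_eq: "(\<Sum>k\<in>{2 ^ n..<2 ^ Suc n}. \<bar>pairing \<iota> y (haar_fn k)\<bar>) = \<dots>" .
    have "\<bar>\<Sum>k\<in>{2 ^ n..<2 ^ Suc n}. s k * haar_fn k t\<bar> \<le> 1" for t
    proof (cases "0 \<le> t \<and> t < 1")
      case True
      then show ?thesis by (subst level_sum) (auto simp: abs_mult haar_fn_at_node s_def abs_sgn_eq)
    next
      case False
      then show ?thesis by (simp add: haar_fn_outside)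
    qed
    then have "\<bar>pairing \<iota> (y - \<iota> z) (\<lambda>t. \<Sum>k\<in>{2 ^ n..<2 ^ Suc n}. s k * haar_fn k t)\<bar> \<le> 1 * norm (y - \<iota> z)"
      by (intro abs_pairing_le haar_span_sum haar_span_scale haar_fn_in_haar_span)
    then show ?thesis unfolding sum_eq using z(2) by simp
  qed
  then show "\<exists>n0. \<forall>n\<ge>n0. norm ((\<Sum>k\<in>{2 ^ n..<2 ^ Suc n}. \<bar>pairing \<iota> y (haar_fn k)\<bar>) - 0) < r" by blast
qed

end

section \<open>Construction of the block system\<close>

text \<open>If \<open>F\<close> is a system of blocks, this is the indicator of the set that is to support
  \<open>F k\<close>. Only the blocks with numbers below \<open>k\<close> enter, so that the blocks can be
  constructed recursively.\<close>

fun block_indicator :: "(nat \<Rightarrow> real \<Rightarrow> real) \<Rightarrow> nat \<Rightarrow> real \<Rightarrow> real" where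
  "block_indicator F k = (if k \<le> 1 then step_fun 0 (\<lambda>_. 1)
     else (\<lambda>t. (1/2) * (block_indicator F (k div 2) t + (if even k then 1 else -1) * F (k div 2) t)))"

declare block_indicator.simps [simp del]

lemma block_indicator_root: "block_indicator F (Suc 0) = step_fun 0 (\<lambda>_. 1)"
  by (simp add: block_indicator.simps)

lemma block_indicator_children:
  assumes "1 \<le> k"
  shows "block_indicator F (2 * k) t = (1/2) * (block_indicator F k t + F k t)"
    and "block_indicator F (2 * k + 1) t = (1/2) * (block_indicator F k t - F k t)"
  using assms by (subst block_indicator.simps; simp)+

lemma block_indicator_cong: "(\<And>l. l < k \<Longrightarrow> F l = F' l) \<Longrightarrow> block_indicator F k = block_indicator F' k"
proof (induction k rule: less_induct)
  case (less k)
  show ?case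
  proof (cases "k \<le> 1")
    case False
    then have p: "k div 2 < k" by simp
    have "block_indicator F (k div 2) = block_indicator F' (k div 2)"
      using less.prems by (intro less.IH p) simp
    moreover have "F (k div 2) = F' (k div 2)" by (intro less.prems p)
    ultimately show ?thesis by (subst (1 2) block_indicator.simps) simp
  qed (simp add: block_indicator.simps)
qed

text \<open>Where the indicator of the parent is \<open>1\<close> the parent block is \<open>1\<close> or
  \<open>- 1\<close>, and where it is \<open>0\<close> so is the block; in each case the recursion yields
  \<open>0\<close> or \<open>1\<close>.\<close>

lemma block_indicator_idempotent:
  assumes "\<And>l. 1 \<le> l \<Longrightarrow> l < k \<Longrightarrow> F l \<in> haar_span \<and> (\<forall>t. F l t * F l t = block_indicator F l t)" "1 \<le> k"
  shows "block_indicator F k \<in> haar_span \<and> (\<forall>t. block_indicator F k t * block_indicator F k t = block_indicator F k t)"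
  using assms
proof (induction k rule: less_induct)
  case (less k)
  show ?case
  proof (cases "k = 1")
    case True
    then show ?thesis
      using steps_subset_haar_span[OF step_in_steps] by (auto simp: block_indicator_root step_fun_def)
  next
    case False
    define p where "p = k div 2"
    have p: "1 \<le> p" "p < k" using False less.prems(2) by (auto simp: p_def)
    define s :: real where "s = (if even k then 1 else -1)"
    have g: "block_indicator F p \<in> haar_span" "\<And>t. block_indicator F p t * block_indicator F p t = block_indicator F p t"
      using less.IH[OF p(2)] less.prems(1) p by auto
    have F: "F p \<in> haar_span" "\<And>t. F p t * F p t = block_indicator F p t"
      using less.prems(1)[OF p] by auto
    have k: "block_indicator F k = (\<lambda>t. (1/2) * (block_indicator F p t + s * F p t))"
      using False less.prems(2) by (subst block_indicator.simps) (simp add: p_def s_def)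
    have "block_indicator F k t * block_indicator F k t = block_indicator F k t" for t
    proof -
      have "block_indicator F p t = 0 \<or> block_indicator F p t = 1" using g(2)[of t] by auto
      then show ?thesis
      proof
        assume "block_indicator F p t = 0"
        with F(2)[of t] show ?thesis by (simp add: k)
      next
        assume 1: "block_indicator F p t = 1"
        with F(2)[of t] have "F p t = 1 \<or> F p t = -1" by (simp add: square_eq_1_iff)
        with 1 show ?thesis by (auto simp: k s_def)
      qed
    qed
    moreover have "block_indicator F k \<in> haar_span"
      unfolding k by (intro haar_span_scale haar_span_add g F)
    ultimately show ?thesis by blast
  qed
qed

context unconditional_haar_space begin

text \<open>One step of the construction: \<open>g\<close> is the indicator of the prescribed support and
  \<open>Y\<close> the set of earlier blocks. The new block \<open>r\<close> is a signed sum of the Haar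
  functions of a level \<open>n\<close> that live where \<open>g = 1\<close>. The two decay lemmas, which hold
  uniformly in the signs, make the interaction with \<open>Y\<close> small for large \<open>n\<close>; the
  signs are then free to make the diagonal term large.\<close>

lemma block_exists:
  fixes S :: "'f \<Rightarrow> 'f"
  assumes wn: "weakly_null (\<lambda>n. \<iota> (rademacher (Suc n)))"
    and S: "bounded_linear S"
    and diag: "\<And>k. \<delta> * mu k \<le> pairing \<iota> (S (e k)) (haar_fn k)"
    and g: "g \<in> haar_span" "\<And>t. g t * g t = g t"
    and Y: "finite Y" "Y \<subseteq> haar_span" and \<eta>: "\<eta> > 0"
  obtains r where "r \<in> haar_span" "\<And>t. r t * r t = g t" "\<And>z. z \<in> step_funs k0 \<Longrightarrow> ip z r = 0"
    "\<delta> * integral\<^sup>L M01 g \<le> pairing \<iota> (S (\<iota> r)) r"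
    "\<And>y. y \<in> Y \<Longrightarrow> \<bar>pairing \<iota> (S (\<iota> y)) r\<bar> \<le> \<eta>"
    "\<And>y. y \<in> Y \<Longrightarrow> \<bar>pairing \<iota> (S (\<iota> r)) y\<bar> \<le> \<eta>"
proof -
  interpret S: bounded_linear S by (rule S)
  obtain n1 where n1: "g \<in> step_funs n1" using g(1) by (auto simp: haar_span_eq_steps)
  have ev1: "\<forall>\<^sub>F n in sequentially. \<forall>y\<in>Y. (\<Sum>k\<in>{2 ^ n..<2 ^ Suc n}. \<bar>pairing \<iota> (S (\<iota> y)) (haar_fn k)\<bar>) < \<eta>"
    using order_tendstoD(2)[OF pairing_level_sums_tendsto_0 \<eta>] Y(1) by (intro eventually_ball_finite) auto
  have ev2: "\<forall>\<^sub>F n in sequentially. \<forall>y\<in>Y. (\<Sum>k\<in>{2 ^ n..<2 ^ Suc n}. \<bar>pairing \<iota> (S (e k)) y\<bar>) < \<eta>"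
  proof (intro eventually_ball_finite Y(1) ballI)
    fix y assume "y \<in> Y"
    then have "y \<in> haar_span" using Y(2) by auto
    then have "bounded_linear (\<lambda>x. pairing \<iota> (S x) y)"
      by (intro bounded_linear_compose[OF pairing_bounded_linear S])
    from order_tendstoD(2)[OF functional_level_sums_tendsto_0[OF wn this] \<eta>]
    show "\<forall>\<^sub>F n in sequentially. (\<Sum>k\<in>{2 ^ n..<2 ^ Suc n}. \<bar>pairing \<iota> (S (e k)) y\<bar>) < \<eta>" .
  qed
  have "\<exists>n. n \<ge> max k0 n1 \<and> (\<forall>y\<in>Y. (\<Sum>k\<in>{2 ^ n..<2 ^ Suc n}. \<bar>pairing \<iota> (S (\<iota> y)) (haar_fn k)\<bar>) < \<eta>)
      \<and> (\<forall>y\<in>Y. (\<Sum>k\<in>{2 ^ n..<2 ^ Suc n}. \<bar>pairing \<iota> (S (e k)) y\<bar>) < \<eta>)"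
    using eventually_conj[OF eventually_ge_at_top[of "max k0 n1"] eventually_conj[OF ev1 ev2]]
    by (rule eventually_happens'[OF sequentially_bot])
  then obtain n where n: "n \<ge> k0" "n \<ge> n1"
    and small1: "\<And>y. y \<in> Y \<Longrightarrow> (\<Sum>k\<in>{2 ^ n..<2 ^ Suc n}. \<bar>pairing \<iota> (S (\<iota> y)) (haar_fn k)\<bar>) < \<eta>"
    and small2: "\<And>y. y \<in> Y \<Longrightarrow> (\<Sum>k\<in>{2 ^ n..<2 ^ Suc n}. \<bar>pairing \<iota> (S (e k)) y\<bar>) < \<eta>" by auto
  have "g \<in> step_funs n" using n1 steps_mono[OF n(2)] by blast
  then obtain \<gamma> where \<gamma>: "g = step_fun n \<gamma>" by (auto simp: step_funs_def)
  have "step_fun n (\<lambda>i. \<gamma> i * \<gamma> i) = step_fun n \<gamma>"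
    using g(2) unfolding \<gamma> step_linear(4)[symmetric] by (simp add: fun_eq_iff)
  then have \<gamma>_idem: "\<gamma> i * \<gamma> i = \<gamma> i" if "i < 2 ^ n" for i using that by (rule step_eqD)
  let ?Q = "{2 ^ n..<(2::nat) ^ Suc n}"
  \<comment> \<open>\<open>d k\<close> is \<open>1\<close> if the support of \<open>haar_fn k\<close> lies in the support of \<open>g\<close>, and \<open>0\<close> otherwise.\<close>
  define d where "d k = \<gamma> (k - 2 ^ n)" for k
  have d_idem: "d k * d k = d k" if "k \<in> ?Q" for k
  proof -
    have "k - 2 ^ n < 2 ^ n" using that by auto
    then show ?thesis unfolding d_def by (rule \<gamma>_idem)
  qed
  then have d01: "d k = 0 \<or> d k = 1" if "k \<in> ?Q" for k using that by force
  obtain \<epsilon> where \<epsilon>: "\<And>k. \<bar>\<epsilon> k\<bar> = (1::real)"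
    "(\<Sum>k\<in>?Q. d k * d k * pairing \<iota> (S (e k)) (haar_fn k))
      \<le> (\<Sum>k\<in>?Q. \<Sum>l\<in>?Q. \<epsilon> k * \<epsilon> l * (d k * d l * pairing \<iota> (S (e k)) (haar_fn l)))"
    using good_signs_exist[of ?Q "\<lambda>k l. d k * d l * pairing \<iota> (S (e k)) (haar_fn l)"] by auto
  define c where "c k = \<epsilon> k * d k" for k
  have c1: "\<bar>c k\<bar> \<le> 1" if "k \<in> ?Q" for k using d01[OF that] \<epsilon>(1)[of k] by (auto simp: c_def abs_mult)
  define r where "r t = (\<Sum>k\<in>?Q. c k * haar_fn k t)" for t
  have r_eq: "r = (\<lambda>t. \<Sum>k\<in>?Q. c k * haar_fn k t)" by (simp add: r_def[abs_def])
  have rZ: "r \<in> haar_span"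
    unfolding r_eq by (intro haar_span_sum haar_span_scale haar_fn_in_haar_span)
  have r_sq: "r t * r t = g t" for t
  proof (cases "0 \<le> t \<and> t < 1")
    case True
    then have rt: "r t = c (2 ^ n + cell n t) * haar_fn (2 ^ n + cell n t) t"
      unfolding r_def by (intro level_sum) auto
    have "\<epsilon> k * \<epsilon> k = 1" for k using \<epsilon>(1)[of k] by (metis abs_mult_self_eq mult_1)
    then have "c (2 ^ n + cell n t) * c (2 ^ n + cell n t) = d (2 ^ n + cell n t) * d (2 ^ n + cell n t)"
      by (simp add: c_def mult.assoc mult.left_commute[of "\<epsilon> _" "d _"])
    also have "\<dots> = g t" using True by (simp add: d_def \<gamma>_idem cell_less \<gamma> step_fun_def)
    finally have "c (2 ^ n + cell n t) * c (2 ^ n + cell n t) = g t" .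
    moreover have "haar_fn (2 ^ n + cell n t) t * haar_fn (2 ^ n + cell n t) t = 1"
      using True by (intro haar_fn_at_node) auto
    moreover have "r t * r t = (c (2 ^ n + cell n t) * c (2 ^ n + cell n t))
        * (haar_fn (2 ^ n + cell n t) t * haar_fn (2 ^ n + cell n t) t)"
      unfolding rt by (simp only: mult_ac)
    ultimately show ?thesis by simp
  next
    case False
    then show ?thesis by (auto simp: r_def haar_fn_outside \<gamma> step_fun_def)
  qed
  have orth: "ip z r = 0" if "z \<in> step_funs k0" for z
  proof -
    have z: "z \<in> step_funs n" using that steps_mono[OF n(1)] by blast
    show ?thesis
      unfolding r_eq using steps_subset_haar_span[OF z]
      by (subst ip_sum) (auto intro: haar_span_scale haar_fn_in_haar_span simp: ip_scale ip_step_haar_fn_eq_0[OF z])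
  qed
  have \<iota>r: "\<iota> r = (\<Sum>k\<in>?Q. c k *\<^sub>R e k)"
    unfolding r_eq by (subst \<iota>_sum) (auto intro: haar_span_scale haar_fn_in_haar_span simp: \<iota>_scale haar_fn_in_haar_span)
  have pair_left: "pairing \<iota> (S (\<iota> r)) y = (\<Sum>k\<in>?Q. c k * pairing \<iota> (S (e k)) y)" if y: "y \<in> haar_span" for y
  proof -
    interpret py: bounded_linear "\<lambda>x. pairing \<iota> x y" by (rule pairing_bounded_linear[OF y])
    show ?thesis unfolding \<iota>r S.sum S.scaleR py.sum py.scaleR by simp
  qed
  have pair_right: "pairing \<iota> x r = (\<Sum>k\<in>?Q. c k * pairing \<iota> x (haar_fn k))" for x
    unfolding r_eq by (rule pairing_sum_right) (rule haar_fn_in_haar_span)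
  have abs_small: "\<bar>\<Sum>k\<in>?Q. c k * b k\<bar> \<le> (\<Sum>k\<in>?Q. \<bar>b k\<bar>)" for b
    using c1 by (intro order_trans[OF sum_abs sum_mono]) (simp add: abs_mult mult_left_le_one_le)
  have int_g: "integral\<^sup>L M01 g = (\<Sum>k\<in>?Q. d k * mu k)"
  proof -
    have "integral\<^sup>L M01 g = (\<Sum>i<2 ^ n. \<gamma> i * (1 / 2 ^ n))"
      unfolding \<gamma> step_integral by (simp add: sum_divide_distrib)
    also have "\<dots> = (\<Sum>k\<in>?Q. d k * mu k)"
      by (rule sum.reindex_bij_witness[of _ "\<lambda>k. k - 2 ^ n" "\<lambda>i. 2 ^ n + i"])
        (auto simp: d_def mu_def floor_log_node)
    finally show ?thesis .
  qed
  have "\<delta> * integral\<^sup>L M01 g = (\<Sum>k\<in>?Q. d k * d k * (\<delta> * mu k))"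
    unfolding int_g sum_distrib_left by (rule sum.cong) (auto simp: d_idem)
  also have "\<dots> \<le> (\<Sum>k\<in>?Q. d k * d k * pairing \<iota> (S (e k)) (haar_fn k))"
    by (intro sum_mono mult_left_mono diag) simp
  also have "\<dots> \<le> (\<Sum>k\<in>?Q. \<Sum>l\<in>?Q. \<epsilon> k * \<epsilon> l * (d k * d l * pairing \<iota> (S (e k)) (haar_fn l)))"
    by (rule \<epsilon>(2))
  also have "\<dots> = pairing \<iota> (S (\<iota> r)) r"
  proof -
    have "pairing \<iota> (S (\<iota> r)) r = (\<Sum>k\<in>?Q. c k * (\<Sum>l\<in>?Q. c l * pairing \<iota> (S (e k)) (haar_fn l)))"
      unfolding pair_left[OF rZ] by (intro sum.cong refl arg_cong2[where f="(*)"] pair_right)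
    then show ?thesis unfolding sum_distrib_left by (simp add: c_def mult_ac)
  qed
  finally have "\<delta> * integral\<^sup>L M01 g \<le> pairing \<iota> (S (\<iota> r)) r" .
  moreover have "\<bar>pairing \<iota> (S (\<iota> y)) r\<bar> \<le> \<eta>" if "y \<in> Y" for y
    unfolding pair_right using abs_small small1[OF that] by (meson less_imp_le order_trans)
  moreover have "\<bar>pairing \<iota> (S (\<iota> r)) y\<bar> \<le> \<eta>" if y: "y \<in> Y" for y
    unfolding pair_left[OF subsetD[OF Y(2) y]] using abs_small small2[OF y] by (meson less_imp_le order_trans)
  ultimately show thesis using rZ r_sq orth by (intro that[of r]) auto
qed

text \<open>The predicate \<open>P F k r\<close> says that \<open>r\<close> may follow the blocks \<open>F
  l\<close> with \<open>l < k\<close> as block number \<open>k\<close>.\<close>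

lemma block_system_exists:
  fixes S :: "'f \<Rightarrow> 'f" and \<eta> :: "nat \<Rightarrow> real"
  assumes wn: "weakly_null (\<lambda>n. \<iota> (rademacher (Suc n)))"
    and S: "bounded_linear S"
    and diag: "\<And>k. \<delta> * mu k \<le> pairing \<iota> (S (e k)) (haar_fn k)"
    and \<eta>: "\<And>k. \<eta> k > 0"
  obtains F where "F 0 = step_fun 0 (\<lambda>_. 1)" "\<And>k. F k \<in> haar_span"
    "\<And>k z. 1 \<le> k \<Longrightarrow> z \<in> step_funs k \<Longrightarrow> ip z (F k) = 0"
    "\<And>k t. 1 \<le> k \<Longrightarrow> F k t * F k t = block_indicator F k t"
    "\<And>k. 1 \<le> k \<Longrightarrow> \<delta> * integral\<^sup>L M01 (block_indicator F k) \<le> pairing \<iota> (S (\<iota> (F k))) (F k)"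
    "\<And>k l. l < k \<Longrightarrow> \<bar>pairing \<iota> (S (\<iota> (F l))) (F k)\<bar> \<le> \<eta> k"
    "\<And>k l. l < k \<Longrightarrow> \<bar>pairing \<iota> (S (\<iota> (F k))) (F l)\<bar> \<le> \<eta> k"
proof -
  define P where "P F k r \<longleftrightarrow> (if k = 0 then r = step_fun 0 (\<lambda>_. 1) else
      r \<in> haar_span \<and> (\<forall>z\<in>step_funs k. ip z r = 0) \<and>
      (\<forall>t. r t * r t = block_indicator F k t) \<and>
      \<delta> * integral\<^sup>L M01 (block_indicator F k) \<le> pairing \<iota> (S (\<iota> r)) r \<and>
      (\<forall>l<k. \<bar>pairing \<iota> (S (\<iota> (F l))) r\<bar> \<le> \<eta> k \<and> \<bar>pairing \<iota> (S (\<iota> r)) (F l)\<bar> \<le> \<eta> k))"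
    for F :: "nat \<Rightarrow> real \<Rightarrow> real" and k :: nat and r :: "real \<Rightarrow> real"
  have "\<exists>F. \<forall>k. P F k (F k)"
  proof (rule dependent_wellorder_choice)
    fix r and F F' :: "nat \<Rightarrow> real \<Rightarrow> real" and k :: nat
    assume *: "\<And>l. l < k \<Longrightarrow> F l = F' l"
    have "block_indicator F k = block_indicator F' k" using * by (rule block_indicator_cong)
    then show "P F k r = P F' k r" using * unfolding P_def by simp
  next
    fix k :: nat and F :: "nat \<Rightarrow> real \<Rightarrow> real"
    assume IH: "\<And>l. l < k \<Longrightarrow> P F l (F l)"
    show "\<exists>r. P F k r"
    proof (cases "k = 0")
      case True
      then show ?thesis by (simp add: P_def)
    next
      case False
      then have k: "1 \<le> k" by simp
      have FZ: "F l \<in> haar_span" if "l < k" for l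
        using IH[OF that] step_in_haar_span unfolding P_def by (simp split: if_splits)
      have Fsq: "F l \<in> haar_span \<and> (\<forall>t. F l t * F l t = block_indicator F l t)" if "1 \<le> l" "l < k" for l
        using IH[OF that(2)] FZ[OF that(2)] that(1) unfolding P_def by simp
      have g: "block_indicator F k \<in> haar_span" "\<And>t. block_indicator F k t * block_indicator F k t = block_indicator F k t"
        using block_indicator_idempotent[OF Fsq k] by auto
      have Y: "finite (F ` {..<k})" "F ` {..<k} \<subseteq> haar_span" using FZ by auto
      obtain r where r: "r \<in> haar_span" "\<And>t. r t * r t = block_indicator F k t"
        "\<And>z. z \<in> step_funs k \<Longrightarrow> ip z r = 0"
        "\<delta> * integral\<^sup>L M01 (block_indicator F k) \<le> pairing \<iota> (S (\<iota> r)) r"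
        "\<And>y. y \<in> F ` {..<k} \<Longrightarrow> \<bar>pairing \<iota> (S (\<iota> y)) r\<bar> \<le> \<eta> k"
        "\<And>y. y \<in> F ` {..<k} \<Longrightarrow> \<bar>pairing \<iota> (S (\<iota> r)) y\<bar> \<le> \<eta> k"
        by (rule block_exists[OF wn S diag g Y \<eta>[of k], of k]) (rule that)
      have "P F k r" using False r unfolding P_def by simp
      then show ?thesis by blast
    qed
  qed
  then obtain F where F: "\<And>k. P F k (F k)" by blast
  show thesis
  proof (rule that[of F])
    show "F 0 = step_fun 0 (\<lambda>_. 1)" using F[of 0] by (simp add: P_def)
    fix k l :: nat and t :: real
    show "F k \<in> haar_span" using F[of k] step_in_haar_span unfolding P_def by (simp split: if_splits)
    show "ip z (F k) = 0" if "1 \<le> k" "z \<in> step_funs k" for z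
      using F[of k] that unfolding P_def by simp
    show "F k t * F k t = block_indicator F k t"
      "\<delta> * integral\<^sup>L M01 (block_indicator F k) \<le> pairing \<iota> (S (\<iota> (F k))) (F k)" if "1 \<le> k"
      using F[of k] that unfolding P_def by simp_all
    show "\<bar>pairing \<iota> (S (\<iota> (F l))) (F k)\<bar> \<le> \<eta> k" "\<bar>pairing \<iota> (S (\<iota> (F k))) (F l)\<bar> \<le> \<eta> k" if "l < k"
      using F[of k] that unfolding P_def by (simp_all split: if_splits)
  qed
qed

end

section \<open>The copy of the Haar system spanned by the blocks\<close>

locale block_system = haar_space N \<iota> for N and \<iota> :: "(real \<Rightarrow> real) \<Rightarrow> 'f::banach" +
  fixes F :: "nat \<Rightarrow> real \<Rightarrow> real"
  assumes F_root: "F 0 = step_fun 0 (\<lambda>_. 1)"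
    and F_in_haar_span: "\<And>k. F k \<in> haar_span"
    and F_orthogonal: "\<And>k z. 1 \<le> k \<Longrightarrow> z \<in> step_funs k \<Longrightarrow> ip z (F k) = 0"
    and F_square: "\<And>k t. 1 \<le> k \<Longrightarrow> F k t * F k t = block_indicator F k t"
begin

abbreviation supp :: "nat \<Rightarrow> real \<Rightarrow> real" where "supp k \<equiv> block_indicator F k"

lemma ip_F_eq_0:
  assumes "1 \<le> k" "m \<le> k" "f \<in> step_funs m" shows "ip f (F k) = 0"
  using F_orthogonal[OF assms(1)] steps_mono[OF assms(2)] assms(3) by blast

lemma supp_facts:
  assumes "1 \<le> k" shows supp_in_haar_span: "supp k \<in> haar_span" and supp_01: "supp k t = 0 \<or> supp k t = 1"
proof -
  have *: "supp k \<in> haar_span \<and> (\<forall>t. supp k t * supp k t = supp k t)"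
    using assms F_in_haar_span F_square by (intro block_indicator_idempotent) auto
  then show "supp k \<in> haar_span" by blast
  have "supp k t * supp k t = supp k t" using * by blast
  then show "supp k t = 0 \<or> supp k t = 1" by auto
qed

text \<open>A block has mean zero, so the sets where it is \<open>1\<close> and \<open>- 1\<close> each have
  half the measure of its support.\<close>

lemma integral_supp: "1 \<le> k \<Longrightarrow> integral\<^sup>L M01 (supp k) = mu k"
proof (induction k rule: less_induct)
  case (less k)
  show ?case
  proof (cases "k = 1")
    case True
    then show ?thesis by (simp add: block_indicator_root step_integral mu_def)
  next
    case False
    define p where "p = k div 2"
    have p: "1 \<le> p" "p < k" using False less.prems by (auto simp: p_def)
    have k: "k = 2 * p \<or> k = 2 * p + 1" unfolding p_def by presburger
    have int: "integrable M01 (supp p)" "integrable M01 (F p)"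
      using supp_in_haar_span[OF p(1)] F_in_haar_span by (auto intro: haar_span_integrable)
    have F0: "integral\<^sup>L M01 (F p) = 0"
    proof -
      have "integral\<^sup>L M01 (F p) = ip (step_fun 0 (\<lambda>_. 1)) (F p)"
        unfolding ip_def by (rule Bochner_Integration.integral_cong) (auto simp: step_fun_def)
      also have "\<dots> = 0" using p by (intro ip_F_eq_0[of _ 0]) auto
      finally show ?thesis .
    qed
    have "supp k = (\<lambda>t. (1/2) * (supp p t + F p t)) \<or> supp k = (\<lambda>t. (1/2) * (supp p t - F p t))"
      using k block_indicator_children[OF p(1), of F] by (auto simp only: fun_eq_iff)
    then have "integral\<^sup>L M01 (supp k) = mu p / 2"
      using less.IH[OF p(2,1)] F0 int by (elim disjE) simp_all
    also have "\<dots> = mu k"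
    proof -
      have "floor_log k = Suc (floor_log p)"
        unfolding p_def using False less.prems by (intro floor_log_rec) simp
      then show ?thesis by (simp add: mu_def)
    qed
    finally show ?thesis .
  qed
qed

lemma sum_supp: "(\<Sum>q<2 ^ m. supp (2 ^ m + q) t) = step_fun 0 (\<lambda>_. 1) t"
proof (induction m)
  case 0
  show ?case by (simp add: block_indicator_root)
next
  case (Suc m)
  have halves: "x = (1/2) * (a + b) \<Longrightarrow> y = (1/2) * (a - b) \<Longrightarrow> x + y = a" for x y a b :: real
    by (simp add: field_simps)
  have "(\<Sum>q<2 ^ Suc m. supp (2 ^ Suc m + q) t) = (\<Sum>q<2 ^ m. supp (2 ^ Suc m + 2 * q) t + supp (2 ^ Suc m + (2 * q + 1)) t)"
    using sum.nat_group[of "\<lambda>q. supp (2 ^ Suc m + q) t" 2 "2 ^ m"]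
    by (simp add: mult.commute numeral_2_eq_2 atLeast0_lessThan_Suc)
  also have "\<dots> = (\<Sum>q<2 ^ m. supp (2 ^ m + q) t)"
  proof (rule sum.cong[OF refl])
    fix q :: nat
    have 1: "1 \<le> 2 ^ m + q" using one_le_power[of "2::nat" m] by linarith
    have "2 ^ Suc m + 2 * q = 2 * (2 ^ m + q)" "2 ^ Suc m + (2 * q + 1) = 2 * (2 ^ m + q) + 1" by simp_all
    then have "supp (2 ^ Suc m + 2 * q) t = (1/2) * (supp (2 ^ m + q) t + F (2 ^ m + q) t)"
      "supp (2 ^ Suc m + (2 * q + 1)) t = (1/2) * (supp (2 ^ m + q) t - F (2 ^ m + q) t)"
      using block_indicator_children[OF 1, of F t] by (simp_all only:)
    then show "supp (2 ^ Suc m + 2 * q) t + supp (2 ^ Suc m + (2 * q + 1)) t = supp (2 ^ m + q) t"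
      using halves by blast
  qed
  finally show ?case using Suc by simp
qed

lemma supp_expansion:
  assumes "1 \<le> k" "k < 2 ^ Suc m"
  shows "supp k t = (\<Sum>j<2 ^ m. (ip (chi k) (haar_fn j) / mu j) * F j t)"
proof (rule haar_tree_expansion[where H = "\<lambda>k. supp k" and G = F, OF _ _ _ assms])
  show "supp 1 t = F 0 t" for t by (simp add: block_indicator_root F_root)
qed (rule block_indicator_children; assumption)+

text \<open>The supports of the blocks of level \<open>m\<close> partition the unit interval into sets of
  measure \<open>2\<^sup>-\<^sup>m\<close>, all of them unions of intervals of some common level
  \<open>M\<close>; the map \<open>p\<close> tells in which of the sets such an interval lies.\<close>

lemma supp_partition:
  obtains M p where "m \<le> M" "\<And>i. i < 2 ^ M \<Longrightarrow> p i < 2 ^ m"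
    "\<And>q. q < 2 ^ m \<Longrightarrow> card {i. i < 2 ^ M \<and> p i = q} = 2 ^ (M - m)"
    "\<And>q. q < 2 ^ m \<Longrightarrow> supp (2 ^ m + q) = step_fun M (\<lambda>i. of_bool (p i = q))"
proof -
  have node: "1 \<le> 2 ^ m + q" for q :: nat using one_le_power[of "2::nat" m] by linarith
  have "\<exists>n. supp (2 ^ m + q) \<in> step_funs n" for q using supp_in_haar_span[OF node] by (auto simp: haar_span_eq_steps)
  then obtain l where l: "\<And>q. supp (2 ^ m + q) \<in> step_funs (l q)" by metis
  define M where "M = Max (insert m (l ` {..<2 ^ m}))"
  have mM: "m \<le> M" unfolding M_def by (rule Max_ge) auto
  have "supp (2 ^ m + q) \<in> step_funs M" if "q < 2 ^ m" for q
  proof -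
    have "l q \<le> M" unfolding M_def using that by (intro Max_ge) auto
    then show ?thesis using l steps_mono by blast
  qed
  then have "\<exists>\<gamma>. supp (2 ^ m + q) = step_fun M \<gamma>" if "q < 2 ^ m" for q using that by (auto simp: step_funs_def)
  then obtain \<gamma> where \<gamma>: "\<And>q. q < 2 ^ m \<Longrightarrow> supp (2 ^ m + q) = step_fun M (\<gamma> q)" by metis
  have val: "step_fun M v (real i / 2 ^ M) = v i" if "i < 2 ^ M" for v i
  proof -
    have "real i < 2 ^ M" using that by (metis of_nat_less_numeral_power_cancel_iff)
    then show ?thesis by (simp add: step_fun_def cell_left_endpoint)
  qed
  have \<gamma>01: "\<gamma> q i = 0 \<or> \<gamma> q i = 1" if "q < 2 ^ m" "i < 2 ^ M" for q i
    using supp_01[OF node, of q "real i / 2 ^ M"] by (simp add: \<gamma> val that)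
  have \<gamma>sum: "(\<Sum>q<2 ^ m. \<gamma> q i) = 1" if "i < 2 ^ M" for i
  proof -
    have "(\<Sum>q<2 ^ m. \<gamma> q i) = (\<Sum>q<2 ^ m. supp (2 ^ m + q) (real i / 2 ^ M))"
      by (rule sum.cong) (simp_all add: \<gamma> val that)
    also have "\<dots> = step_fun M (\<lambda>_. 1) (real i / 2 ^ M)"
      unfolding sum_supp using step_refine[of 0 "\<lambda>_. 1" M] by simp
    finally show ?thesis by (simp add: val that)
  qed
  have ex: "\<exists>q<2 ^ m. \<forall>q'<2 ^ m. \<gamma> q' i = of_bool (q = q')" if i: "i < 2 ^ M" for i
  proof -
    have "\<exists>q<2 ^ m. \<gamma> q i = 1"
    proof (rule ccontr)
      assume "\<not> ?thesis"
      then have "(\<Sum>q<2 ^ m. \<gamma> q i) = 0" using \<gamma>01[OF _ i] by (intro sum.neutral) auto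
      with \<gamma>sum[OF i] show False by simp
    qed
    then obtain q where q: "q < 2 ^ m" "\<gamma> q i = 1" by blast
    have "\<gamma> q' i = 0" if q': "q' < 2 ^ m" "q' \<noteq> q" for q'
    proof (rule ccontr)
      assume "\<gamma> q' i \<noteq> 0"
      then have "\<gamma> q' i = 1" using \<gamma>01[OF q'(1) i] by simp
      then have "2 = (\<Sum>a\<in>{q, q'}. \<gamma> a i)" using q q' by simp
      also have "\<dots> \<le> (\<Sum>q<2 ^ m. \<gamma> q i)"
        using q q' \<gamma>01[OF _ i] by (intro sum_mono2) (auto, fastforce)
      finally show False using \<gamma>sum[OF i] by simp
    qed
    then show ?thesis using q by (intro exI[of _ q]) auto
  qed
  define p where "p i = (SOME q. q < 2 ^ m \<and> (\<forall>q'<2 ^ m. \<gamma> q' i = of_bool (q = q')))" for i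
  have p: "p i < 2 ^ m" "\<And>q. q < 2 ^ m \<Longrightarrow> \<gamma> q i = of_bool (p i = q)" if "i < 2 ^ M" for i
    using someI_ex[OF ex[OF that]] unfolding p_def[symmetric] by auto
  have supp_p: "supp (2 ^ m + q) = step_fun M (\<lambda>i. of_bool (p i = q))" if "q < 2 ^ m" for q
    unfolding \<gamma>[OF that] by (rule step_eqI) (rule p(2)[OF _ that])
  have "card {i. i < 2 ^ M \<and> p i = q} = 2 ^ (M - m)" if q: "q < 2 ^ m" for q
  proof -
    have "real (card {i. i < 2 ^ M \<and> p i = q}) / 2 ^ M = integral\<^sup>L M01 (supp (2 ^ m + q))"
      unfolding supp_p[OF q] step_integral by (simp add: of_bool_def sum.If_cases Int_def)
    also have "\<dots> = 1 / 2 ^ m" using q by (simp add: integral_supp[OF node] mu_def floor_log_node)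
    finally have "real (card {i. i < 2 ^ M \<and> p i = q}) = 2 ^ M / 2 ^ m" by (simp add: field_simps)
    also have "\<dots> = 2 ^ (M - m)" using mM by (simp add: power_diff)
    finally have "real (card {i. i < 2 ^ M \<and> p i = q}) = real (2 ^ (M - m))" by simp
    then show ?thesis by (simp only: of_nat_eq_iff)
  qed
  with mM p(1) supp_p show thesis by (intro that[of M p]) auto
qed

text \<open>By the tree expansion the map sends the indicator \<open>chi k\<close> to that of the support of
  block \<open>k\<close>. A step function of level \<open>m\<close> is thus sent to a function that takes the
  same values on sets of the same measure.\<close>

lemma block_embedding:
  obtains A where "bounded_linear A" "\<And>k. A (e k) = \<iota> (F k)"
proof (rule extend_from_haar_basis[of "\<lambda>k. \<iota> (F k)" 1])
  fix m and a :: "nat \<Rightarrow> real"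
  define f where "f t = (\<Sum>j<2 ^ m. a j * haar_fn j t)" for t
  have f_eq: "f = (\<lambda>t. \<Sum>j<2 ^ m. a j * haar_fn j t)" by (simp add: f_def[abs_def])
  have "f \<in> step_funs m" unfolding f_eq by (intro steps_sum steps_closed(4) haar_fn_in_steps) auto
  then obtain v where v: "f = step_fun m v" by (auto simp: step_funs_def)
  have Z: "chi (2 ^ m + i) \<in> haar_span" for i
    using one_le_power[of "2::nat" m] by (intro chi_in_haar_span) linarith
  have a: "a j = (\<Sum>q<2 ^ m. v q * (ip (chi (2 ^ m + q)) (haar_fn j) / mu j))" if "j < 2 ^ m" for j
  proof -
    have "ip f (haar_fn j) = (\<Sum>i<2 ^ m. a i * ip (haar_fn i) (haar_fn j))"
      unfolding f_eq by (subst ip_sum) (auto intro: haar_span_scale haar_fn_in_haar_span simp: ip_scale)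
    also have "\<dots> = (\<Sum>i<2 ^ m. if i = j then a j * mu j else 0)"
      by (rule sum.cong) (auto simp: ip_haar_fn_self ip_haar_fn_orthogonal)
    finally have "a j = ip f (haar_fn j) / mu j" using that mu_pos[of j] by simp
    also have "ip f (haar_fn j) = (\<Sum>q<2 ^ m. v q * ip (chi (2 ^ m + q)) (haar_fn j))"
      unfolding v step_eq_sum_chi by (subst ip_sum) (auto intro: haar_span_scale Z haar_fn_in_haar_span simp: ip_scale)
    finally show ?thesis by (simp add: sum_divide_distrib)
  qed
  obtain M p where p: "m \<le> M" "\<And>i. i < 2 ^ M \<Longrightarrow> p i < 2 ^ m"
    "\<And>q. q < 2 ^ m \<Longrightarrow> card {i. i < 2 ^ M \<and> p i = q} = 2 ^ (M - m)"
    "\<And>q. q < 2 ^ m \<Longrightarrow> supp (2 ^ m + q) = step_fun M (\<lambda>i. of_bool (p i = q))"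
    by (rule supp_partition[of m]) (rule that)
  have "(\<Sum>j<2 ^ m. a j * F j t) = step_fun M (\<lambda>i. v (p i)) t" for t
  proof -
    have "(\<Sum>j<2 ^ m. a j * F j t) = (\<Sum>j<2 ^ m. \<Sum>q<2 ^ m. v q * ((ip (chi (2 ^ m + q)) (haar_fn j) / mu j) * F j t))"
      by (rule sum.cong) (simp_all add: a sum_distrib_right mult.assoc)
    also have "\<dots> = (\<Sum>q<2 ^ m. v q * (\<Sum>j<2 ^ m. (ip (chi (2 ^ m + q)) (haar_fn j) / mu j) * F j t))"
      unfolding sum_distrib_left by (rule sum.swap)
    also have "\<dots> = (\<Sum>q<2 ^ m. v q * supp (2 ^ m + q) t)"
    proof (rule sum.cong[OF refl])
      fix q assume "q \<in> {..<(2::nat) ^ m}"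
      then have "supp (2 ^ m + q) t = (\<Sum>j<2 ^ m. (ip (chi (2 ^ m + q)) (haar_fn j) / mu j) * F j t)"
        using one_le_power[of "2::nat" m] by (intro supp_expansion) auto
      then show "v q * (\<Sum>j<2 ^ m. (ip (chi (2 ^ m + q)) (haar_fn j) / mu j) * F j t) = v q * supp (2 ^ m + q) t"
        by simp
    qed
    also have "\<dots> = (\<Sum>q<2 ^ m. step_fun M (\<lambda>i. v q * of_bool (p i = q)) t)"
      by (rule sum.cong) (auto simp: p(4) step_fun_def)
    also have "\<dots> = step_fun M (\<lambda>i. \<Sum>q<2 ^ m. v q * of_bool (p i = q)) t"
      by (rule fun_cong[OF step_linear(6)])
    also have "step_fun M (\<lambda>i. \<Sum>q<2 ^ m. v q * of_bool (p i = q)) = step_fun M (\<lambda>i. v (p i))"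
    proof (rule step_eqI)
      fix i :: nat assume "i < 2 ^ M"
      then have pi: "p i < 2 ^ m" by (rule p(2))
      have "(\<Sum>q<2 ^ m. v q * of_bool (p i = q)) = (\<Sum>q<2 ^ m. if p i = q then v q else 0)"
        by (rule sum.cong) auto
      then show "(\<Sum>q<2 ^ m. v q * of_bool (p i = q)) = v (p i)" using pi by simp
    qed
    finally show ?thesis .
  qed
  then have image: "(\<lambda>t. \<Sum>j<2 ^ m. a j * F j t) = step_fun M (\<lambda>i. v (p i))" by auto
  have "norm (\<Sum>j<2 ^ m. a j *\<^sub>R \<iota> (F j)) = N (\<lambda>t. \<Sum>j<2 ^ m. a j * F j t)"
    by (subst norm_\<iota>[symmetric])
      (auto intro!: haar_span_sum haar_span_scale F_in_haar_span simp: \<iota>_sum haar_span_scale F_in_haar_span \<iota>_scale)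
  also have "\<dots> = N f" unfolding image v using N_equal_fibres(1)[OF p(1-3)] by simp
  finally show "norm (\<Sum>j<2 ^ m. a j *\<^sub>R \<iota> (F j)) \<le> 1 * N (\<lambda>t. \<Sum>j<2 ^ m. a j * haar_fn j t)"
    by (simp add: f_eq)
qed (rule that)

text \<open>For a step function \<open>f\<close> the tree expansion shows that the value of
  \<open>\<Sum>k<2\<^sup>m. (\<langle>f, F k\<rangle> / \<mu> k) h k\<close> on the dyadic interval number
  \<open>q\<close> of level \<open>m\<close> is the mean of \<open>f\<close> over the support of block
  \<open>2\<^sup>m + q\<close>. Such averaging does not increase the norm.\<close>

lemma block_averaging:
  obtains B where "bounded_linear B" "\<And>j y. coef j (B y) = pairing \<iota> y (F j) / mu j"
proof -
  define \<phi> where "\<phi> f = (\<Sum>k | ip f (F k) \<noteq> 0. (ip f (F k) / mu k) *\<^sub>R e k)" for f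
  have zero: "ip f (F k) = 0" if "f \<in> step_funs n" "2 ^ n \<le> k" for f n k
  proof (rule ip_F_eq_0[OF _ _ that(1)])
    show "1 \<le> k" using that(2) one_le_power[of "2::nat" n] by linarith
    show "n \<le> k" using that(2) less_exp[of n] by linarith
  qed
  have \<phi>: "\<phi> f = (\<Sum>k<2 ^ n. (ip f (F k) / mu k) *\<^sub>R e k)" if f: "f \<in> step_funs n" for f n
    unfolding \<phi>_def
  proof (rule sum.mono_neutral_left)
    show "{k. ip f (F k) \<noteq> 0} \<subseteq> {..<2 ^ n}"
    proof (rule subsetI, rule ccontr)
      fix k assume "k \<in> {k. ip f (F k) \<noteq> 0}" "k \<notin> {..<2 ^ n}"
      then show False using zero[OF f, of k] by simp
    qed
  qed auto
  have contraction: "norm (\<phi> f) \<le> 1 * N f" if fZ: "f \<in> haar_span" for f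
  proof -
    obtain m where m: "f \<in> step_funs m" using fZ by (auto simp: haar_span_eq_steps)
    obtain M p where p: "m \<le> M" "\<And>i. i < 2 ^ M \<Longrightarrow> p i < 2 ^ m"
      "\<And>q. q < 2 ^ m \<Longrightarrow> card {i. i < 2 ^ M \<and> p i = q} = 2 ^ (M - m)"
      "\<And>q. q < 2 ^ m \<Longrightarrow> supp (2 ^ m + q) = step_fun M (\<lambda>i. of_bool (p i = q))"
      by (rule supp_partition[of m]) (rule that)
    obtain w where w: "f = step_fun M w" using m steps_mono[OF p(1)] by (auto simp: step_funs_def)
    define W where "W q = (\<Sum>i | i < 2 ^ M \<and> p i = q. w i)" for q
    define b where "b t = (\<Sum>k<2 ^ m. (ip f (F k) / mu k) * haar_fn k t)" for t
    have b_eq: "b = (\<lambda>t. \<Sum>k<2 ^ m. (ip f (F k) / mu k) * haar_fn k t)" by (simp add: b_def[abs_def])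
    have bm: "b \<in> step_funs m" unfolding b_eq by (intro steps_sum steps_closed(4) haar_fn_in_steps) auto
    then obtain u where u: "b = step_fun m u" by (auto simp: step_funs_def)
    have "u q = (1 / 2 ^ (M - m)) * W q" if q: "q < 2 ^ m" for q
    proof -
      have node: "1 \<le> 2 ^ m + q" "2 ^ m + q < 2 ^ Suc m" using q one_le_power[of "2::nat" m] by simp_all
      have "real q < 2 ^ m" using q by (metis of_nat_less_numeral_power_cancel_iff)
      then have "u q = b (real q / 2 ^ m)" by (simp add: u step_fun_def cell_left_endpoint)
      also have "\<dots> = 2 ^ m * (\<Sum>k<2 ^ m. (ip (chi (2 ^ m + q)) (haar_fn k) / mu k) * ip f (F k))"
        unfolding b_def sum_distrib_left
      proof (rule sum.cong[OF refl])
        fix k assume "k \<in> {..<(2::nat) ^ m}"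
        then have "ip (haar_fn k) (chi (2 ^ m + q)) = haar_fn k (real q / 2 ^ m) / 2 ^ m"
          using q by (intro ip_chi haar_fn_in_steps) auto
        then have "haar_fn k (real q / 2 ^ m) = 2 ^ m * ip (chi (2 ^ m + q)) (haar_fn k)"
          by (simp add: ip_commute[of "haar_fn k"])
        then show "(ip f (F k) / mu k) * haar_fn k (real q / 2 ^ m)
            = 2 ^ m * ((ip (chi (2 ^ m + q)) (haar_fn k) / mu k) * ip f (F k))" by simp
      qed
      also have "(\<Sum>k<2 ^ m. (ip (chi (2 ^ m + q)) (haar_fn k) / mu k) * ip f (F k)) = ip f (supp (2 ^ m + q))"
      proof -
        have supp_eq: "supp (2 ^ m + q) = (\<lambda>t. \<Sum>k<2 ^ m. (ip (chi (2 ^ m + q)) (haar_fn k) / mu k) * F k t)"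
          by (rule ext) (rule supp_expansion[OF node])
        have "ip f (supp (2 ^ m + q)) = (\<Sum>k<2 ^ m. ip f (\<lambda>t. (ip (chi (2 ^ m + q)) (haar_fn k) / mu k) * F k t))"
          unfolding supp_eq by (intro ip_sum(2) haar_span_scale F_in_haar_span fZ)
        then show ?thesis by (simp only: ip_scale)
      qed
      also have "ip f (supp (2 ^ m + q)) = W q / 2 ^ M"
      proof -
        have "(\<Sum>i<2 ^ M. w i * of_bool (p i = q)) = (\<Sum>i<2 ^ M. if p i = q then w i else 0)"
          by (rule sum.cong) auto
        also have "\<dots> = W q" unfolding W_def by (simp add: sum.If_cases Int_def)
        finally show ?thesis unfolding p(4)[OF q] w ip_step by simp
      qed
      also have "2 ^ m * (W q / 2 ^ M) = (1 / 2 ^ (M - m)) * W q"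
        using p(1) by (simp add: power_diff)
      finally show ?thesis .
    qed
    then have "b = step_fun m (\<lambda>q. (1 / 2 ^ (M - m)) * W q)" unfolding u by (rule step_eqI)
    also have "\<dots> = (\<lambda>t. (1 / 2 ^ (M - m)) * step_fun m W t)" unfolding step_linear ..
    finally have "N b = \<bar>1 / 2 ^ (M - m)\<bar> * N (step_fun m W)"
      by (simp only: N_scale[OF step_in_haar_span])
    then have "N b = (1 / 2 ^ (M - m)) * N (step_fun m W)" by simp
    also have "\<dots> \<le> (1 / 2 ^ (M - m)) * (2 ^ (M - m) * N (step_fun M w))"
      using N_equal_fibres(2)[OF p(1-3), of w] unfolding W_def[abs_def]
      by (intro mult_left_mono) auto
    finally have "N b \<le> N f" unfolding w by simp
    moreover have "\<phi> f = \<iota> b"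
    proof -
      have "\<iota> b = (\<Sum>k<2 ^ m. \<iota> (\<lambda>t. (ip f (F k) / mu k) * haar_fn k t))"
        unfolding b_eq by (intro \<iota>_sum haar_span_scale haar_fn_in_haar_span)
      then show ?thesis unfolding \<phi>[OF m] by (simp only: \<iota>_scale[OF haar_fn_in_haar_span])
    qed
    ultimately show ?thesis using norm_\<iota>[OF steps_subset_haar_span[OF bm]] by simp
  qed
  obtain B where B: "bounded_linear B" "\<And>f. f \<in> haar_span \<Longrightarrow> B (\<iota> f) = \<phi> f" "\<And>x. norm (B x) \<le> 1 * norm x"
  proof (rule extend_from_haar_span[of \<phi> 1])
    fix f g :: "real \<Rightarrow> real" assume fg: "f \<in> haar_span" "g \<in> haar_span"
    then obtain n where n: "f \<in> step_funs n" "g \<in> step_funs n" by (rule haar_span_common_level)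
    show "\<phi> (\<lambda>t. f t + g t) = \<phi> f + \<phi> g"
      unfolding \<phi>[OF n(1)] \<phi>[OF n(2)] \<phi>[OF steps_closed(1)[OF n]] using fg
      by (simp add: ip_add F_in_haar_span sum.distrib[symmetric] add_divide_distrib scaleR_add_left)
  next
    fix f :: "real \<Rightarrow> real" and c assume f: "f \<in> haar_span"
    then obtain n where n: "f \<in> step_funs n" by (auto simp: haar_span_eq_steps)
    show "\<phi> (\<lambda>t. c * f t) = c *\<^sub>R \<phi> f"
      unfolding \<phi>[OF n(1)] \<phi>[OF steps_closed(4)[OF n]]
      by (simp add: ip_scale scaleR_sum_right)
  qed (rule contraction that; assumption)+
  have "coef j (B y) = pairing \<iota> y (F j) / mu j" for j y
  proof (rule eq_from_haar_span[where F="\<lambda>y. coef j (B y)"])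
    show "bounded_linear (\<lambda>y. coef j (B y))" by (rule bounded_linear_compose[OF coef_bounded_linear B(1)])
    show "bounded_linear (\<lambda>y. pairing \<iota> y (F j) / mu j)"
      using bounded_linear_compose[OF bounded_linear_divide pairing_bounded_linear[OF F_in_haar_span]] .
    fix f assume f: "f \<in> haar_span"
    then obtain n where n: "f \<in> step_funs n" by (auto simp: haar_span_eq_steps)
    interpret c: bounded_linear "coef j" by (rule coef_bounded_linear)
    have "coef j (B (\<iota> f)) = (\<Sum>k<2 ^ n. if k = j then ip f (F j) / mu j else 0)"
      unfolding B(2)[OF f] \<phi>[OF n] c.sum c.scaleR by (rule sum.cong) (auto simp: coef_e)
    also have "\<dots> = ip f (F j) / mu j" using zero[OF n, of j] by (cases "j < 2 ^ n") auto
    finally show "coef j (B (\<iota> f)) = pairing \<iota> (\<iota> f) (F j) / mu j"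
      using f by (simp add: pairing_\<iota> F_in_haar_span)
  qed
  with B(1) show thesis by (rule that)
qed

end

section \<open>The factorization theorem\<close>

context unconditional_haar_space begin

text \<open>The factor \<open>mu k\<close> in the bound compensates the growth of the coefficient functional
  \<open>coef k\<close>, whose norm is at most \<open>1 / mu k\<close>; the geometric factors make the double
  series of the entries sum to at most one half.\<close>

lemma near_identity_if_small_off_diagonal:
  assumes V: "bounded_linear V" and diag: "\<And>k. coef k (V (e k)) = 1"
    and off: "\<And>j k. j \<noteq> k \<Longrightarrow> \<bar>coef j (V (e k))\<bar> \<le> mu k / 8 * (1/2) ^ j * (1/2) ^ k"
  shows "norm (V x - x) \<le> norm x / 2"
proof -
  interpret V: bounded_linear V by (rule V)
  define R where "R x = V x - x" for x
  have R: "bounded_linear R" unfolding R_def by (intro bounded_linear_sub bounded_linear_ident V)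
  interpret R: bounded_linear R by (rule R)
  have geo: "(\<lambda>j. (1/2::real) ^ j) sums 2" using geometric_sums[of "1/2::real"] by simp
  have Re: "norm (R (e k)) \<le> mu k / 4 * (1/2) ^ k" for k
  proof -
    have cR: "\<bar>coef j (R (e k))\<bar> \<le> mu k / 8 * (1/2) ^ k * (1/2) ^ j" for j
    proof -
      interpret c: bounded_linear "coef j" by (rule coef_bounded_linear)
      have "coef j (R (e k)) = coef j (V (e k)) - of_bool (j = k)"
        by (simp only: R_def c.diff coef_e)
      then show ?thesis
        using diag[of k] off[of j k] mu_pos[of k] by (cases "j = k") (simp_all add: mult_ac)
    qed
    have s: "(\<lambda>j. mu k / 8 * (1/2) ^ k * (1/2) ^ j) sums (mu k / 8 * (1/2) ^ k * 2)"
      using geo by (rule sums_mult)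
    have le: "norm (coef j (R (e k)) *\<^sub>R e j) \<le> mu k / 8 * (1/2) ^ k * (1/2) ^ j" for j
      using mult_mono[OF cR[of j] norm_e_le_1[of j]] mu_pos[of k] by simp
    have sn: "summable (\<lambda>j. norm (coef j (R (e k)) *\<^sub>R e j))"
      by (rule summable_comparison_test'[OF sums_summable[OF s], where N=0]) (use le in auto)
    have "norm (R (e k)) = norm (\<Sum>j. coef j (R (e k)) *\<^sub>R e j)"
      using coef_expansion(1)[of "R (e k)"] by (simp add: sums_iff)
    also have "\<dots> \<le> (\<Sum>j. norm (coef j (R (e k)) *\<^sub>R e j))" by (rule summable_norm[OF sn])
    also have "\<dots> \<le> (\<Sum>j. mu k / 8 * (1/2) ^ k * (1/2) ^ j)"
      by (rule suminf_le[OF le sn sums_summable[OF s]])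
    also have "\<dots> = mu k / 4 * (1/2) ^ k" using s by (simp add: sums_iff)
    finally show ?thesis .
  qed
  have s: "(\<lambda>k. norm x / 4 * (1/2) ^ k) sums (norm x / 4 * 2)" using geo by (rule sums_mult)
  have le: "norm (coef k x *\<^sub>R R (e k)) \<le> norm x / 4 * (1/2) ^ k" for k
  proof -
    have "norm (coef k x *\<^sub>R R (e k)) \<le> (norm x / mu k) * (mu k / 4 * (1/2) ^ k)"
      using mult_mono[OF abs_coef_le[of k x] Re[of k]] mu_pos[of k] by simp
    then show ?thesis using mu_pos[of k] by simp
  qed
  have sn: "summable (\<lambda>k. norm (coef k x *\<^sub>R R (e k)))"
    by (rule summable_comparison_test'[OF sums_summable[OF s], where N=0]) (use le in auto)
  have "(\<lambda>k. R (coef k x *\<^sub>R e k)) sums R x" by (rule R.sums[OF coef_expansion(1)])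
  then have "R x = (\<Sum>k. coef k x *\<^sub>R R (e k))" by (simp add: R.scaleR sums_iff)
  also have "norm \<dots> \<le> (\<Sum>k. norm (coef k x *\<^sub>R R (e k)))" by (rule summable_norm[OF sn])
  also have "\<dots> \<le> (\<Sum>k. norm x / 4 * (1/2) ^ k)" by (rule suminf_le[OF le sn sums_summable[OF s]])
  also have "\<dots> = norm x / 2" using s by (simp add: sums_iff)
  finally show ?thesis by (simp add: R_def)
qed

text \<open>With \<open>d k\<close> the diagonal entries of \<open>B \<circ> S \<circ> A\<close>, the
  multiplier \<open>E\<close> divides the \<open>k\<close>-th coefficient by \<open>d k\<close>. Then \<open>E
  \<circ> B \<circ> S \<circ> A\<close> has a left inverse.\<close>

lemma factorization_positive_diagonal:
  assumes wn: "weakly_null (\<lambda>n. \<iota> (rademacher (Suc n)))"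
    and S: "bounded_linear S" and \<delta>: "\<delta> > 0"
    and diag: "\<And>k. \<delta> * mu k \<le> pairing \<iota> (S (e k)) (haar_fn k)"
  obtains A B :: "'f \<Rightarrow> 'f" where "bounded_linear A" "bounded_linear B" "\<And>x. B (S (A x)) = x"
proof -
  \<comment> \<open>The entry at \<open>(j, k)\<close> will be bounded by \<open>\<eta> (max j k)\<close>; the powers provide the geometric factors
    and the denominators pay for two factors \<open>1 / mu i \<le> Suc i\<close>.\<close>
  define \<eta> where "\<eta> k = \<delta> / 8 * ((1/2) ^ k * (1/2) ^ k) / (real (Suc k) * real (Suc k))" for k
  have \<eta>: "\<eta> k > 0" for k using \<delta> by (simp add: \<eta>_def)
  obtain F where F: "F 0 = step_fun 0 (\<lambda>_. 1)" "\<And>k. F k \<in> haar_span"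
    "\<And>k z. 1 \<le> k \<Longrightarrow> z \<in> step_funs k \<Longrightarrow> ip z (F k) = 0"
    "\<And>k t. 1 \<le> k \<Longrightarrow> F k t * F k t = block_indicator F k t"
    and Fdiag: "\<And>k. 1 \<le> k \<Longrightarrow> \<delta> * integral\<^sup>L M01 (block_indicator F k) \<le> pairing \<iota> (S (\<iota> (F k))) (F k)"
    and Foff: "\<And>k l. l < k \<Longrightarrow> \<bar>pairing \<iota> (S (\<iota> (F l))) (F k)\<bar> \<le> \<eta> k"
      "\<And>k l. l < k \<Longrightarrow> \<bar>pairing \<iota> (S (\<iota> (F k))) (F l)\<bar> \<le> \<eta> k"
    by (rule block_system_exists[OF wn S diag \<eta>]) (rule that)
  interpret block_system N \<iota> F by unfold_locales (rule F; assumption)+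
  obtain A where A: "bounded_linear A" "\<And>k. A (e k) = \<iota> (F k)" by (rule block_embedding) (rule that)
  obtain B where B: "bounded_linear B" "\<And>j y. coef j (B y) = pairing \<iota> y (F j) / mu j"
    by (rule block_averaging) (rule that)
  define d where "d k = pairing \<iota> (S (\<iota> (F k))) (F k) / mu k" for k
  have d: "\<delta> \<le> d k" for k
  proof -
    have "\<delta> * mu k \<le> pairing \<iota> (S (\<iota> (F k))) (F k)"
    proof (cases "k = 0")
      case True
      then show ?thesis using diag[of 0] by (simp add: F(1) haar_fn_0)
    next
      case False
      then show ?thesis using Fdiag[of k] by (simp add: integral_supp)
    qed
    then show ?thesis using mu_pos[of k] by (simp add: d_def field_simps)
  qed
  \<comment> \<open>Multipliers must be bounded by one, so the division by \<open>d k\<close> is first scaled by \<open>\<delta>\<close>.\<close>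
  obtain D where D: "bounded_linear D" "\<And>k. D (e k) = (\<delta> / d k) *\<^sub>R e k"
  proof (rule multiplier_exists[of "\<lambda>k. \<delta> / d k"])
    show "\<bar>\<delta> / d k\<bar> \<le> 1" for k using d[of k] \<delta> by simp
  qed (rule that)
  interpret D: bounded_linear D by (rule D(1))
  define E where "E x = (1 / \<delta>) *\<^sub>R D x" for x
  have E: "bounded_linear E"
    unfolding E_def by (rule bounded_linear_compose[OF bounded_linear_scaleR_right D(1)])
  have coef_E: "coef j (E y) = coef j y / d j" for j y
  proof (rule eq_from_haar_basis[where F="\<lambda>y. coef j (E y)"])
    show "bounded_linear (\<lambda>y. coef j (E y))" by (rule bounded_linear_compose[OF coef_bounded_linear E])
    show "bounded_linear (\<lambda>y. coef j y / d j)"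
      by (rule bounded_linear_compose[OF bounded_linear_divide coef_bounded_linear])
    fix k
    interpret c: bounded_linear "coef j" by (rule coef_bounded_linear)
    show "coef j (E (e k)) = coef j (e k) / d j"
      using \<delta> by (simp add: E_def D c.scaleR coef_e)
  qed
  define V where "V x = E (B (S (A x)))" for x
  have V: "bounded_linear V"
    unfolding V_def by (intro bounded_linear_compose[OF E] bounded_linear_compose[OF B(1)] bounded_linear_compose[OF S] A(1))
  have cV: "coef j (V (e k)) = pairing \<iota> (S (\<iota> (F k))) (F j) / mu j / d j" for j k
    by (simp add: V_def coef_E B(2) A(2))
  have "norm (V x - x) \<le> norm x / 2" for x
  proof (rule near_identity_if_small_off_diagonal[OF V])
    show "coef k (V (e k)) = 1" for k
    proof -
      have "coef k (V (e k)) = d k / d k" by (simp only: cV d_def)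
      then show ?thesis using d[of k] \<delta> by simp
    qed
  next
    fix j k :: nat assume jk: "j \<noteq> k"
    let ?m = "max j k"
    have "\<bar>pairing \<iota> (S (\<iota> (F k))) (F j)\<bar> \<le> \<eta> ?m"
      using jk Foff(1)[of k j] Foff(2)[of j k] by (cases "j < k") (auto simp: max_def)
    also have "\<dots> \<le> \<delta> / 8 * ((1/2) ^ j * (1/2) ^ k) / (real (Suc j) * real (Suc k))"
      unfolding \<eta>_def using \<delta>
      by (intro frac_le mult_left_mono mult_mono power_decreasing) auto
    also have "\<dots> \<le> \<delta> / 8 * ((1/2) ^ j * (1/2) ^ k) * (mu j * mu k)"
    proof -
      have inv: "1 / real (Suc i) \<le> mu i" for i
        using mu_inverse_le[of i] mu_pos[of i] by (simp add: field_simps)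
      have "1 / real (Suc j) * (1 / real (Suc k)) \<le> mu j * mu k"
        using mu_pos[of j] by (intro mult_mono inv) auto
      then have "\<delta> / 8 * ((1/2) ^ j * (1/2) ^ k) * (1 / real (Suc j) * (1 / real (Suc k)))
          \<le> \<delta> / 8 * ((1/2) ^ j * (1/2) ^ k) * (mu j * mu k)"
        using \<delta> by (intro mult_left_mono) auto
      then show ?thesis by simp
    qed
    finally have P: "\<bar>pairing \<iota> (S (\<iota> (F k))) (F j)\<bar> \<le> \<delta> / 8 * ((1/2) ^ j * (1/2) ^ k) * (mu j * mu k)" .
    have "\<bar>coef j (V (e k))\<bar> = \<bar>pairing \<iota> (S (\<iota> (F k))) (F j)\<bar> / (mu j * d j)"
      using d[of j] \<delta> mu_pos[of j] by (simp add: cV abs_divide)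
    also have "\<dots> \<le> \<bar>pairing \<iota> (S (\<iota> (F k))) (F j)\<bar> / (mu j * \<delta>)"
      using d[of j] \<delta> mu_pos[of j] by (intro divide_left_mono mult_left_mono mult_pos_pos) auto
    also have "\<dots> \<le> (\<delta> / 8 * ((1/2) ^ j * (1/2) ^ k) * (mu j * mu k)) / (mu j * \<delta>)"
      using \<delta> mu_pos[of j] by (intro divide_right_mono P) auto
    also have "\<dots> = mu k / 8 * (1/2) ^ j * (1/2) ^ k"
      using \<delta> mu_pos[of j] by (simp add: field_simps)
    finally show "\<bar>coef j (V (e k))\<bar> \<le> mu k / 8 * (1/2) ^ j * (1/2) ^ k" .
  qed
  then obtain W where W: "bounded_linear W" "\<And>x. W (V x) = x"
    by (rule neumann_left_inverse[OF V]) (rule that)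
  have "bounded_linear (\<lambda>y. W (E (B y)))"
    by (intro bounded_linear_compose[OF W(1)] bounded_linear_compose[OF E] B(1))
  then show thesis using W(2) A(1) by (intro that[of A "\<lambda>y. W (E (B y))"]) (auto simp: V_def)
qed

end

theorem corollary4p1:
  fixes N :: "(real \<Rightarrow> real) \<Rightarrow> real"
    and \<iota> :: "(real \<Rightarrow> real) \<Rightarrow> 'f::banach"
    and T :: "'f \<Rightarrow> 'f"
    and \<delta> :: real
  assumes "haar_system_space N \<iota>"
    and "unconditional_schauder_basis (\<lambda>j. \<iota> (haar_seq (Suc j)))"
    and "weakly_null (\<lambda>n. \<iota> (rademacher (Suc n)))"
    and "\<delta> > 0"
    and "bounded_linear T"
    and "\<And>j. j \<ge> 1 \<Longrightarrow>
           \<bar>pairing \<iota> (T (\<iota> (haar_seq j))) (haar_seq j)\<bar>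
             \<ge> \<delta> * norm (\<iota> (haar_seq j)) * dual_norm \<iota> (haar_seq j)"
  shows "\<exists>A B :: 'f \<Rightarrow> 'f. bounded_linear A \<and> bounded_linear B \<and> B \<circ> T \<circ> A = id"
proof -
  interpret haar_space N \<iota> by unfold_locales (rule assms(1))
  interpret unconditional_haar_space N \<iota>
    by unfold_locales (use assms(2) in \<open>simp add: haar_fn_def[abs_def]\<close>)
  have T_diag: "\<delta> * mu k \<le> \<bar>pairing \<iota> (T (e k)) (haar_fn k)\<bar>" for k
  proof -
    have "\<delta> * mu k \<le> \<delta> * (norm (e k) * dual_norm \<iota> (haar_fn k))"
      using assms(4) by (intro mult_left_mono mu_le_norm_times_dual_norm) auto
    also have "\<dots> \<le> \<bar>pairing \<iota> (T (e k)) (haar_fn k)\<bar>"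
      using assms(6)[of "Suc k"] by (simp add: haar_fn_def mult.assoc)
    finally show ?thesis .
  qed
  \<comment> \<open>Changing signs before \<open>T\<close> makes the diagonal positive; the sign change is absorbed into \<open>A\<close>.\<close>
  obtain M where M: "bounded_linear M" "\<And>k. M (e k) = sgn (pairing \<iota> (T (e k)) (haar_fn k)) *\<^sub>R e k"
    by (rule multiplier_exists[of "\<lambda>k. sgn (pairing \<iota> (T (e k)) (haar_fn k))"]) (simp add: abs_sgn_eq, rule that)
  have TM: "bounded_linear (\<lambda>x. T (M x))" by (rule bounded_linear_compose[OF assms(5) M(1)])
  have TM_diag: "\<delta> * mu k \<le> pairing \<iota> (T (M (e k))) (haar_fn k)" for k
  proof -
    interpret T: bounded_linear T by (rule assms(5))
    interpret p: bounded_linear "\<lambda>x. pairing \<iota> x (haar_fn k)" by (rule pairing_bounded_linear[OF haar_fn_in_haar_span])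
    show ?thesis using T_diag[of k] by (simp add: M(2) T.scaleR p.scaleR abs_sgn mult.commute)
  qed
  show ?thesis
  proof (rule factorization_positive_diagonal[OF assms(3) TM assms(4) TM_diag])
    fix A B :: "'f \<Rightarrow> 'f"
    assume AB: "bounded_linear A" "bounded_linear B" "\<And>x. B (T (M (A x))) = x"
    have "bounded_linear (\<lambda>x. M (A x))" by (rule bounded_linear_compose[OF M(1) AB(1)])
    moreover have "B \<circ> T \<circ> (\<lambda>x. M (A x)) = id" using AB(3) by (simp add: fun_eq_iff)
    ultimately show ?thesis using AB(2) by blast
  qed
qed

end
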